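(* Let $d\ge 3$ and let $C=[C_{i_1,\ldots,i_d}]$, $(i_1,\ldots,i_d)\in[n]^d$, have independent entries, each exponentially distributed with mean $1$. Let $Z^{(d)}_A$ denote the minimum of $C(T)=\sum_{(i_1,\ldots,i_d)\in T}C_{i_1,\ldots,i_d}$ over all $d$-dimensional axial assignments $T$. Then: (a) $Z^{(d)}_A=\Omega(n^{d-2})$ with high probability, for every $d\ge 3$; (b) when $d=3$ there is a polynomial time algorithm that finds an axial assignment of cost $Z$ where $Z=O(n\log n)$ with high probability.
   Context: A line in $[n]^d$ is a set of the form $\{i_1\}\times\cdots\times\{i_r\}\times[n]\times\{i_{r+2}\}\times\cdots\times\{i_d\}$ for some $r$ and fixed $i_1,\ldots,i_r,i_{r+2},\ldots,i_d\in[n]$. A $d$-dimensional axial assignment is a set $T$ of $n^{d-1}$ $d$-tuples such that each of the $dn^{d-1}$ lines contains exactly one tuple of $T$. "With high probability" means with probability tending to $1$ as $n\to\infty$. *)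

theory Defs
  imports "HOL-Probability.Probability"
begin

section \<open>Axial assignments\<close>

text \<open>The index set $[n]^d$ is represented by lists of length $d$ over $\{1,\ldots,n\}$.\<close>

definition cube :: "nat \<Rightarrow> nat \<Rightarrow> nat list set" where
  "cube d n = {x. length x = d \<and> set x \<subseteq> {1..n}}"

definition axis_lines :: "nat \<Rightarrow> nat \<Rightarrow> nat list set set" where
  "axis_lines d n = {(\<lambda>j. x[r := j]) ` {1..n} | x r. x \<in> cube d n \<and> r < d}"

definition axial_assignments :: "nat \<Rightarrow> nat \<Rightarrow> nat list set set" where
  "axial_assignments d n =
     {T. T \<subseteq> cube d n \<and> card T = n ^ (d - 1) \<and> (\<forall>L\<in>axis_lines d n. \<exists>!x. x \<in> T \<inter> L)}"

definition assignment_cost :: "(nat list \<Rightarrow> real) \<Rightarrow> nat list set \<Rightarrow> real" where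
  "assignment_cost C T = (\<Sum>x\<in>T. C x)"

lemma finite_cube: "finite (cube d n)"
  using finite_lists_length_eq[of "{1..n}" d] by (simp add: cube_def conj_commute)

lemma finite_axial_assignments: "finite (axial_assignments d n)"
  by (rule finite_subset[of _ "Pow (cube d n)"]) (auto simp: axial_assignments_def finite_cube)

text \<open>For \<open>d \<ge> 1\<close> and \<open>n \<ge> 1\<close> the minimum is over a nonempty set: the tuples whose sum is
  divisible by \<open>n\<close> form an axial assignment.\<close>

definition Z_A :: "nat \<Rightarrow> nat \<Rightarrow> (nat list \<Rightarrow> real) \<Rightarrow> real" where
  "Z_A d n C = Min (assignment_cost C ` axial_assignments d n)"


section \<open>Random costs\<close>

definition iid_exp_costs :: "nat \<Rightarrow> nat \<Rightarrow> 'a measure \<Rightarrow> (nat list \<Rightarrow> 'a \<Rightarrow> real) \<Rightarrow> bool" where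
  "iid_exp_costs d n M C \<longleftrightarrow>
     prob_space M \<and>
     prob_space.indep_vars M (\<lambda>_. borel) C (cube d n) \<and>
     (\<forall>x\<in>cube d n. distributed M lborel (C x) (\<lambda>t. ennreal (exponential_density 1 t)))"

definition whp :: "(nat \<Rightarrow> 'a measure) \<Rightarrow> (nat \<Rightarrow> 'a \<Rightarrow> bool) \<Rightarrow> bool" where
  "whp M P \<longleftrightarrow> (\<lambda>n. measure (M n) {\<omega> \<in> space (M n). P n \<omega>}) \<longlonglongrightarrow> 1"


section \<open>Polynomial time algorithms on real input\<close>

text \<open>
  Algorithms are programs of a uniform, deterministic random access machine with one memory for
  natural numbers and one for real numbers.  A memory cell is addressed by an array name and a list
  of computed indices; scalars are arrays with the empty list of indices.  A program is a finite
  object, contains no real constants, and accesses real data only through addition, subtraction,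
  comparison and conversion from natural numbers.

  Every assignment and every test costs one time unit.  As there is no multiplication, no division
  and no rounding of reals, \<open>t\<close> steps increase the bit length of the numbers by \<open>O(t)\<close> only.
  Hence a polynomial bound in this unit-cost measure also gives a polynomial bound in the bit model
  on rational inputs, and, the instructions being a subset of those of the real RAM, in that model
  as well.
\<close>

type_synonym state = "(string \<Rightarrow> nat list \<Rightarrow> nat) \<times> (string \<Rightarrow> nat list \<Rightarrow> real)"

datatype nexp =
    NConst nat
  | NCell string "nexp list"
  | NAdd nexp nexp
  | NSub nexp nexp

datatype rexp =
    ROfNat nexp
  | RCell string "nexp list"
  | RAdd rexp rexp
  | RSub rexp rexp

datatype test =
    NLess nexp nexp
  | RLess rexp rexp
  | TNot test
  | TAnd test test

datatype program =
    Skip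
  | NAssign string "nexp list" nexp
  | RAssign string "nexp list" rexp
  | Seq program program
  | Cond test program program
  | Loop test program

primrec nval :: "nexp \<Rightarrow> state \<Rightarrow> nat" where
  "nval (NConst k) s = k"
| "nval (NCell a is) s = fst s a (map (\<lambda>e. nval e s) is)"
| "nval (NAdd e1 e2) s = nval e1 s + nval e2 s"
| "nval (NSub e1 e2) s = nval e1 s - nval e2 s"

primrec rval :: "rexp \<Rightarrow> state \<Rightarrow> real" where
  "rval (ROfNat e) s = real (nval e s)"
| "rval (RCell a is) s = snd s a (map (\<lambda>e. nval e s) is)"
| "rval (RAdd e1 e2) s = rval e1 s + rval e2 s"
| "rval (RSub e1 e2) s = rval e1 s - rval e2 s"

primrec tval :: "test \<Rightarrow> state \<Rightarrow> bool" where
  "tval (NLess e1 e2) s \<longleftrightarrow> nval e1 s < nval e2 s"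
| "tval (RLess e1 e2) s \<longleftrightarrow> rval e1 s < rval e2 s"
| "tval (TNot b) s \<longleftrightarrow> \<not> tval b s"
| "tval (TAnd b1 b2) s \<longleftrightarrow> tval b1 s \<and> tval b2 s"

definition write_cell ::
    "(string \<Rightarrow> nat list \<Rightarrow> 'v) \<Rightarrow> string \<Rightarrow> nat list \<Rightarrow> 'v \<Rightarrow> string \<Rightarrow> nat list \<Rightarrow> 'v" where
  "write_cell m a k v = m(a := (m a)(k := v))"

text \<open>\<open>exec p s t s'\<close>: started in \<open>s\<close>, the program \<open>p\<close> halts in \<open>s'\<close> after time \<open>t\<close>.\<close>

inductive exec :: "program \<Rightarrow> state \<Rightarrow> nat \<Rightarrow> state \<Rightarrow> bool" where
  Skip: "exec Skip s 1 s"
| NAssign: "exec (NAssign a is e) s 1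
     (write_cell (fst s) a (map (\<lambda>i. nval i s) is) (nval e s), snd s)"
| RAssign: "exec (RAssign a is e) s 1
     (fst s, write_cell (snd s) a (map (\<lambda>i. nval i s) is) (rval e s))"
| Seq: "exec p s t s' \<Longrightarrow> exec q s' t' s'' \<Longrightarrow> exec (Seq p q) s (t + t') s''"
| CondTrue: "tval b s \<Longrightarrow> exec p s t s' \<Longrightarrow> exec (Cond b p q) s (Suc t) s'"
| CondFalse: "\<not> tval b s \<Longrightarrow> exec q s t s' \<Longrightarrow> exec (Cond b p q) s (Suc t) s'"
| LoopFalse: "\<not> tval b s \<Longrightarrow> exec (Loop b p) s 1 s"
| LoopTrue: "tval b s \<Longrightarrow> exec p s t s' \<Longrightarrow> exec (Loop b p) s' t' s'' \<Longrightarrow>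
     exec (Loop b p) s (Suc (t + t')) s''"

inductive_cases exec_SkipE: "exec Skip s t s'"
inductive_cases exec_NAssignE: "exec (NAssign a is e) s t s'"
inductive_cases exec_RAssignE: "exec (RAssign a is e) s t s'"
inductive_cases exec_SeqE: "exec (Seq p q) s t s'"
inductive_cases exec_CondE: "exec (Cond b p q) s t s'"
inductive_cases exec_LoopE: "exec (Loop b p) s t s'"

lemma exec_deterministic:
  "exec p s t s' \<Longrightarrow> exec p s u s'' \<Longrightarrow> u = t \<and> s'' = s'"
proof (induction arbitrary: u s'' rule: exec.induct)
  case Skip
  from Skip.prems show ?case by (rule exec_SkipE) simp
next
  case NAssign
  from NAssign.prems show ?case by (rule exec_NAssignE) simp
next
  case RAssign
  from RAssign.prems show ?case by (rule exec_RAssignE) simp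
next
  case Seq
  from Seq.prems show ?case by (rule exec_SeqE) (use Seq.IH in blast)
next
  case CondTrue
  from CondTrue.prems show ?case by (rule exec_CondE) (use CondTrue.IH CondTrue.hyps in blast)+
next
  case CondFalse
  from CondFalse.prems show ?case by (rule exec_CondE) (use CondFalse.IH CondFalse.hyps in blast)+
next
  case LoopFalse
  from LoopFalse.prems show ?case by (rule exec_LoopE) (use LoopFalse.hyps in simp_all)
next
  case LoopTrue
  from LoopTrue.prems show ?case by (rule exec_LoopE) (use LoopTrue.IH LoopTrue.hyps in blast)+
qed

text \<open>Input: the number \<open>n\<close> and the \<open>n\<^sup>d\<close> costs; everything else is zero.
  Output: the tuples that are marked in the array \<open>T\<close>.\<close>

definition init_state :: "nat \<Rightarrow> nat \<Rightarrow> (nat list \<Rightarrow> real) \<Rightarrow> state" where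
  "init_state d n C =
     ((\<lambda>a k. if a = ''n'' \<and> k = [] then n else 0),
      (\<lambda>a k. if a = ''C'' \<and> k \<in> cube d n then C k else 0))"

definition output_set :: "nat \<Rightarrow> nat \<Rightarrow> state \<Rightarrow> nat list set" where
  "output_set d n s = {x \<in> cube d n. fst s ''T'' x \<noteq> 0}"

definition program_output :: "nat \<Rightarrow> program \<Rightarrow> nat \<Rightarrow> (nat list \<Rightarrow> real) \<Rightarrow> nat list set" where
  "program_output d p n C = output_set d n (THE s. \<exists>t. exec p (init_state d n C) t s)"

definition polynomial_time :: "nat \<Rightarrow> program \<Rightarrow> bool" where
  "polynomial_time d p \<longleftrightarrow>
     (\<exists>a k. \<forall>n\<ge>1. \<forall>C. \<exists>t s. exec p (init_state d n C) t s \<and> t \<le> a * n ^ k)"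

definition finds_axial_assignment :: "nat \<Rightarrow> program \<Rightarrow> bool" where
  "finds_axial_assignment d p \<longleftrightarrow>
     (\<forall>n\<ge>1. \<forall>C. program_output d p n C \<in> axial_assignments d n)"

end

theory Submission
  imports Defs
begin

text \<open>
  Lower bound: a fixed assignment of \<open>N = n\<^sup>d\<^sup>-\<^sup>1\<close> cells costs less than \<open>N / (4n)\<close> with
  probability at most \<open>(e / (4n))\<^sup>N\<close>, and there are at most \<open>n\<^sup>N\<close> assignments.

  Upper bound: the layers \<open>k = 1, \<dots>, n\<close> are filled one after the other by a cheap perfect matching
  of the \<open>r\<close>-regular bipartite graph of the cells \<open>(i, j)\<close> that are still free, \<open>r = n - k + 1\<close>.  An
  auction on truncated costs finds a matching that is optimal up to an additive constant, together
  with a feasible solution of the dual linear program of nearly the same value.  It remains to see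
  that for independent exponential costs \<open>c\<close> no feasible dual has value above \<open>O(n / r)\<close>; summing over
  the layers then gives \<open>O(n log n)\<close>.  For this let \<open>Q\<^sub>\<theta>(c)\<close> be the integral of
  \<open>exp (\<theta> * value)\<close> over all feasible duals.  Contracting the feasible region towards a dual \<open>D\<close>
  shows \<open>exp (\<theta> * value D) \<le> 2\<^sup>2\<^sup>n Q\<^sub>2\<^sub>\<theta>(c) / Q\<^sub>\<theta>(c)\<close>, while memorylessness of the costs,
  translation of the duals by \<open>D\<close> and scaling of \<open>D\<close> bound the expectation of the right-hand side
  for \<open>\<theta> = r/4\<close> by \<open>(8/3)\<^sup>2\<^sup>n\<close>.
\<close>

section \<open>Duals of linear programs with exponential costs\<close>

text \<open>The plain assignment dual is unusable for the exponential integral: raising every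
  \<open>u i\<close> and every \<open>p j\<close> by the same amount changes neither a load nor the
  value, so the integral diverges in this direction. The prices are therefore charged
  \<open>1 + \<eta>\<close> times, with \<open>\<eta> = 1 / (big n + 1)\<close>. The integral then
  converges, averaging the constraints still bounds the value, and the certificate loses at most an
  additive 1, because the auction prices have an a priori bound. The estimate for one layer has to
  hold for every regular graph, since the free cells are shaped by the earlier layers. Given those
  layers the new costs are fresh, so a bound that is uniform over graphs may be averaged over the
  law of the graph, and no union over graphs occurs. The ratio of the integrals at
  \<open>r/2\<close> and \<open>r/4\<close> controls all duals at once: it dominates
  \<open>exp (r/4 * val D)\<close> for every feasible \<open>D\<close>, while its expectation
  involves the number of dual variables only.\<close>

definition exp_measure :: "real measure" where
  "exp_measure = density lborel (\<lambda>t. ennreal (exponential_density 1 t))"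

lemma sets_exp_measure [measurable_cong, simp]: "sets exp_measure = sets borel"
  by (simp add: exp_measure_def)

lemma space_exp_measure [simp]: "space exp_measure = UNIV"
  by (simp add: exp_measure_def)

lemma prob_space_exp_measure: "prob_space exp_measure"
  unfolding exp_measure_def by (rule prob_space_exponential_density) simp

lemma product_sigma_finite_exp: "product_sigma_finite (\<lambda>_. exp_measure)"
  by (simp add: product_sigma_finite_def prob_space_exp_measure prob_space_imp_sigma_finite)

lemma product_sigma_finite_lborel: "product_sigma_finite (\<lambda>_. lborel :: real measure)"
  by (simp add: product_sigma_finite_def sigma_finite_lborel)

section \<open>Changes of variables in product integrals: memorylessness and affine maps\<close>

text \<open>Memorylessness in integral form: substituting \<open>a + x\<close> pulls
  \<open>exp (-a)\<close> out of the density. For negative \<open>a\<close> this fails, as the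
  density vanishes below 0.\<close>

lemma exp_measure_shift:
  assumes [measurable]: "f \<in> borel_measurable borel" and a: "0 \<le> a"
  shows "(\<integral>\<^sup>+x. f x * indicator {a..} x \<partial>exp_measure) = ennreal (exp (-a)) * (\<integral>\<^sup>+x. f (a + x) \<partial>exp_measure)"
proof -
  have "(\<integral>\<^sup>+x. f x * indicator {a..} x \<partial>exp_measure)
      = (\<integral>\<^sup>+x. ennreal (exponential_density 1 x) * (f x * indicator {a..} x) \<partial>lborel)"
    by (simp add: exp_measure_def nn_integral_density)
  also have "\<dots> = (\<integral>\<^sup>+x. ennreal (exponential_density 1 (a + 1 * x)) * (f (a + 1 * x) * indicator {a..} (a + 1 * x)) \<partial>lborel)"
    by (subst nn_integral_real_affine[where c = 1 and t = a]) auto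
  also have "\<dots> = (\<integral>\<^sup>+x. ennreal (exp (-a)) * (ennreal (exponential_density 1 x) * f (a + x)) \<partial>lborel)"
    using a by (intro nn_integral_cong)
      (auto simp: exponential_density_def indicator_def exp_add[symmetric] exp_diff mult.assoc[symmetric]
         ennreal_mult'[symmetric] simp flip: exp_minus)
  also have "\<dots> = ennreal (exp (-a)) * (\<integral>\<^sup>+x. f (a + x) \<partial>exp_measure)"
    by (simp add: exp_measure_def nn_integral_density nn_integral_cmult)
  finally show ?thesis .
qed

text \<open>Fubini glues one-dimensional identities together, one coordinate at a time; the
  induction hypothesis is applied to the function in which coordinate \<open>i\<close> is already
  integrated out. The weights \<open>w\<close> are the indicators of the memoryless shift in one
  application and constantly 1 in the other, where \<open>k\<close> is the Jacobian.\<close>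

lemma nn_integral_PiM_transform:
  fixes T :: "'i \<Rightarrow> real \<Rightarrow> real" and w :: "'i \<Rightarrow> real \<Rightarrow> ennreal"
  assumes N: "product_sigma_finite N" and sN: "\<And>i. sets (N i) = sets borel"
    and "finite I"
    and T: "\<And>i. T i \<in> borel_measurable borel" and w: "\<And>i. w i \<in> borel_measurable borel"
    and step: "\<And>i f. i \<in> I \<Longrightarrow> f \<in> borel_measurable borel \<Longrightarrow>
       (\<integral>\<^sup>+x. f x * w i x \<partial>N i) = k i * (\<integral>\<^sup>+x. f (T i x) \<partial>N i)"
    and f: "f \<in> borel_measurable (PiM I N)"
  shows "(\<integral>\<^sup>+x. f x * (\<Prod>i\<in>I. w i (x i)) \<partial>PiM I N)
       = (\<Prod>i\<in>I. k i) * (\<integral>\<^sup>+x. f (\<lambda>i\<in>I. T i (x i)) \<partial>PiM I N)"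
  using \<open>finite I\<close> step f
proof (induction I arbitrary: f rule: finite_induct)
  case empty
  interpret product_sigma_finite N by fact
  show ?case by (simp add: PiM_empty nn_integral_count_space_finite)
next
  case (insert i I)
  interpret product_sigma_finite N by fact
  interpret i: sigma_finite_measure "N i" by (rule sigma_finite_measures)
  note sN [measurable_cong] T [measurable] w [measurable]
  note [measurable] = insert.prems(2)
  have T' [measurable]: "T j \<in> measurable (N j') (N j'')" for j j' j''
    using T[of j] by (simp add: measurable_cong_sets[OF sN sN])
  have "(\<integral>\<^sup>+x. f x * (\<Prod>j\<in>insert i I. w j (x j)) \<partial>PiM (insert i I) N)
      = (\<integral>\<^sup>+x. (\<integral>\<^sup>+y. f (x(i := y)) * (\<Prod>j\<in>insert i I. w j ((x(i := y)) j)) \<partial>N i) \<partial>PiM I N)"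
    using insert by (subst product_nn_integral_insert) auto
  also have "\<dots> = (\<integral>\<^sup>+x. (\<integral>\<^sup>+y. (f (x(i := y)) * w i y) * (\<Prod>j\<in>I. w j (x j)) \<partial>N i) \<partial>PiM I N)"
  proof (intro nn_integral_cong)
    fix x y
    have "(\<Prod>j\<in>I. w j ((x(i := y)) j)) = (\<Prod>j\<in>I. w j (x j))"
      using insert by (intro prod.cong) auto
    then show "f (x(i := y)) * (\<Prod>j\<in>insert i I. w j ((x(i := y)) j))
        = (f (x(i := y)) * w i y) * (\<Prod>j\<in>I. w j (x j))"
      using insert by (simp add: mult.assoc)
  qed
  also have "\<dots> = (\<integral>\<^sup>+x. (\<integral>\<^sup>+y. f (x(i := y)) * w i y \<partial>N i) * (\<Prod>j\<in>I. w j (x j)) \<partial>PiM I N)"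
  proof (intro nn_integral_cong nn_integral_multc)
    fix x assume "x \<in> space (PiM I N)"
    then have [measurable]: "(\<lambda>y. x(i := y)) \<in> measurable (N i) (PiM (insert i I) N)"
      by (intro measurable_fun_upd[where f = "\<lambda>_. x" and J = I]) auto
    show "(\<lambda>y. f (x(i := y)) * w i y) \<in> borel_measurable (N i)" by measurable
  qed
  also have "\<dots> = (\<integral>\<^sup>+x. (k i * (\<integral>\<^sup>+y. f (x(i := T i y)) \<partial>N i)) * (\<Prod>j\<in>I. w j (x j)) \<partial>PiM I N)"
  proof (intro nn_integral_cong arg_cong2[where f = "(*)"] refl)
    fix x assume "x \<in> space (PiM I N)"
    then have [measurable]: "(\<lambda>y. x(i := y)) \<in> measurable (N i) (PiM (insert i I) N)"
      by (intro measurable_fun_upd[where f = "\<lambda>_. x" and J = I]) auto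
    have "(\<lambda>y. f (x(i := y))) \<in> borel_measurable (N i)" by measurable
    then have "(\<lambda>y. f (x(i := y))) \<in> borel_measurable borel" by (simp add: measurable_cong_sets[OF sN])
    then show "(\<integral>\<^sup>+y. f (x(i := y)) * w i y \<partial>N i) = k i * (\<integral>\<^sup>+y. f (x(i := T i y)) \<partial>N i)"
      using insert.prems(1)[of i] by simp
  qed
  also have "\<dots> = k i * (\<integral>\<^sup>+x. (\<integral>\<^sup>+y. f (x(i := T i y)) \<partial>N i) * (\<Prod>j\<in>I. w j (x j)) \<partial>PiM I N)"
    by (subst nn_integral_cmult[symmetric]) (auto simp: mult.assoc)
  also have "\<dots> = k i * ((\<Prod>i\<in>I. k i) * (\<integral>\<^sup>+x. (\<integral>\<^sup>+y. f ((\<lambda>i\<in>I. T i (x i))(i := T i y)) \<partial>N i) \<partial>PiM I N))"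
    by (subst insert.IH) (auto intro!: insert.prems)
  also have "\<dots> = (\<Prod>i\<in>insert i I. k i) * (\<integral>\<^sup>+x. (\<integral>\<^sup>+y. f (\<lambda>j\<in>insert i I. T j ((x(i := y)) j)) \<partial>N i) \<partial>PiM I N)"
  proof -
    have "(\<lambda>i\<in>I. T i (x i))(i := T i y) = (\<lambda>j\<in>insert i I. T j ((x(i := y)) j))" for x y
      using insert by (auto simp: restrict_def)
    then show ?thesis using insert by (simp add: mult.assoc)
  qed
  also have "(\<integral>\<^sup>+x. (\<integral>\<^sup>+y. f (\<lambda>j\<in>insert i I. T j ((x(i := y)) j)) \<partial>N i) \<partial>PiM I N)
     = (\<integral>\<^sup>+x. f (\<lambda>i\<in>insert i I. T i (x i)) \<partial>PiM (insert i I) N)"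
    using insert by (subst product_nn_integral_insert) auto
  finally show ?case .
qed

lemma nn_integral_PiM_lborel_affine:
  fixes t :: "'i \<Rightarrow> real"
  assumes "finite I" "0 < s" and f: "f \<in> borel_measurable (PiM I (\<lambda>_. lborel))"
  shows "(\<integral>\<^sup>+x. f x \<partial>PiM I (\<lambda>_. lborel))
       = ennreal s ^ card I * (\<integral>\<^sup>+x. f (\<lambda>i\<in>I. t i + s * x i) \<partial>PiM I (\<lambda>_. lborel))"
  using nn_integral_PiM_transform[OF product_sigma_finite_lborel _ \<open>finite I\<close>, where w = "\<lambda>_ _. 1"
      and T = "\<lambda>i x. t i + s * x" and k = "\<lambda>_. ennreal s" and f = f] f \<open>0 < s\<close>
  using nn_integral_real_affine[of _ s] by (auto simp: prod_constant)

lemma nn_integral_PiM_exp_shift: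
  fixes a :: "'e \<Rightarrow> real"
  assumes "finite E" "\<And>e. 0 \<le> a e" and f: "f \<in> borel_measurable (PiM E (\<lambda>_. exp_measure))"
  shows "(\<integral>\<^sup>+x. f x * (\<Prod>e\<in>E. indicator {a e..} (x e)) \<partial>PiM E (\<lambda>_. exp_measure))
       = ennreal (exp (- (\<Sum>e\<in>E. a e))) * (\<integral>\<^sup>+x. f (\<lambda>e\<in>E. a e + x e) \<partial>PiM E (\<lambda>_. exp_measure))"
proof -
  have "(\<Prod>e\<in>E. ennreal (exp (- a e))) = ennreal (exp (- (\<Sum>e\<in>E. a e)))"
    by (simp add: prod_ennreal exp_sum[OF \<open>finite E\<close>] sum_negf[symmetric])
  then show ?thesis
    using nn_integral_PiM_transform[OF product_sigma_finite_exp _ \<open>finite E\<close>, where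
      w = "\<lambda>e. indicator {a e..}" and T = "\<lambda>e x. a e + x" and k = "\<lambda>e. ennreal (exp (- a e))" and f = f]
      f assms exp_measure_shift by simp
qed

section \<open>The exponential integral over the feasible duals\<close>

text \<open>\<open>a\<close> is the constraint matrix, \<open>b\<close> the objective and
  \<open>r\<close> plays the part of the degree of the graph. \<open>dominated\<close> is what
  averaging the constraints over all edges gives. \<open>coercive\<close> says that the value falls
  off linearly at infinity on the feasible region; it serves the finiteness of \<open>Q\<close>, so
  an arbitrarily small \<open>\<kappa>\<close> and a huge \<open>M\<close> are acceptable.\<close>

locale dual_program =
  fixes I :: "'i set" and E :: "'e set" and a :: "'e \<Rightarrow> 'i \<Rightarrow> real" and b :: "'i \<Rightarrow> real" and r :: real
    and M :: "('e \<Rightarrow> real) \<Rightarrow> real" and \<kappa> :: real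
  assumes finI: "finite I" and finE: "finite E" and r: "0 < r" and \<kappa>: "0 < \<kappa>"
    and dominated: "\<And>D. (\<And>i. i \<in> I \<Longrightarrow> 0 \<le> D i) \<Longrightarrow>
          r * (\<Sum>i\<in>I. b i * D i) \<le> (\<Sum>e\<in>E. \<Sum>i\<in>I. a e i * D i)"
    and coercive: "\<And>c D. (\<And>i. i \<in> I \<Longrightarrow> 0 \<le> D i) \<Longrightarrow> (\<And>e. e \<in> E \<Longrightarrow> (\<Sum>i\<in>I. a e i * D i) \<le> c e) \<Longrightarrow>
          (\<Sum>i\<in>I. b i * D i) \<le> M c - \<kappa> * (\<Sum>i\<in>I. D i)"
begin

definition load :: "('i \<Rightarrow> real) \<Rightarrow> 'e \<Rightarrow> real" where
  "load D e = (\<Sum>i\<in>I. a e i * D i)"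

definition val :: "('i \<Rightarrow> real) \<Rightarrow> real" where
  "val D = (\<Sum>i\<in>I. b i * D i)"

text \<open>Because of \<open>max 0\<close>, the costs for which a given nonnegative
  \<open>D\<close> is feasible form an orthant above a nonnegative corner. This is the form to which
  the memoryless shift applies.\<close>

definition feasible :: "('e \<Rightarrow> real) \<Rightarrow> ('i \<Rightarrow> real) \<Rightarrow> bool" where
  "feasible c D \<longleftrightarrow> (\<forall>i\<in>I. 0 \<le> D i) \<and> (\<forall>e\<in>E. max 0 (load D e) \<le> c e)"

definition dens :: "real \<Rightarrow> ('e \<Rightarrow> real) \<Rightarrow> ('i \<Rightarrow> real) \<Rightarrow> ennreal" where
  "dens \<theta> c D = (if feasible c D then ennreal (exp (\<theta> * val D)) else 0)"

abbreviation duals :: "('i \<Rightarrow> real) measure" where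
  "duals \<equiv> PiM I (\<lambda>_. lborel)"

abbreviation costs :: "('e \<Rightarrow> real) measure" where
  "costs \<equiv> PiM E (\<lambda>_. exp_measure)"

definition Q :: "real \<Rightarrow> ('e \<Rightarrow> real) \<Rightarrow> ennreal" where
  "Q \<theta> c = (\<integral>\<^sup>+D. dens \<theta> c D \<partial>duals)"

lemma load_measurable [measurable]: "(\<lambda>D. load D e) \<in> borel_measurable duals"
  unfolding load_def by measurable

lemma val_measurable [measurable]: "val \<in> borel_measurable duals"
  unfolding val_def by measurable

lemma feasible_measurable [measurable]:
  "Measurable.pred (costs \<Otimes>\<^sub>M duals) (\<lambda>(c, D). feasible c D)"
  unfolding feasible_def load_def using finI finE by measurable

lemma dens_measurable [measurable]: "(\<lambda>(c, D). dens \<theta> c D) \<in> borel_measurable (costs \<Otimes>\<^sub>M duals)"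
  using feasible_measurable unfolding dens_def case_prod_beta' by (intro measurable_If) auto

lemma dens_measurable' [measurable]: "c \<in> space costs \<Longrightarrow> dens \<theta> c \<in> borel_measurable duals"
  using dens_measurable by measurable

sublocale D: sigma_finite_measure duals
  by (rule product_sigma_finite.sigma_finite[OF product_sigma_finite_lborel finI])

sublocale C: prob_space costs
  by (rule prob_space_PiM) (rule prob_space_exp_measure)

sublocale CD: pair_sigma_finite costs duals ..

lemma Q_measurable [measurable]: "Q \<theta> \<in> borel_measurable costs"
  unfolding Q_def using dens_measurable by measurable

lemma load_comb: "load (\<lambda>i\<in>I. x * D i + y * D' i) e = x * load D e + y * load D' e"
  by (simp add: load_def algebra_simps sum.distrib sum_distrib_left)

lemma val_comb: "val (\<lambda>i\<in>I. x * D i + y * D' i) = x * val D + y * val D'"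
  by (simp add: val_def algebra_simps sum.distrib sum_distrib_left)

text \<open>The contraction \<open>D \<mapsto> (D\<^sub>0 + D) / 2\<close> maps the feasible region into itself.\<close>

lemma Q_doubling:
  assumes c: "c \<in> space costs" and D0: "feasible c D0"
  shows "ennreal (exp (\<theta> * val D0)) * Q \<theta> c \<le> 2 ^ card I * Q (2 * \<theta>) c"
proof -
  note [measurable] = dens_measurable'[OF c]
  let ?m = "\<lambda>D. \<lambda>i\<in>I. (1/2) * D0 i + (1/2) * D i"
  have "ennreal (exp (\<theta> * val D0)) * dens \<theta> c D \<le> dens (2 * \<theta>) c (?m D)" for D
  proof (cases "feasible c D")
    case True
    have "feasible c (?m D)"
      unfolding feasible_def
    proof (intro conjI ballI)
      fix e assume "e \<in> E"
      then have "load D0 e \<le> c e" "load D e \<le> c e" "0 \<le> c e"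
        using D0 True by (auto simp: feasible_def)
      then show "max 0 (load (?m D) e) \<le> c e"
        by (simp only: load_comb)
    qed (use D0 True in \<open>auto simp: feasible_def\<close>)
    then show ?thesis
      using True
      by (simp only: dens_def val_comb if_True) (simp add: ennreal_mult'[symmetric] exp_add[symmetric] algebra_simps)
  qed (simp add: dens_def)
  then have "ennreal (exp (\<theta> * val D0)) * Q \<theta> c \<le> (\<integral>\<^sup>+D. dens (2 * \<theta>) c (?m D) \<partial>duals)"
    unfolding Q_def by (subst nn_integral_cmult[symmetric]) (auto intro!: nn_integral_mono)
  moreover have "Q (2 * \<theta>) c = ennreal (1/2) ^ card I * (\<integral>\<^sup>+D. dens (2 * \<theta>) c (?m D) \<partial>duals)"
    unfolding Q_def using finI by (subst nn_integral_PiM_lborel_affine[of I "1/2" _ "\<lambda>i. 1/2 * D0 i"]) auto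
  moreover have "(2::ennreal) ^ card I * ennreal (1/2) ^ card I = 1"
    using ennreal_mult'[of 2 "1/2"] by (simp add: power_mult_distrib[symmetric])
  ultimately show ?thesis by (simp add: mult.assoc[symmetric])
qed

text \<open>Coercivity bounds the integrand by a constant times a product of functions
  \<open>exp (- (\<theta> * \<kappa>) * x)\<close> on the nonnegative half-line, and the integral of
  the product factorises.\<close>

lemma Q_finite:
  assumes c: "c \<in> space costs" and \<theta>: "0 < \<theta>"
  shows "Q \<theta> c < \<infinity>"
proof -
  have "dens \<theta> c D \<le> ennreal (exp (\<theta> * M c)) * (\<Prod>i\<in>I. ennreal (exp (- (\<theta> * \<kappa>) * D i)) * indicator {0..} (D i))" for D
  proof (cases "feasible c D")
    case True
    then have "val D \<le> M c - \<kappa> * (\<Sum>i\<in>I. D i)"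
      unfolding val_def by (intro coercive) (auto simp: feasible_def load_def)
    then have "\<theta> * val D \<le> \<theta> * M c + (\<Sum>i\<in>I. - (\<theta> * \<kappa>) * D i)"
      using \<theta> by (simp add: sum_distrib_left[symmetric] sum_negf mult_left_mono[of _ _ \<theta>] right_diff_distrib[symmetric] mult.assoc)
    then have "exp (\<theta> * val D) \<le> exp (\<theta> * M c) * (\<Prod>i\<in>I. exp (- (\<theta> * \<kappa>) * D i))"
      by (simp add: exp_add[symmetric] exp_sum[OF finI, symmetric] del: exp_add)
    moreover have "(\<Prod>i\<in>I. ennreal (exp (- (\<theta> * \<kappa>) * D i)) * indicator {0..} (D i))
        = ennreal (\<Prod>i\<in>I. exp (- (\<theta> * \<kappa>) * D i))"
      using True by (auto simp: feasible_def prod_ennreal[symmetric] intro!: prod.cong)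
    ultimately show ?thesis
      using True by (simp add: dens_def ennreal_mult'[symmetric] prod_nonneg del: mult_minus_left)
  qed (simp add: dens_def)
  then have "Q \<theta> c \<le> (\<integral>\<^sup>+D. ennreal (exp (\<theta> * M c)) * (\<Prod>i\<in>I. ennreal (exp (- (\<theta> * \<kappa>) * D i)) * indicator {0..} (D i)) \<partial>duals)"
    unfolding Q_def by (intro nn_integral_mono)
  also have "\<dots> = ennreal (exp (\<theta> * M c)) * (\<Prod>i\<in>I. \<integral>\<^sup>+x. ennreal (exp (- (\<theta> * \<kappa>) * x)) * indicator {0..} x \<partial>lborel)"
    by (subst nn_integral_cmult, measurable)
      (subst product_sigma_finite.product_nn_integral_prod[OF product_sigma_finite_lborel finI,
          where f = "\<lambda>_ x. ennreal (exp (- (\<theta> * \<kappa>) * x)) * indicator {0..} x"], auto)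
  also have "\<dots> < \<infinity>"
  proof -
    have "(\<integral>\<^sup>+x. ennreal (exp (- (\<theta> * \<kappa>) * x)) * indicator {0..} x \<partial>lborel) < \<infinity>"
    proof -
      have "(\<integral>\<^sup>+x. ennreal (exp (- (\<theta> * \<kappa>) * x)) * indicator {0..} x \<partial>lborel)
         = (\<integral>\<^sup>+x. ennreal (1 / (\<theta> * \<kappa>)) * ennreal (exponential_density (\<theta> * \<kappa>) x) \<partial>lborel)"
        using \<theta> \<kappa> by (intro nn_integral_cong)
          (auto simp: exponential_density_def indicator_def ennreal_mult'[symmetric] mult_ac)
      also have "\<dots> = ennreal (1 / (\<theta> * \<kappa>)) * emeasure (density lborel (\<lambda>x. ennreal (exponential_density (\<theta> * \<kappa>) x))) UNIV"
        by (subst nn_integral_cmult) (auto simp: emeasure_density)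
      also have "\<dots> = ennreal (1 / (\<theta> * \<kappa>))"
        using prob_space.emeasure_space_1[OF prob_space_exponential_density[of "\<theta> * \<kappa>"]] \<theta> \<kappa> by simp
      finally show ?thesis by simp
    qed
    then show ?thesis
      by (auto simp: ennreal_mult_less_top less_top[symmetric] power_eq_top_ennreal ennreal_mult_eq_top_iff)
  qed
  finally show ?thesis .
qed

text \<open>For strictly positive costs a small box \<open>[0, \<delta>]\<close> in every coordinate
  is feasible, and it has positive volume.\<close>

lemma Q_positive:
  assumes c: "c \<in> space costs" and pos: "\<And>e. e \<in> E \<Longrightarrow> 0 < c e"
  shows "0 < Q \<theta> c"
proof (rule ccontr)
  note [measurable] = dens_measurable'[OF c]
  define A where "A = 1 + (\<Sum>e\<in>E. \<Sum>i\<in>I. \<bar>a e i\<bar>)"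
  have A: "1 \<le> A" by (auto simp: A_def intro!: sum_nonneg)
  \<comment> \<open>\<open>A\<close> dominates every absolute row sum of the constraint matrix, so
    loads on the box are at most \<open>\<delta> * A\<close>. The inserted 1 keeps
    \<open>Min\<close> meaningful when \<open>E\<close> is empty.\<close>
  define \<delta> where "\<delta> = Min (insert 1 (c ` E)) / A"
  have \<delta>: "0 < \<delta>" and \<delta>': "\<And>e. e \<in> E \<Longrightarrow> \<delta> * A \<le> c e"
    using A finE pos by (auto simp: \<delta>_def)
  assume "\<not> 0 < Q \<theta> c"
  then have "AE D in duals. dens \<theta> c D = 0"
    by (simp add: Q_def nn_integral_0_iff_AE)
  moreover have "dens \<theta> c D \<noteq> 0" if D: "\<And>i. i \<in> I \<Longrightarrow> 0 \<le> D i \<and> D i \<le> \<delta>" for D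
  proof -
    have "load D e \<le> c e" if e: "e \<in> E" for e
    proof -
      have "load D e \<le> (\<Sum>i\<in>I. \<bar>a e i\<bar> * \<delta>)"
        unfolding load_def
        by (intro sum_mono) (metis D abs_ge_self abs_ge_zero mult_mono)
      also have "\<dots> \<le> A * \<delta>"
        unfolding sum_distrib_right[symmetric] A_def using e finE \<delta>
        by (intro mult_right_mono) (auto intro!: add_increasing member_le_sum sum_nonneg)
      finally show ?thesis using \<delta>'[OF e] by (simp add: mult.commute)
    qed
    then show ?thesis using D pos by (auto simp: dens_def feasible_def less_imp_le)
  qed
  ultimately have "AE D in duals. D \<notin> PiE I (\<lambda>_. {0..\<delta>})"
    by (elim eventually_mono) (auto simp: PiE_def Pi_def)
  then have "emeasure duals (PiE I (\<lambda>_. {0..\<delta>})) = 0"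
    using AE_iff_measurable[of "PiE I (\<lambda>_. {0..\<delta>})" duals "\<lambda>D. D \<notin> PiE I (\<lambda>_. {0..\<delta>})"]
      sets_PiM_I_finite[OF finI, of "\<lambda>_. {0..\<delta>}" "\<lambda>_. lborel"]
    by (auto simp: space_PiM Int_absorb1 PiE_mono simp flip: Int_def)
  moreover have "emeasure duals (PiE I (\<lambda>_. {0..\<delta>})) = ennreal \<delta> ^ card I"
    using finI \<delta> by (subst product_sigma_finite.emeasure_PiM[OF product_sigma_finite_lborel]) auto
  ultimately show False using \<delta> by (simp add: ennreal_power)
qed

section \<open>Memoryless shift of the costs and scaling of the duals\<close>

definition total_load :: "('i \<Rightarrow> real) \<Rightarrow> real" where
  "total_load D = (\<Sum>e\<in>E. max 0 (load D e))"

definition shifted :: "('i \<Rightarrow> real) \<Rightarrow> ('e \<Rightarrow> real) \<Rightarrow> 'e \<Rightarrow> real" where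
  "shifted D c = (\<lambda>e\<in>E. max 0 (load D e) + c e)"

text \<open>For nonnegative \<open>D\<close> this is the conditional expectation of
  \<open>exp (\<theta> * val D) / Q \<theta>\<close> given that \<open>D\<close> is feasible: under
  this condition the costs are distributed like \<open>shifted D c\<close> with fresh
  \<open>c\<close>.\<close>

definition \<Psi> :: "real \<Rightarrow> ('i \<Rightarrow> real) \<Rightarrow> ennreal" where
  "\<Psi> \<theta> D = (\<integral>\<^sup>+c. ennreal (exp (\<theta> * val D)) * inverse (Q \<theta> (shifted D c)) \<partial>costs)"

lemma total_load_measurable [measurable]: "total_load \<in> borel_measurable duals"
  unfolding total_load_def by measurable

lemma shifted_measurable [measurable]:
  "(\<lambda>(D, c). shifted D c) \<in> measurable (duals \<Otimes>\<^sub>M costs) costs"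
  unfolding shifted_def case_prod_beta' by (rule measurable_restrict) measurable

lemma \<Psi>_measurable [measurable]: "\<Psi> \<theta> \<in> borel_measurable duals"
  unfolding \<Psi>_def by measurable

lemma load_scale: "load (\<lambda>i\<in>I. x * D i) e = x * load D e"
  using load_comb[of x D 0] by simp

lemma total_load_scale: "0 \<le> x \<Longrightarrow> total_load (\<lambda>i\<in>I. x * D i) = x * total_load D"
  by (auto simp: total_load_def load_scale sum_distrib_left max_def mult_le_0_iff zero_le_mult_iff intro!: sum.cong)

text \<open>The density for the costs \<open>shifted D c\<close> at the dual \<open>D + D'\<close>,
  with the factor \<open>exp (\<theta> * val D)\<close> removed. The constraints are left
  uncancelled, because the monotonicity in \<open>D\<close> is read off from this form.\<close>

definition translated_dens :: "real \<Rightarrow> ('i \<Rightarrow> real) \<Rightarrow> ('e \<Rightarrow> real) \<Rightarrow> ('i \<Rightarrow> real) \<Rightarrow> ennreal" where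
  "translated_dens \<theta> D c D' = (if (\<forall>i\<in>I. 0 \<le> D i + D' i) \<and>
      (\<forall>e\<in>E. max 0 (load D e + load D' e) \<le> max 0 (load D e) + c e) then ennreal (exp (\<theta> * val D')) else 0)"

text \<open>Translation invariance of Lebesgue measure lets the dual be written as
  \<open>D + D'\<close>. The factor that comes out is the numerator in \<open>\<Psi>\<close>, so it
  cancels there.\<close>

lemma Q_shifted:
  assumes c: "c \<in> space costs"
  shows "Q \<theta> (shifted D c) = ennreal (exp (\<theta> * val D)) * (\<integral>\<^sup>+D'. translated_dens \<theta> D c D' \<partial>duals)"
proof -
  have c': "shifted D c \<in> space costs" by (simp add: shifted_def space_PiM)
  note [measurable] = dens_measurable'[OF c']
  have m: "translated_dens \<theta> D c \<in> borel_measurable duals"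
    unfolding translated_dens_def using finI finE by measurable
  have "Q \<theta> (shifted D c) = (\<integral>\<^sup>+D'. dens \<theta> (shifted D c) (\<lambda>i\<in>I. D i + 1 * D' i) \<partial>duals)"
    unfolding Q_def using finI by (subst nn_integral_PiM_lborel_affine[where s = 1 and t = D]) auto
  also have "\<dots> = (\<integral>\<^sup>+D'. ennreal (exp (\<theta> * val D)) * translated_dens \<theta> D c D' \<partial>duals)"
  proof (rule nn_integral_cong)
    fix D'
    have "feasible (shifted D c) (\<lambda>i\<in>I. D i + 1 * D' i) \<longleftrightarrow> (\<forall>i\<in>I. 0 \<le> D i + D' i) \<and>
      (\<forall>e\<in>E. max 0 (load D e + load D' e) \<le> max 0 (load D e) + c e)"
      using load_comb[of 1 D 1 D'] by (simp add: feasible_def shifted_def)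
    moreover have "val (\<lambda>i\<in>I. D i + 1 * D' i) = val D + val D'"
      using val_comb[of 1 D 1 D'] by simp
    ultimately show "dens \<theta> (shifted D c) (\<lambda>i\<in>I. D i + 1 * D' i)
        = ennreal (exp (\<theta> * val D)) * translated_dens \<theta> D c D'"
      by (simp add: dens_def translated_dens_def ennreal_mult'[symmetric] exp_add[symmetric] distrib_left)
  qed
  also have "\<dots> = ennreal (exp (\<theta> * val D)) * (\<integral>\<^sup>+D'. translated_dens \<theta> D c D' \<partial>duals)"
    using m by (rule nn_integral_cmult)
  finally show ?thesis .
qed

lemma inverse_antimono_ennreal:
  fixes x y :: ennreal
  shows "x \<le> y \<Longrightarrow> inverse y \<le> inverse x"
proof -
  assume "x \<le> y"
  then show ?thesis
  proof (cases "x = 0 \<or> y = top")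
    case False
    with \<open>x \<le> y\<close> obtain u v where "x = ennreal u" "y = ennreal v" "0 < u" "u \<le> v"
      by (cases x; cases y) (auto simp: ennreal_le_iff top_unique less_le)
    then show ?thesis by (simp add: inverse_ennreal)
  qed auto
qed

text \<open>The values 0 and \<open>top\<close> of \<open>y\<close> are included, so the
  cancellation inside \<open>\<Psi>\<close> needs no exceptional null set.\<close>

lemma inverse_exp_mult: "ennreal (exp x) * inverse (ennreal (exp x) * y) = inverse y"
proof (cases y)
  case (real z)
  then show ?thesis
    by (cases "z = 0")
       (auto simp: ennreal_mult'[symmetric] inverse_ennreal field_simps)
next
  case top
  then show ?thesis by (simp add: ennreal_mult_top)
qed

text \<open>The translated region only grows when \<open>D\<close> is scaled up; this is where the restriction to
  the cone of nonnegative duals pays off.\<close>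

lemma \<Psi>_antimono:
  assumes D: "\<And>i. i \<in> I \<Longrightarrow> 0 \<le> D i" and x: "1 \<le> x"
  shows "\<Psi> \<theta> (\<lambda>i\<in>I. x * D i) \<le> \<Psi> \<theta> D"
proof -
  have "(\<integral>\<^sup>+D'. translated_dens \<theta> D c D' \<partial>duals) \<le> (\<integral>\<^sup>+D'. translated_dens \<theta> (\<lambda>i\<in>I. x * D i) c D' \<partial>duals)" for c
  proof (rule nn_integral_mono)
    fix D'
    have "0 \<le> x * D i + D' i" if "i \<in> I" "0 \<le> D i + D' i" for i
      using mult_right_mono[OF x D[OF that(1)]] that by simp
    \<comment> \<open>For \<open>0 \<le> u\<close> scaling adds \<open>(x - 1) * u\<close> to both
      loads; for negative \<open>u\<close> the left side can only drop, while \<open>max 0\<close>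
      on the right stays 0.\<close>
    moreover have "max 0 (x * u + v) \<le> max 0 (x * u) + w" if "max 0 (u + v) \<le> max 0 u + w" for u v w :: real
    proof (cases "0 \<le> u")
      case True
      then show ?thesis using that mult_right_mono[OF x True] x by auto
    next
      case False
      then have "x * u \<le> u" using x by (simp add: mult_le_cancel_right1)
      then show ?thesis using that False by linarith
    qed
    ultimately show "translated_dens \<theta> D c D' \<le> translated_dens \<theta> (\<lambda>i\<in>I. x * D i) c D'"
      by (auto simp: translated_dens_def load_scale)
  qed
  then show ?thesis
    unfolding \<Psi>_def
    by (intro nn_integral_mono) (simp add: Q_shifted inverse_exp_mult inverse_antimono_ennreal)
qed

text \<open>Fubini moves the integral over \<open>D\<close> outside. For fixed nonnegative
  \<open>D\<close>, feasibility is the event that every cost exceeds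
  \<open>max 0 (load D e)\<close>; it has probability \<open>exp (- total_load D)\<close>, and
  conditioning on it shifts the costs. The exponent contains \<open>\<theta> - \<theta>'\<close>
  because \<open>\<Psi> \<theta>'\<close> already absorbs
  \<open>exp (\<theta>' * val D)\<close>.\<close>

lemma Q_ratio_formula:
  "(\<integral>\<^sup>+c. Q \<theta> c * inverse (Q \<theta>' c) \<partial>costs) =
   (\<integral>\<^sup>+D. (if \<forall>i\<in>I. 0 \<le> D i then ennreal (exp ((\<theta> - \<theta>') * val D - total_load D)) * \<Psi> \<theta>' D else 0) \<partial>duals)"
proof -
  have "(\<integral>\<^sup>+c. Q \<theta> c * inverse (Q \<theta>' c) \<partial>costs) = (\<integral>\<^sup>+c. \<integral>\<^sup>+D. dens \<theta> c D * inverse (Q \<theta>' c) \<partial>duals \<partial>costs)"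
    unfolding Q_def[of \<theta>] by (intro nn_integral_cong nn_integral_multc[symmetric]) simp
  also have "\<dots> = (\<integral>\<^sup>+D. \<integral>\<^sup>+c. dens \<theta> c D * inverse (Q \<theta>' c) \<partial>costs \<partial>duals)"
    by (rule CD.Fubini'[symmetric]) measurable
  also have "\<dots> = (\<integral>\<^sup>+D. (if \<forall>i\<in>I. 0 \<le> D i then ennreal (exp ((\<theta> - \<theta>') * val D - total_load D)) * \<Psi> \<theta>' D else 0) \<partial>duals)"
  proof (rule nn_integral_cong)
    fix D assume D: "D \<in> space duals"
    have [measurable]: "(\<lambda>c. shifted D c) \<in> measurable costs costs"
      using D by measurable
    show "(\<integral>\<^sup>+c. dens \<theta> c D * inverse (Q \<theta>' c) \<partial>costs) =
       (if \<forall>i\<in>I. 0 \<le> D i then ennreal (exp ((\<theta> - \<theta>') * val D - total_load D)) * \<Psi> \<theta>' D else 0)"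
    proof (cases "\<forall>i\<in>I. 0 \<le> D i")
      case True
      have *: "dens \<theta> c D = ennreal (exp (\<theta> * val D)) * (\<Prod>e\<in>E. indicator {max 0 (load D e)..} (c e))" for c
        using True finE by (auto simp: dens_def feasible_def indicator_def prod.If_cases if_distrib Int_def intro!: prod_zero)
      have "(\<integral>\<^sup>+c. dens \<theta> c D * inverse (Q \<theta>' c) \<partial>costs)
         = ennreal (exp (\<theta> * val D)) * (\<integral>\<^sup>+c. inverse (Q \<theta>' c) * (\<Prod>e\<in>E. indicator {max 0 (load D e)..} (c e)) \<partial>costs)"
        unfolding * by (subst nn_integral_cmult[symmetric]) (auto simp: mult_ac)
      also have "\<dots> = ennreal (exp (\<theta> * val D)) * (ennreal (exp (- total_load D)) * (\<integral>\<^sup>+c. inverse (Q \<theta>' (shifted D c)) \<partial>costs))"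
        unfolding total_load_def shifted_def by (subst nn_integral_PiM_exp_shift) (auto simp: finE)
      also have "\<dots> = ennreal (exp ((\<theta> - \<theta>') * val D - total_load D)) * \<Psi> \<theta>' D"
        unfolding \<Psi>_def
        by (subst nn_integral_cmult)
           (auto simp: mult.assoc[symmetric] ennreal_mult'[symmetric] exp_add[symmetric] algebra_simps)
      finally show ?thesis using True by simp
    next
      case False
      then have "dens \<theta> c D = 0" for c by (auto simp: dens_def feasible_def)
      with False show ?thesis by (subst if_not_P) auto
    qed
  qed
  finally show ?thesis .
qed

text \<open>With \<open>\<theta> - \<theta>' = r/4\<close>, \<open>dominated\<close> lets
  \<open>total_load\<close> absorb the value and leaves \<open>exp (- (3/4) * total_load D)\<close>.
  Substituting \<open>(4/3) * D\<close> restores the full exponent at the price of the Jacobian, and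
  \<open>\<Psi>\<close> only decreases. What remains is the same formula with both parameters equal
  to \<open>r/4\<close>, that is, the expectation of \<open>Q\<close> divided by itself.\<close>

lemma Q_ratio_bound:
  "(\<integral>\<^sup>+c. Q (r/2) c * inverse (Q (r/4) c) \<partial>costs) \<le> ennreal (4/3) ^ card I"
proof -
  let ?p = "\<lambda>D. \<forall>i\<in>I. 0 \<le> D i"
  let ?s = "\<lambda>D. \<lambda>i\<in>I. 0 + (4/3) * D i"
  define f where "f = (\<lambda>D. if ?p D then ennreal (exp (- (3/4) * total_load D)) * \<Psi> (r/4) D else 0)"
  have [measurable]: "f \<in> borel_measurable duals"
    unfolding f_def using finI by measurable
  have "(\<integral>\<^sup>+c. Q (r/2) c * inverse (Q (r/4) c) \<partial>costs) \<le> (\<integral>\<^sup>+D. f D \<partial>duals)"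
    unfolding Q_ratio_formula f_def
  proof (intro nn_integral_mono)
    fix D
    show "(if ?p D then ennreal (exp ((r/2 - r/4) * val D - total_load D)) * \<Psi> (r/4) D else 0)
        \<le> (if ?p D then ennreal (exp (- (3/4) * total_load D)) * \<Psi> (r/4) D else 0)"
    proof (cases "?p D")
      case True
      then have "r * val D \<le> (\<Sum>e\<in>E. load D e)"
        unfolding val_def load_def by (intro dominated) auto
      also have "\<dots> \<le> total_load D" unfolding total_load_def by (intro sum_mono) auto
      finally have "(r/2 - r/4) * val D - total_load D \<le> - (3/4) * total_load D" by simp
      then show ?thesis by (auto intro!: mult_right_mono)
    qed auto
  qed
  also have "\<dots> = ennreal (4/3) ^ card I * (\<integral>\<^sup>+D. f (?s D) \<partial>duals)"
    using finI by (subst nn_integral_PiM_lborel_affine[where s = "4/3" and t = "\<lambda>_. 0"]) auto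
  also have "(\<integral>\<^sup>+D. f (?s D) \<partial>duals) \<le> (\<integral>\<^sup>+c. Q (r/4) c * inverse (Q (r/4) c) \<partial>costs)"
    unfolding Q_ratio_formula
  proof (intro nn_integral_mono)
    fix D
    show "f (?s D) \<le> (if ?p D then ennreal (exp ((r/4 - r/4) * val D - total_load D)) * \<Psi> (r/4) D else 0)"
    proof (cases "?p D")
      case True
      then show ?thesis
        using \<Psi>_antimono[of D "4/3" "r/4"] total_load_scale[of "4/3" D]
        by (auto simp: f_def simp del: times_divide_eq_left intro!: mult_mono ennreal_leI)
    next
      case False
      then show ?thesis by (auto simp: f_def zero_le_mult_iff)
    qed
  qed
  \<comment> \<open>If \<open>Q\<close> is 0 or \<open>top\<close>, the product with its inverse is
    0 in \<open>ennreal\<close>, so the bound 1 holds for every \<open>c\<close>.\<close>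
  also have "(\<integral>\<^sup>+c. Q (r/4) c * inverse (Q (r/4) c) \<partial>costs) \<le> (\<integral>\<^sup>+c. 1 \<partial>costs)"
  proof (intro nn_integral_mono)
    fix c
    show "Q (r/4) c * inverse (Q (r/4) c) \<le> 1"
      using ennreal_divide_self[of "Q (r/4) c"]
      by (cases "Q (r/4) c = 0 \<or> Q (r/4) c = top") (auto simp: divide_ennreal_def less_top)
  qed
  also have "\<dots> = 1" by (simp add: C.emeasure_space_1)
  finally show ?thesis by (simp add: mult_left_mono)
qed

text \<open>Markov's inequality for \<open>2 ^ card I * Q (r/2) / Q (r/4)\<close>. Contraction
  bounds \<open>exp (r/4 * val D)\<close> by this one random variable for all feasible
  \<open>D\<close> simultaneously, so a single measurable exceptional set suffices and no supremum
  over duals has to be measured.\<close>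

lemma value_tail:
  "\<exists>A. A \<in> sets costs \<and> measure costs A \<le> exp (- s) * (8/3) ^ card I \<and>
    (\<forall>c\<in>space costs. c \<notin> A \<longrightarrow> (\<forall>e\<in>E. 0 < c e) \<longrightarrow> (\<forall>D. feasible c D \<longrightarrow> r * val D < 4 * s))"
proof -
  define R where "R c = 2 ^ card I * (Q (r/2) c * inverse (Q (r/4) c))" for c
  have [measurable]: "R \<in> borel_measurable costs" unfolding R_def by measurable
  define A where "A = {c \<in> space costs. 1 \<le> ennreal (exp (- s)) * R c}"
  have A: "A \<in> sets costs" unfolding A_def by measurable
  have "emeasure costs A \<le> ennreal (exp (- s)) * (\<integral>\<^sup>+c. R c \<partial>costs)"
    using nn_integral_Markov_inequality[of "\<lambda>c. ennreal (exp (- s)) * R c" "space costs" costs 1]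
    by (simp add: A_def nn_integral_cmult Int_def cong: conj_cong)
  also have "(\<integral>\<^sup>+c. R c \<partial>costs) \<le> 2 ^ card I * ennreal (4/3) ^ card I"
    using Q_ratio_bound by (simp add: R_def nn_integral_cmult mult_left_mono)
  also have "2 ^ card I * ennreal (4/3) ^ card I = ennreal ((8/3) ^ card I)"
  proof -
    have "2 ^ card I * ennreal (4/3) ^ card I = (2 * ennreal (4/3)) ^ card I"
      by (rule power_mult_distrib[symmetric])
    also have "2 * ennreal (4/3) = ennreal (8/3)" using ennreal_mult'[of 2 "4/3"] by simp
    finally show ?thesis by (simp only: ennreal_power)
  qed
  finally have "emeasure costs A \<le> ennreal (exp (- s) * (8/3) ^ card I)"
    by (simp add: mult_left_mono ennreal_mult)
  then have m: "measure costs A \<le> exp (- s) * (8/3) ^ card I"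
    by (simp add: C.emeasure_eq_measure)
  have "r * val D < 4 * s"
    if c: "c \<in> space costs" "c \<notin> A" and pos: "\<And>e. e \<in> E \<Longrightarrow> 0 < c e" and D: "feasible c D" for c D
  proof -
  let ?q = "Q (r/4) c"
  have q: "?q \<noteq> 0" "?q < top" using Q_positive[OF c(1) pos, of "r/4"] Q_finite[OF c(1), of "r/4"] r by (auto simp del: not_gr_zero)
  have "ennreal (exp (r/4 * val D)) * ?q \<le> 2 ^ card I * Q (r/2) c"
    using Q_doubling[OF c(1) D, of "r/4"] by simp
  then have "ennreal (exp (r/4 * val D)) * ?q * inverse ?q \<le> 2 ^ card I * Q (r/2) c * inverse ?q"
    by (rule mult_right_mono) simp
  moreover have "?q * inverse ?q = 1" using q by (simp add: divide_ennreal_def[symmetric])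
  ultimately have *: "ennreal (exp (r/4 * val D)) \<le> R c"
    by (simp add: R_def mult.assoc)
  have "ennreal (exp (- s + r/4 * val D)) = ennreal (exp (- s)) * ennreal (exp (r/4 * val D))"
    by (simp only: exp_add) (simp add: ennreal_mult)
  also have "\<dots> \<le> ennreal (exp (- s)) * R c" using * by (rule mult_left_mono) simp
  also have "\<dots> < 1" using c by (simp add: A_def not_le)
  finally have "exp (- s + r/4 * val D) < 1" by (simp add: ennreal_less_one_iff)
  then show ?thesis by simp
  qed
  with A m show ?thesis by (intro exI[of _ A]) blast
qed

end

section \<open>The auction algorithm\<close>

text \<open>The minimum is located by a left-to-right scan rather than by choice, because both the
  loop of the program and the measurability proof follow this recursion. The default 1 is also the
  value at \<open>Suc 0\<close>, since \<open>f 1 < f 1\<close> fails.\<close>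

primrec best :: "(nat \<Rightarrow> real) \<Rightarrow> nat \<Rightarrow> nat" where
  "best f 0 = 1"
| "best f (Suc j) = (if f (Suc j) < f (best f j) then Suc j else best f j)"

lemma best_bounds: "1 \<le> best f n \<and> best f n \<le> max 1 n"
  by (induction n) auto

lemma best_le: "1 \<le> j \<Longrightarrow> j \<le> n \<Longrightarrow> f (best f n) \<le> f j"
proof (induction n)
  case (Suc n)
  then show ?case by (cases "j = Suc n"; cases n) force+
qed simp

section \<open>The auction with unit price increments\<close>

type_synonym auction_state = "(nat \<Rightarrow> nat) \<times> (nat \<Rightarrow> nat) \<times> nat \<times> nat"

text \<open>A state consists of the prices of the objects, their owners (\<open>0\<close> for none), the person who
  bids next, and the largest person who has entered so far.\<close>

definition bid :: "nat \<Rightarrow> (nat \<Rightarrow> nat \<Rightarrow> real) \<Rightarrow> auction_state \<Rightarrow> auction_state" where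
  "bid n w = (\<lambda>(p, own, cur, nxt). let b = best (\<lambda>j. w cur j + real (p j)) n in
     (p(b := p b + 1), own(b := cur),
      if own b = 0 then nxt + 1 else own b, if own b = 0 then nxt + 1 else nxt))"

definition bidder :: "auction_state \<Rightarrow> nat" where
  "bidder = (\<lambda>(p, own, cur, nxt). cur)"

text \<open>The state is frozen once the bidder exceeds \<open>n\<close>. This makes the auction a
  total function of the number of rounds, which spares stopping times both in the loop invariant and
  in the measurability argument.\<close>

definition auction :: "nat \<Rightarrow> (nat \<Rightarrow> nat \<Rightarrow> real) \<Rightarrow> nat \<Rightarrow> auction_state" where
  "auction n w m = ((\<lambda>st. if n < bidder st then st else bid n w st) ^^ m) (\<lambda>_. 0, \<lambda>_. 0, 1, 1)"

lemma auction_0: "auction n w 0 = (\<lambda>_. 0, \<lambda>_. 0, 1, 1)"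
  by (simp add: auction_def)

lemma auction_Suc: "auction n w (Suc m) =
    (if n < bidder (auction n w m) then auction n w m else bid n w (auction n w m))"
  by (simp add: auction_def)

lemma auction_stopped_add: "n < bidder (auction n w m) \<Longrightarrow> auction n w (m + d) = auction n w m"
  by (induction d) (simp_all add: auction_Suc)

lemma auction_stopped:
  "n < bidder (auction n w m) \<Longrightarrow> n < bidder (auction n w m') \<Longrightarrow> auction n w m = auction n w m'"
  by (metis auction_stopped_add le_add_diff_inverse nat_le_linear)

text \<open>Of the persons \<open>1..nxt\<close> exactly one, \<open>cur\<close>, owns nothing;
  \<open>cur = nxt = n + 1\<close> encodes the end. Unowned objects still have price 0, which is
  what bounds the prices. The last clause is complementary slackness up to an error of 1.\<close>

definition auction_inv :: "nat \<Rightarrow> (nat \<Rightarrow> nat \<Rightarrow> real) \<Rightarrow> nat \<Rightarrow> auction_state \<Rightarrow> bool" where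
  "auction_inv n w W = (\<lambda>(p, own, cur, nxt).
     1 \<le> cur \<and> cur \<le> nxt \<and> nxt \<le> n + 1 \<and> (cur \<le> n \<longrightarrow> nxt \<le> n) \<and>
     {j. own j \<noteq> 0} \<subseteq> {1..n} \<and> inj_on own {j. own j \<noteq> 0} \<and> own ` {j. own j \<noteq> 0} = {1..nxt} - {cur} \<and>
     (\<forall>j. own j = 0 \<longrightarrow> p j = 0) \<and> (\<forall>j. p j \<le> W + 1) \<and>
     (\<forall>j. own j \<noteq> 0 \<longrightarrow> (\<forall>j'\<in>{1..n}. w (own j) j + p j \<le> w (own j) j' + p j' + 1)))"

lemma auction_inv_bid:
  assumes inv: "auction_inv n w W st" and cur: "bidder st \<le> n"
    and w: "\<And>i j. i \<in> {1..n} \<Longrightarrow> j \<in> {1..n} \<Longrightarrow> 0 \<le> w i j \<and> w i j \<le> real W"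
  shows "auction_inv n w W (bid n w st)"
proof -
  obtain p own cur nxt where st: "st = (p, own, cur, nxt)" by (cases st)
  define b where "b = best (\<lambda>j. w cur j + real (p j)) n"
  let ?S = "{j. own j \<noteq> 0}"
  have c: "1 \<le> cur" "cur \<le> nxt" "nxt \<le> n" "cur \<le> n" and S: "?S \<subseteq> {1..n}" and inj: "inj_on own ?S"
    and im: "own ` ?S = {1..nxt} - {cur}" and p0: "\<And>j. own j = 0 \<Longrightarrow> p j = 0" and pW: "\<And>j. p j \<le> W + 1"
    and cs: "\<And>j j'. own j \<noteq> 0 \<Longrightarrow> j' \<in> {1..n} \<Longrightarrow> w (own j) j + p j \<le> w (own j) j' + p j' + 1"
    using inv cur by (auto simp: auction_inv_def st bidder_def)
  have b: "b \<in> {1..n}" using best_bounds[of _ n] c unfolding b_def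
    by (metis atLeastAtMost_iff le_trans max.absorb2)
  have bmin: "w cur b + p b \<le> w cur j + p j" if "j \<in> {1..n}" for j
    using best_le[of j n "\<lambda>j. w cur j + real (p j)"] that by (simp add: b_def)
  \<comment> \<open>Fewer than \<open>n\<close> objects are owned, so there is an unowned one, of
    price 0. The best object is no worse for \<open>cur\<close> than that one, hence its price is
    still at most \<open>W\<close>.\<close>
  have "card ?S = card ({1..nxt} - {cur})" using card_image[OF inj] im by simp
  also have "\<dots> = nxt - 1" using c by (subst card_Diff_singleton) auto
  also have "\<dots> < card {1..n}" using c by simp
  finally have "?S \<noteq> {1..n}" by auto
  then have "\<not> {1..n} \<subseteq> ?S" using subset_antisym[OF S] by (rule contrapos_nn)
  then have "\<exists>j0\<in>{1..n}. own j0 = 0" by auto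
  then obtain j0 where j0: "j0 \<in> {1..n}" "own j0 = 0" by blast
  have "cur \<in> {1..n}" using c by simp
  note wb = w[OF this b] and wj = w[OF this j0(1)]
  have "real (p b) \<le> W" using bmin[OF j0(1)] p0[OF j0(2)] wb wj by linarith
  then have pb: "p b \<le> W" by simp
  define own' where "own' = own(b := cur)"
  define p' where "p' = p(b := p b + 1)"
  have bid: "bid n w st = (p', own',
      if own b = 0 then nxt + 1 else own b, if own b = 0 then nxt + 1 else nxt)"
    by (simp add: bid_def st b_def Let_def own'_def p'_def)
  have S': "{j. own' j \<noteq> 0} = insert b ?S" using c by (auto simp: own'_def)
  have Sn: "{j. own' j \<noteq> 0} \<subseteq> {1..n}" using S b unfolding S' by blast
  have nim: "cur \<notin> own ` ?S" unfolding im by simp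
  have inj': "inj_on own' {j. own' j \<noteq> 0}"
    unfolding S' own'_def using inj nim by (intro inj_onI) (auto dest: inj_onD split: if_splits)
  have p0': "\<forall>j. own' j = 0 \<longrightarrow> p' j = 0" using p0 c by (simp add: own'_def p'_def)
  have pW': "\<forall>j. p' j \<le> W + 1" using pW pb by (simp add: p'_def)
  \<comment> \<open>Only the price of \<open>b\<close> rises, and by 1. The new owner bought an
    optimal object and is off by at most 1 afterwards; for every other owner the alternatives can
    only have become dearer.\<close>
  have cs': "\<forall>j. own' j \<noteq> 0 \<longrightarrow> (\<forall>j'\<in>{1..n}. w (own' j) j + p' j \<le> w (own' j) j' + p' j' + 1)"
  proof (intro allI impI ballI)
    fix j j' assume j: "own' j \<noteq> 0" "j' \<in> {1..n}"
    have le: "real (p j') \<le> real (p' j')" by (simp add: p'_def)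
    show "w (own' j) j + p' j \<le> w (own' j) j' + p' j' + 1"
    proof (cases "j = b")
      case True
      then show ?thesis using bmin[OF j(2)] le by (simp add: own'_def p'_def)
    next
      case False
      then have "own' j = own j" "p' j = p j" by (simp_all add: own'_def p'_def)
      then show ?thesis using cs[OF _ j(2), of j] j le by simp
    qed
  qed
  have im': "own' ` {j. own' j \<noteq> 0} = insert cur (own ` (?S - {b}))"
    unfolding S' by (auto simp: own'_def)
  show ?thesis
  proof (cases "own b = 0")
    case True
    then have "?S - {b} = ?S" by auto
    moreover have "insert cur ({1..nxt} - {cur}) = {1..nxt+1} - {nxt+1}" using c by auto
    ultimately have "own' ` {j. own' j \<noteq> 0} = {1..nxt+1} - {nxt+1}" using im im' by metis
    then show ?thesis
      using c Sn inj' p0' pW' cs' True unfolding bid by (simp add: auction_inv_def del: fun_upd_apply)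
  next
    case False
    have "own ` (?S - {b}) = own ` ?S - {own b}" using inj False by (auto simp: inj_on_def)
    moreover have ob: "own b \<in> {1..nxt} - {cur}" using im False by blast
    ultimately have "own' ` {j. own' j \<noteq> 0} = {1..nxt} - {own b}" unfolding im' im using c by auto
    then show ?thesis
      using c Sn inj' p0' pW' cs' False ob unfolding bid by (simp add: auction_inv_def)
  qed
qed

lemma bid_total_price:
  assumes "1 \<le> n"
  shows "(\<Sum>j\<in>{1..n}. fst (bid n w st) j) = Suc (\<Sum>j\<in>{1..n}. fst st j)"
proof -
  obtain p own cur nxt where st: "st = (p, own, cur, nxt)" by (cases st)
  define b where "b = best (\<lambda>j. w cur j + real (p j)) n"
  have b: "b \<in> {1..n}" using best_bounds[of _ n] assms unfolding b_def
    by (metis atLeastAtMost_iff le_trans max.absorb2)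
  then show ?thesis
    by (simp add: bid_def st Let_def b_def[symmetric] sum.remove[of _ b])
qed

locale auction_data =
  fixes n :: nat and w :: "nat \<Rightarrow> nat \<Rightarrow> real" and W :: nat
  assumes n: "1 \<le> n"
    and w: "\<And>i j. i \<in> {1..n} \<Longrightarrow> j \<in> {1..n} \<Longrightarrow> 0 \<le> w i j \<and> w i j \<le> real W"
begin

lemma auction_inv_auction: "auction_inv n w W (auction n w m)"
proof (induction m)
  case 0
  have "{1..1} - {1::nat} = {}" by auto
  then show ?case using n by (simp add: auction_0 auction_inv_def)
next
  case (Suc m)
  then show ?case using auction_inv_bid[OF Suc _ w] by (auto simp: auction_Suc)
qed

lemma auction_total_price:
  "bidder (auction n w m) \<le> n \<Longrightarrow> (\<Sum>j\<in>{1..n}. fst (auction n w m) j) = m"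
proof (induction m)
  case 0
  then show ?case by (simp add: auction_0)
next
  case (Suc m)
  then have "bidder (auction n w m) \<le> n" by (auto simp: auction_Suc split: if_splits)
  with Suc show ?case
    using bid_total_price[OF n, of w "auction n w m"] by (simp add: auction_Suc)
qed

text \<open>The total price is a potential: each bid raises it by 1, and each of the
  \<open>n\<close> prices stays at most \<open>W + 1\<close>.\<close>

lemma auction_running: "bidder (auction n w m) \<le> n \<Longrightarrow> m \<le> n * (W + 1)"
proof -
  assume *: "bidder (auction n w m) \<le> n"
  have "m = (\<Sum>j\<in>{1..n}. fst (auction n w m) j)" using auction_total_price[OF *] by simp
  also have "\<dots> \<le> (\<Sum>j\<in>{1..n}. W + 1)"
    using auction_inv_auction[of m] by (intro sum_mono) (auto simp: auction_inv_def split: prod.splits)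
  finally show ?thesis by simp
qed

end

text \<open>\<open>n * (W + 1) + 1\<close> rounds are more than a running auction can survive, so
  this is the final assignment of objects to persons.\<close>

definition owner :: "nat \<Rightarrow> (nat \<Rightarrow> nat \<Rightarrow> real) \<Rightarrow> nat \<Rightarrow> nat \<Rightarrow> nat" where
  "owner n w W = fst (snd (auction n w (n * (W + 1) + 1)))"

definition price :: "nat \<Rightarrow> (nat \<Rightarrow> nat \<Rightarrow> real) \<Rightarrow> nat \<Rightarrow> nat \<Rightarrow> nat" where
  "price n w W = fst (auction n w (n * (W + 1) + 1))"

context auction_data
begin

lemma auction_final:
  shows owner_bij: "bij_betw (owner n w W) {1..n} {1..n}"
    and owner_optimal: "\<And>j j'. j \<in> {1..n} \<Longrightarrow> j' \<in> {1..n} \<Longrightarrow>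
       w (owner n w W j) j + price n w W j \<le> w (owner n w W j) j' + price n w W j' + 1"
    and price_le: "\<And>j. price n w W j \<le> W + 1"
proof -
  let ?st = "auction n w (n * (W + 1) + 1)"
  obtain p own cur nxt where st: "?st = (p, own, cur, nxt)" by (cases ?st)
  have *: "owner n w W = own" "price n w W = p" using st by (auto simp: owner_def price_def)
  have inv: "auction_inv n w W (p, own, cur, nxt)" using auction_inv_auction[of "n * (W + 1) + 1"] st by simp
  have "\<not> bidder ?st \<le> n" using auction_running[of "n * (W + 1) + 1"] by auto
  \<comment> \<open>A finished auction has \<open>cur = nxt = n + 1\<close>, so by the invariant the
    owners are exactly \<open>1..n\<close>; counting then shows that all objects are sold.\<close>
  then have "cur = n + 1" "nxt = n + 1" using inv st by (auto simp: bidder_def auction_inv_def)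
  then have im: "own ` {j. own j \<noteq> 0} = {1..n}" and inj: "inj_on own {j. own j \<noteq> 0}" and S: "{j. own j \<noteq> 0} \<subseteq> {1..n}"
    using inv by (auto simp: auction_inv_def atLeastAtMostSuc_conv)
  have "card {j. own j \<noteq> 0} = card {1..n}" using card_image[OF inj] im by simp
  then have S': "{j. own j \<noteq> 0} = {1..n}" using S by (intro card_subset_eq) auto
  show "bij_betw (owner n w W) {1..n} {1..n}" using im inj unfolding S' by (simp add: * bij_betw_def)
  show "w (owner n w W j) j + price n w W j \<le> w (owner n w W j) j' + price n w W j' + 1"
    if "j \<in> {1..n}" "j' \<in> {1..n}" for j j'
  proof -
    have "own j \<noteq> 0" using that S' by blast
    then show ?thesis using inv that unfolding * by (auto simp: auction_inv_def)
  qed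
  show "price n w W j \<le> W + 1" for j using inv unfolding * by (auto simp: auction_inv_def)
qed

end

section \<open>Layer by layer construction\<close>

text \<open>A matching within \<open>n\<close> of the average over the free edges weighs at most
  \<open>n * n * n + n\<close>, as free edges weigh at most \<open>n * n\<close>. One used edge is
  made dearer than that.\<close>

definition big :: "nat \<Rightarrow> nat" where
  "big n = n * n * n + n + 1"

text \<open>The factor \<open>n\<close> turns the unit increments of the auction into an error of
  \<open>1/n\<close> per person, hence 1 in total. Clipping to the interval from 0 to
  \<open>n * n\<close> bounds the running time for every real input; it changes nothing when all
  costs lie between 0 and \<open>n\<close>.\<close>

definition weights :: "nat \<Rightarrow> (nat \<times> nat) set \<Rightarrow> (nat \<Rightarrow> nat \<Rightarrow> real) \<Rightarrow> nat \<Rightarrow> nat \<Rightarrow> real" where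
  "weights n U c i j = (if (i, j) \<in> U then real (big n) else min (real (n * n)) (max 0 (real n * c i j)))"

lemma weights_bounds: "0 \<le> weights n U c i j \<and> weights n U c i j \<le> real (big n)"
proof -
  have "n * n \<le> big n" unfolding big_def by (cases n) auto
  then have "real (n * n) \<le> real (big n)" by (simp only: of_nat_le_iff)
  then show ?thesis by (auto simp: weights_def min_def)
qed

lemma auction_data_weights: "1 \<le> n \<Longrightarrow> auction_data n (weights n U c) (big n)"
  using weights_bounds by (simp add: auction_data_def)

abbreviation free_edges :: "nat \<Rightarrow> (nat \<times> nat) set \<Rightarrow> (nat \<times> nat) set" where
  "free_edges n U \<equiv> {1..n} \<times> {1..n} - U"

definition regular :: "nat \<Rightarrow> nat \<Rightarrow> (nat \<times> nat) set \<Rightarrow> bool" where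
  "regular n r U \<longleftrightarrow> (\<forall>i\<in>{1..n}. card {j\<in>{1..n}. (i, j) \<notin> U} = r) \<and>
                     (\<forall>j\<in>{1..n}. card {i\<in>{1..n}. (i, j) \<notin> U} = r)"

lemma sum_free_edges:
  "(\<Sum>e\<in>free_edges n U. f (fst e) (snd e)) = (\<Sum>i\<in>{1..n}. \<Sum>j\<in>{j\<in>{1..n}. (i, j) \<notin> U}. f i j)"
proof -
  have "free_edges n U = Sigma {1..n} (\<lambda>i. {j\<in>{1..n}. (i, j) \<notin> U})" by auto
  then show ?thesis by (simp add: sum.Sigma case_prod_beta')
qed

lemma sum_free_edges':
  "(\<Sum>e\<in>free_edges n U. f (fst e) (snd e)) = (\<Sum>j\<in>{1..n}. \<Sum>i\<in>{i\<in>{1..n}. (i, j) \<notin> U}. f i j)"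
  unfolding sum_free_edges by (rule sum.swap_restrict) auto

text \<open>Equivalently, weight \<open>1/r\<close> on every free edge is a fractional perfect
  matching.\<close>

lemma sum_free_edges_regular:
  fixes u v :: "nat \<Rightarrow> real"
  assumes "regular n r U"
  shows "(\<Sum>e\<in>free_edges n U. u (fst e) + v (snd e)) = r * ((\<Sum>i\<in>{1..n}. u i) + (\<Sum>j\<in>{1..n}. v j))"
proof -
  have "(\<Sum>e\<in>free_edges n U. u (fst e)) = r * (\<Sum>i\<in>{1..n}. u i)"
    using assms sum_free_edges[where f = "\<lambda>i j. u i" and n = n and U = U]
    by (simp add: regular_def sum_distrib_left)
  moreover have "(\<Sum>e\<in>free_edges n U. v (snd e)) = r * (\<Sum>j\<in>{1..n}. v j)"
    using assms sum_free_edges'[where f = "\<lambda>i j. v j" and n = n and U = U]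
    by (simp add: regular_def sum_distrib_left)
  ultimately show ?thesis by (simp add: sum.distrib distrib_left)
qed

lemma card_free_edges: "regular n r U \<Longrightarrow> card (free_edges n U) = n * r"
proof -
  assume "regular n r U"
  then have "real (card (free_edges n U)) = real (n * r)"
    using sum_free_edges_regular[of n r U "\<lambda>_. 1" "\<lambda>_. 0"] by simp
  then show ?thesis by (simp only: of_nat_eq_iff)
qed

definition matching :: "nat \<Rightarrow> (nat \<times> nat) set \<Rightarrow> (nat \<Rightarrow> nat \<Rightarrow> real) \<Rightarrow> nat \<Rightarrow> nat" where
  "matching n U c = owner n (weights n U c) (big n)"

lemma matching_bij: "1 \<le> n \<Longrightarrow> bij_betw (matching n U c) {1..n} {1..n}"
  unfolding matching_def by (rule auction_data.owner_bij[OF auction_data_weights])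

text \<open>Comparison with the fractional matching of weight \<open>1/r\<close> on each free edge.
  Approximate slackness is summed over the free edges; every price then occurs \<open>r\<close>
  times on both sides and cancels, and an error of 1 for each of the \<open>r * n\<close> edges
  remains.\<close>

lemma matching_le_weights:
  assumes n: "1 \<le> n" and r: "regular n r U"
  shows "real r * (\<Sum>j\<in>{1..n}. weights n U c (matching n U c j) j)
      \<le> (\<Sum>e\<in>free_edges n U. weights n U c (fst e) (snd e)) + real r * real n"
proof -
  interpret auction_data n "weights n U c" "big n" by (rule auction_data_weights[OF n])
  let ?w = "weights n U c" and ?s = "matching n U c" and ?p = "\<lambda>j. real (price n (weights n U c) (big n) j)"
  \<comment> \<open>Slackness is stated per object, while the sum over free edges groups by persons,
    so the matching is inverted.\<close>
  let ?t = "the_inv_into {1..n} ?s"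
  have b: "bij_betw ?s {1..n} {1..n}" by (rule matching_bij[OF n])
  have t: "bij_betw ?t {1..n} {1..n}" by (rule bij_betw_the_inv_into[OF b])
  have st: "?s (?t i) = i" "?t i \<in> {1..n}" if "i \<in> {1..n}" for i
    using f_the_inv_into_f_bij_betw[OF b] bij_betwE[OF t] that by auto
  have opt: "?w i (?t i) + ?p (?t i) \<le> ?w i j + ?p j + 1" if "i \<in> {1..n}" "j \<in> {1..n}" for i j
    using owner_optimal[of "?t i" j] st[OF that(1)] that by (simp add: matching_def)
  have "r * ((\<Sum>i\<in>{1..n}. ?w i (?t i) + ?p (?t i)) + (\<Sum>j\<in>{1..n}. 0::real)) =
      (\<Sum>e\<in>free_edges n U. (?w (fst e) (?t (fst e)) + ?p (?t (fst e))) + 0)"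
    by (rule sum_free_edges_regular[OF r, symmetric])
  also have "\<dots> \<le> (\<Sum>e\<in>free_edges n U. ?w (fst e) (snd e) + (0 + (?p (snd e) + 1)))"
  proof (rule sum_mono)
    fix e assume "e \<in> free_edges n U"
    then have "fst e \<in> {1..n}" "snd e \<in> {1..n}" by auto
    from opt[OF this] show "?w (fst e) (?t (fst e)) + ?p (?t (fst e)) + 0 \<le> ?w (fst e) (snd e) + (0 + (?p (snd e) + 1))"
      by simp
  qed
  also have "\<dots> = (\<Sum>e\<in>free_edges n U. ?w (fst e) (snd e)) + r * (\<Sum>j\<in>{1..n}. ?p j + 1)"
    by (subst sum.distrib, subst sum_free_edges_regular[OF r, of "\<lambda>_. 0" "\<lambda>j. ?p j + 1"]) simp
  finally have "r * ((\<Sum>i\<in>{1..n}. ?w i (?t i)) + (\<Sum>i\<in>{1..n}. ?p (?t i)))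
     \<le> (\<Sum>e\<in>free_edges n U. ?w (fst e) (snd e)) + r * ((\<Sum>j\<in>{1..n}. ?p j) + n)"
    by (simp add: sum.distrib)
  moreover have "(\<Sum>i\<in>{1..n}. ?p (?t i)) = (\<Sum>j\<in>{1..n}. ?p j)"
    by (rule sum.reindex_bij_betw[OF t])
  moreover have "(\<Sum>i\<in>{1..n}. ?w i (?t i)) = (\<Sum>j\<in>{1..n}. ?w (?s j) j)"
  proof -
    have "(\<Sum>j\<in>{1..n}. ?w (?s j) j) = (\<Sum>j\<in>{1..n}. ?w (?s j) (?t (?s j)))"
      using the_inv_into_f_f[OF bij_betw_imp_inj_on[OF b]] by simp
    also have "\<dots> = (\<Sum>i\<in>{1..n}. ?w i (?t i))" by (rule sum.reindex_bij_betw[OF b])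
    finally show ?thesis by simp
  qed
  ultimately show ?thesis by (simp add: distrib_left)
qed

text \<open>No appeal to Hall's theorem is needed: by the preceding bound a matching using a forbidden
  edge would be more expensive than the average over the free edges.\<close>

lemma matching_free:
  assumes n: "1 \<le> n" and r: "regular n r U" "1 \<le> r" and j: "j \<in> {1..n}"
  shows "(matching n U c j, j) \<notin> U"
proof
  assume U: "(matching n U c j, j) \<in> U"
  let ?w = "weights n U c"
  have "real (big n) = ?w (matching n U c j) j" using U by (simp add: weights_def)
  also have "\<dots> \<le> (\<Sum>j\<in>{1..n}. ?w (matching n U c j) j)"
    using weights_bounds j by (intro member_le_sum) auto
  finally have "r * real (big n) \<le> r * (\<Sum>j\<in>{1..n}. ?w (matching n U c j) j)" by (rule mult_left_mono) simp
  also have "\<dots> \<le> (\<Sum>e\<in>free_edges n U. ?w (fst e) (snd e)) + real r * real n"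
    by (rule matching_le_weights[OF n r(1)])
  also have "\<dots> \<le> (\<Sum>e\<in>free_edges n U. real (n * n)) + real r * real n"
    by (intro add_right_mono sum_mono) (auto simp: weights_def)
  also have "\<dots> = r * (real (n * n * n) + n)"
    using card_free_edges[OF r(1)] by (simp add: algebra_simps)
  finally have "real (big n) \<le> real (n * n * n) + n" using r(2) by simp
  then show False by (simp add: big_def)
qed

text \<open>The auction prices \<open>p\<close> and \<open>u i = Min (w i j + p j)\<close>, both
  divided by \<open>n\<close>, are a nonnegative dual solution. Approximate slackness leaves a gap
  of 1 per object, which is 1 altogether after the division; the other 1 in the constant 2 pays for
  the surcharge on the prices.\<close>

lemma matching_certificate:
  assumes n: "1 \<le> n" and r: "regular n r U" "1 \<le> r"
    and c: "\<And>i j. i \<in> {1..n} \<Longrightarrow> j \<in> {1..n} \<Longrightarrow> 0 < c i j \<and> c i j \<le> n"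
  shows "\<exists>u p. (\<forall>i\<in>{1..n}. 0 \<le> u i) \<and> (\<forall>j\<in>{1..n}. 0 \<le> p j) \<and>
    (\<forall>i\<in>{1..n}. \<forall>j\<in>{1..n}. (i, j) \<notin> U \<longrightarrow> u i - p j \<le> c i j) \<and>
    (\<Sum>j\<in>{1..n}. c (matching n U c j) j)
        \<le> (\<Sum>i\<in>{1..n}. u i) - (1 + 1 / (real (big n) + 1)) * (\<Sum>j\<in>{1..n}. p j) + 2"
proof -
  interpret auction_data n "weights n U c" "big n" by (rule auction_data_weights[OF n])
  let ?w = "weights n U c" and ?s = "matching n U c" and ?p = "\<lambda>j. real (price n (weights n U c) (big n) j)"
  define u where "u i = Min ((\<lambda>j. ?w i j + ?p j) ` {1..n})" for i
  have b: "bij_betw ?s {1..n} {1..n}" by (rule matching_bij[OF n])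
  have s: "?s j \<in> {1..n}" if "j \<in> {1..n}" for j using bij_betwE[OF b] that by auto
  have u_le: "u i \<le> ?w i j + ?p j" if "j \<in> {1..n}" for i j
    using that unfolding u_def by (intro Min_le) auto
  have u_nonneg: "0 \<le> u i" for i
    unfolding u_def using n weights_bounds[of n U c i] by (subst Min_ge_iff) (auto intro!: add_nonneg_nonneg)
  have u_ge: "?w (?s j) j + ?p j - 1 \<le> u (?s j)" if "j \<in> {1..n}" for j
    unfolding u_def using n owner_optimal[OF that] by (subst Min_ge_iff) (auto simp: matching_def algebra_simps)
  have w: "?w i j = n * c i j" if "i \<in> {1..n}" "j \<in> {1..n}" "(i, j) \<notin> U" for i j
    using c[OF that(1,2)] that(3) by (auto simp: weights_def)
  have "(\<Sum>j\<in>{1..n}. ?w (?s j) j + ?p j - 1) \<le> (\<Sum>j\<in>{1..n}. u (?s j))"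
    by (intro sum_mono u_ge)
  also have "\<dots> = (\<Sum>i\<in>{1..n}. u i)" by (rule sum.reindex_bij_betw[OF b])
  also have "(\<Sum>j\<in>{1..n}. ?w (?s j) j + ?p j - 1) = (\<Sum>j\<in>{1..n}. ?w (?s j) j) + (\<Sum>j\<in>{1..n}. ?p j) - n"
    by (simp add: sum.distrib sum_subtractf)
  also have "(\<Sum>j\<in>{1..n}. ?w (?s j) j) = n * (\<Sum>j\<in>{1..n}. c (?s j) j)"
    unfolding sum_distrib_left using w s matching_free[OF n r] by (intro sum.cong) auto
  finally have main: "n * (\<Sum>j\<in>{1..n}. c (?s j) j) + (\<Sum>j\<in>{1..n}. ?p j) - n \<le> (\<Sum>i\<in>{1..n}. u i)" .
  \<comment> \<open>The prices are at most \<open>big n + 1\<close>, so the surcharge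
    \<open>1 / (big n + 1)\<close> on the scaled prices adds up to at most 1.\<close>
  have P: "(\<Sum>j\<in>{1..n}. ?p j) \<le> n * (real (big n) + 1)"
  proof -
    have "?p j \<le> real (big n) + 1" for j
      using of_nat_mono[OF price_le[of j], where 'a = real] by simp
    then have "(\<Sum>j\<in>{1..n}. ?p j) \<le> (\<Sum>j\<in>{1..n}. real (big n) + 1)" by (intro sum_mono) auto
    then show ?thesis by simp
  qed
  moreover have "0 < n * (real (big n) + 1)" using n by (intro mult_pos_pos) auto
  ultimately have P': "(\<Sum>j\<in>{1..n}. ?p j) / n * (1 / (real (big n) + 1)) \<le> 1"
    by (simp add: divide_le_eq)
  show ?thesis
  proof (rule exI[of _ "\<lambda>i. u i / n"], rule exI[of _ "\<lambda>j. ?p j / n"], intro conjI ballI impI)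
    show "u i / n - ?p j / n \<le> c i j" if "i \<in> {1..n}" "j \<in> {1..n}" "(i, j) \<notin> U" for i j
      using u_le[OF that(2), of i] w[OF that] n by (simp add: field_simps)
    have "(\<Sum>j\<in>{1..n}. c (?s j) j) \<le> (\<Sum>i\<in>{1..n}. u i) / n - (\<Sum>j\<in>{1..n}. ?p j) / n + 1"
      using main n by (simp add: field_simps)
    also have "\<dots> \<le> (\<Sum>i\<in>{1..n}. u i) / n - (1 + 1 / (real (big n) + 1)) * ((\<Sum>j\<in>{1..n}. ?p j) / n) + 2"
    proof -
      have "x - y + 1 \<le> x - (1 + z) * y + 2" if "y * z \<le> 1" for x y z :: real
        using that by (simp add: algebra_simps)
      from this[OF P'] show ?thesis .
    qed
    finally show "(\<Sum>j\<in>{1..n}. c (?s j) j)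
        \<le> (\<Sum>i\<in>{1..n}. u i / n) - (1 + 1 / (real (big n) + 1)) * (\<Sum>j\<in>{1..n}. ?p j / n) + 2"
      by (simp only: sum_divide_distrib)
  qed (use u_nonneg in auto)
qed

section \<open>Stacking disjoint matchings to an axial assignment\<close>

definition layer :: "(nat list \<Rightarrow> real) \<Rightarrow> nat \<Rightarrow> nat \<Rightarrow> nat \<Rightarrow> real" where
  "layer C k i j = C [i, j, k]"

primrec used :: "nat \<Rightarrow> (nat list \<Rightarrow> real) \<Rightarrow> nat \<Rightarrow> (nat \<times> nat) set" where
  "used n C 0 = {}"
| "used n C (Suc k) = used n C k \<union> (\<lambda>j. (matching n (used n C k) (layer C (Suc k)) j, j)) ` {1..n}"

text \<open>The index \<open>k\<close> counts the layers that are already filled; this is the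
  matching placed in layer \<open>Suc k\<close>.\<close>

definition layer_matching :: "nat \<Rightarrow> (nat list \<Rightarrow> real) \<Rightarrow> nat \<Rightarrow> nat \<Rightarrow> nat" where
  "layer_matching n C k = matching n (used n C k) (layer C (Suc k))"

primrec marked :: "nat \<Rightarrow> (nat list \<Rightarrow> real) \<Rightarrow> nat \<Rightarrow> nat list set" where
  "marked n C 0 = {}"
| "marked n C (Suc k) = marked n C k \<union> (\<lambda>j. [layer_matching n C k j, j, Suc k]) ` {1..n}"

lemma used_Suc: "used n C (Suc k) = used n C k \<union> (\<lambda>j. (layer_matching n C k j, j)) ` {1..n}"
  by (simp add: layer_matching_def)

declare used.simps(2) [simp del]

lemma layer_matching_bij: "1 \<le> n \<Longrightarrow> bij_betw (layer_matching n C k) {1..n} {1..n}"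
  unfolding layer_matching_def by (rule matching_bij)

lemma layer_matching_in: "1 \<le> n \<Longrightarrow> j \<in> {1..n} \<Longrightarrow> layer_matching n C k j \<in> {1..n}"
  using bij_betwE[OF layer_matching_bij] by blast

lemma used_subset: "1 \<le> n \<Longrightarrow> used n C k \<subseteq> {1..n} \<times> {1..n}"
  by (induction k) (use layer_matching_in in \<open>auto simp: used_Suc\<close>)

text \<open>Each layer removes a perfect matching of the free graph, which lowers every degree by
  exactly 1. Before the step the degree \<open>n - k\<close> is still positive, so the matching does
  avoid the used cells.\<close>

lemma used_regular: "1 \<le> n \<Longrightarrow> k \<le> n \<Longrightarrow> regular n (n - k) (used n C k)"
proof (induction k)
  case 0
  have "{1..n} = {j. Suc 0 \<le> j \<and> j \<le> n}" by auto
  then have "card {j. Suc 0 \<le> j \<and> j \<le> n} = n" by (metis card_atLeastAtMost diff_Suc_1)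
  then show ?case by (simp add: regular_def)
next
  case (Suc k)
  let ?U = "used n C k" and ?s = "layer_matching n C k"
  have r: "regular n (n - k) ?U" using Suc by simp
  have free: "(?s j, j) \<notin> ?U" if "j \<in> {1..n}" for j
    unfolding layer_matching_def using Suc.prems that by (intro matching_free[OF _ r]) auto
  note bij = layer_matching_bij[OF Suc.prems(1), of C k]
  show ?case
    unfolding regular_def
  proof (intro conjI ballI)
    fix i assume i: "i \<in> {1..n}"
    then have "i \<in> ?s ` {1..n}" using bij by (simp add: bij_betw_def)
    then obtain j where j: "j \<in> {1..n}" "?s j = i" by blast
    have uniq: "j' = j" if "?s j' = i" "j' \<in> {1..n}" for j'
      using that j bij_betw_imp_inj_on[OF bij] by (metis inj_onD)
    have "(i, j') \<in> (\<lambda>j. (?s j, j)) ` {1..n} \<longleftrightarrow> j' = j" if "j' \<in> {1..n}" for j'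
      unfolding image_iff prod.inject using uniq j that by blast
    then have "{j\<in>{1..n}. (i, j) \<notin> used n C (Suc k)} = {j\<in>{1..n}. (i, j) \<notin> ?U} - {j}"
      unfolding used_Suc by blast
    moreover have "j \<in> {j\<in>{1..n}. (i, j) \<notin> ?U}" using j free[OF j(1)] by auto
    moreover have "card {j\<in>{1..n}. (i, j) \<notin> ?U} = n - k" using r i by (auto simp: regular_def)
    ultimately show "card {j\<in>{1..n}. (i, j) \<notin> used n C (Suc k)} = n - Suc k"
      by (simp only: card_Diff_singleton)
  next
    fix j assume j: "j \<in> {1..n}"
    have "(i, j) \<in> (\<lambda>j. (?s j, j)) ` {1..n} \<longleftrightarrow> i = ?s j" for i
      unfolding image_iff prod.inject using j by blast
    then have "{i\<in>{1..n}. (i, j) \<notin> used n C (Suc k)} = {i\<in>{1..n}. (i, j) \<notin> ?U} - {?s j}"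
      unfolding used_Suc by blast
    moreover have "?s j \<in> {i\<in>{1..n}. (i, j) \<notin> ?U}"
      using layer_matching_in[OF Suc.prems(1) j] free[OF j] by auto
    moreover have "card {i\<in>{1..n}. (i, j) \<notin> ?U} = n - k" using r j by (auto simp: regular_def)
    ultimately show "card {i\<in>{1..n}. (i, j) \<notin> used n C (Suc k)} = n - Suc k"
      by (simp only: card_Diff_singleton)
  qed
qed

lemma layer_matching_free:
  "1 \<le> n \<Longrightarrow> k < n \<Longrightarrow> j \<in> {1..n} \<Longrightarrow> (layer_matching n C k j, j) \<notin> used n C k"
  unfolding layer_matching_def using used_regular[of n k C] by (intro matching_free) auto

lemma used_iff: "(i, j) \<in> used n C k \<longleftrightarrow> j \<in> {1..n} \<and> (\<exists>l<k. layer_matching n C l j = i)"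
  by (induction k) (auto simp: used_Suc less_Suc_eq)

lemma marked_iff:
  "x \<in> marked n C k \<longleftrightarrow> (\<exists>l<k. \<exists>j\<in>{1..n}. x = [layer_matching n C l j, j, Suc l])"
  by (induction k) (auto simp: less_Suc_eq)

text \<open>After \<open>n\<close> layers the free graph is 0-regular, hence empty.\<close>

lemma used_all:
  assumes "1 \<le> n" "i \<in> {1..n}" "j \<in> {1..n}"
  shows "(i, j) \<in> used n C n"
proof -
  have "card {j\<in>{1..n}. (i, j) \<notin> used n C n} = 0"
    using used_regular[of n n C] assms by (simp add: regular_def)
  then have "{j\<in>{1..n}. (i, j) \<notin> used n C n} = {}" by simp
  then show ?thesis using assms by blast
qed

lemma layer_matching_inj_layer:
  assumes "1 \<le> n" "j \<in> {1..n}" "k < n" "l < n" "layer_matching n C k j = layer_matching n C l j"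
  shows "k = l"
  using assms layer_matching_free[of n k j C] layer_matching_free[of n l j C]
  by (metis linorder_neqE_nat used_iff)

lemma marked_layer_disjoint:
  "marked n C k \<inter> (\<lambda>j. [layer_matching n C k j, j, Suc k]) ` {1..n} = {}"
  by (auto simp: marked_iff)

lemma finite_marked: "finite (marked n C k)"
  by (induction k) auto

lemma sum_marked:
  fixes f :: "nat list \<Rightarrow> 'b::comm_monoid_add"
  shows "(\<Sum>x\<in>marked n C k. f x) = (\<Sum>l<k. \<Sum>j\<in>{1..n}. f [layer_matching n C l j, j, Suc l])"
proof (induction k)
  case (Suc k)
  have "inj_on (\<lambda>j. [layer_matching n C k j, j, Suc k]) {1..n}" by (auto simp: inj_on_def)
  then have "(\<Sum>x\<in>(\<lambda>j. [layer_matching n C k j, j, Suc k]) ` {1..n}. f x)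
     = (\<Sum>j\<in>{1..n}. f [layer_matching n C k j, j, Suc k])"
    by (simp add: sum.reindex)
  moreover have "(\<Sum>x\<in>marked n C (Suc k). f x) = (\<Sum>x\<in>marked n C k. f x)
      + (\<Sum>x\<in>(\<lambda>j. [layer_matching n C k j, j, Suc k]) ` {1..n}. f x)"
    unfolding marked.simps by (rule sum.union_disjoint[OF finite_marked _ marked_layer_disjoint]) simp
  ultimately show ?case using Suc by simp
qed simp

lemma cube3: "x \<in> cube 3 n \<longleftrightarrow> (\<exists>i\<in>{1..n}. \<exists>j\<in>{1..n}. \<exists>k\<in>{1..n}. x = [i, j, k])"
  by (auto simp: cube_def length_Suc_conv numeral_3_eq_3)

lemma marked_subset_cube:
  assumes "1 \<le> n"
  shows "marked n C n \<subseteq> cube 3 n"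
proof
  fix x assume "x \<in> marked n C n"
  then obtain l j where "l < n" "j \<in> {1..n}" "x = [layer_matching n C l j, j, Suc l]"
    unfolding marked_iff by blast
  then show "x \<in> cube 3 n" using layer_matching_in[OF assms, of j C l] by (auto simp: cube3)
qed

text \<open>Each direction of lines rests on a different fact: the matching of a layer is a function
  of the column (\<open>r = 0\<close>), it is a bijection onto the rows (\<open>r = 1\<close>), and
  over all layers every cell is used once and only once (\<open>r = 2\<close>).\<close>

lemma marked_axial:
  assumes n: "1 \<le> n"
  shows "marked n C n \<in> axial_assignments 3 n"
proof -
  have card: "card (marked n C n) = n ^ (3 - 1)"
    using sum_marked[of "\<lambda>_. 1::nat" n C n] by (simp add: power2_eq_square)
  have "\<exists>!x. x \<in> marked n C n \<inter> L" if L: "L \<in> axis_lines 3 n" for L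
  proof -
    obtain a b c r where abc: "a \<in> {1..n}" "b \<in> {1..n}" "c \<in> {1..n}" and r: "r < 3"
      and L: "L = (\<lambda>j. [a, b, c][r := j]) ` {1..n}"
      using L unfolding axis_lines_def cube3 by blast
    let ?m = "layer_matching n C"
    have c': "c - 1 < n" "Suc (c - 1) = c" using abc(3) by auto
    consider "r = 0" | "r = 1" | "r = 2" using r by linarith
    then show ?thesis
    proof cases
      case 1
      have iff: "x \<in> marked n C n \<inter> L \<longleftrightarrow> x = [?m (c - 1) b, b, c]" for x
      proof
        assume "x \<in> marked n C n \<inter> L"
        then have "\<exists>l j. x = [?m l j, j, Suc l]" "\<exists>i. x = [i, b, c]"
          unfolding Int_iff L marked_iff 1 by auto
        then show "x = [?m (c - 1) b, b, c]" by auto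
      next
        assume x: "x = [?m (c - 1) b, b, c]"
        then have "x \<in> marked n C n" unfolding marked_iff using c' abc(2) by metis
        moreover have "x \<in> L"
          unfolding L using x 1 layer_matching_in[OF n abc(2)] by auto
        ultimately show "x \<in> marked n C n \<inter> L" by blast
      qed
      show ?thesis unfolding iff by simp
    next
      case 2
      note bij = layer_matching_bij[OF n, of C "c - 1"]
      from abc(1) have "a \<in> ?m (c - 1) ` {1..n}" using bij by (simp add: bij_betw_def)
      then obtain j where j: "j \<in> {1..n}" "?m (c - 1) j = a" by blast
      have iff: "x \<in> marked n C n \<inter> L \<longleftrightarrow> x = [a, j, c]" for x
      proof
        assume "x \<in> marked n C n \<inter> L"
        then have "\<exists>l. \<exists>j'\<in>{1..n}. x = [?m l j', j', Suc l]" "\<exists>i. x = [a, i, c]"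
          unfolding Int_iff L marked_iff 2 by auto
        then obtain l j' i where *: "x = [?m l j', j', Suc l]" "j' \<in> {1..n}" "x = [a, i, c]" by blast
        then have "?m (c - 1) j' = ?m (c - 1) j" using j by auto
        then have "j' = j" using bij_betw_imp_inj_on[OF bij] * j by (metis inj_onD)
        then show "x = [a, j, c]" using * by auto
      next
        assume x: "x = [a, j, c]"
        then have "x \<in> marked n C n" unfolding marked_iff using c' j by metis
        moreover have "x \<in> L" unfolding L using x 2 j by auto
        ultimately show "x \<in> marked n C n \<inter> L" by blast
      qed
      show ?thesis unfolding iff by simp
    next
      case 3
      obtain k where k: "k < n" "?m k b = a"
        using used_all[OF n abc(1,2), of C] unfolding used_iff by blast
      have iff: "x \<in> marked n C n \<inter> L \<longleftrightarrow> x = [a, b, Suc k]" for x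
      proof
        assume "x \<in> marked n C n \<inter> L"
        then have "\<exists>l<n. \<exists>j. x = [?m l j, j, Suc l]" "\<exists>i. x = [a, b, i]"
          unfolding Int_iff L marked_iff 3 by (auto simp: numeral_2_eq_2)
        then obtain l j i where *: "l < n" "x = [?m l j, j, Suc l]" "x = [a, b, i]" by blast
        then have "?m l b = ?m k b" using k by auto
        then have "l = k" using layer_matching_inj_layer[OF n abc(2)] * k by blast
        then show "x = [a, b, Suc k]" using * by auto
      next
        assume x: "x = [a, b, Suc k]"
        then have "x \<in> marked n C n" unfolding marked_iff using k abc(2) by metis
        moreover have "x \<in> L" unfolding L using x 3 k by auto
        ultimately show "x \<in> marked n C n \<inter> L" by blast
      qed
      show ?thesis unfolding iff by simp
    qed
  qed
  with card marked_subset_cube[OF n] show ?thesis unfolding axial_assignments_def by blast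
qed

section \<open>The program\<close>

lemma write_cell_apply [simp]:
  "write_cell m a k v b l = (if b = a \<and> l = k then v else m b l)"
  by (simp add: write_cell_def)

definition triple :: "(state \<Rightarrow> bool) \<Rightarrow> program \<Rightarrow> (state \<Rightarrow> bool) \<Rightarrow> nat \<Rightarrow> bool" where
  "triple P p Q b \<longleftrightarrow> (\<forall>s. P s \<longrightarrow> (\<exists>t s'. exec p s t s' \<and> t \<le> b \<and> Q s'))"

lemma tripleI: "(\<And>s. P s \<Longrightarrow> \<exists>t s'. exec p s t s' \<and> t \<le> b \<and> Q s') \<Longrightarrow> triple P p Q b"
  by (simp add: triple_def)

lemma tripleE:
  assumes "triple P p Q b" "P s"
  obtains t s' where "exec p s t s'" "t \<le> b" "Q s'"
  using assms unfolding triple_def by blast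

lemma triple_pre: "triple P p Q b \<Longrightarrow> (\<And>s. P' s \<Longrightarrow> P s) \<Longrightarrow> triple P' p Q b"
  unfolding triple_def by blast

lemma triple_post: "triple P p Q b \<Longrightarrow> (\<And>s. Q s \<Longrightarrow> Q' s) \<Longrightarrow> triple P p Q' b"
  unfolding triple_def by blast

lemma triple_Skip: "(\<And>s. P s \<Longrightarrow> Q s) \<Longrightarrow> triple P Skip Q 1"
  by (rule tripleI) (blast intro: exec.Skip)

lemma triple_NAssign:
  "(\<And>s. P s \<Longrightarrow> Q (write_cell (fst s) a (map (\<lambda>i. nval i s) is) (nval e s), snd s)) \<Longrightarrow>
     triple P (NAssign a is e) Q 1"
  by (rule tripleI) (blast intro: exec.NAssign)

lemma triple_RAssign:
  "(\<And>s. P s \<Longrightarrow> Q (fst s, write_cell (snd s) a (map (\<lambda>i. nval i s) is) (rval e s))) \<Longrightarrow>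
     triple P (RAssign a is e) Q 1"
  by (rule tripleI) (blast intro: exec.RAssign)

lemma triple_Seq:
  assumes p: "triple P p Q a" and q: "triple Q q R b"
  shows "triple P (Seq p q) R (a + b)"
proof (rule tripleI)
  fix s assume "P s"
  then obtain t s' where 1: "exec p s t s'" "t \<le> a" "Q s'" by (rule tripleE[OF p])
  obtain t' s'' where 2: "exec q s' t' s''" "t' \<le> b" "R s''" using 1(3) by (rule tripleE[OF q])
  from exec.Seq[OF 1(1) 2(1)] 1(2) 2(2,3)
  show "\<exists>t s'. exec (Seq p q) s t s' \<and> t \<le> a + b \<and> R s'" by (metis add_mono)
qed

lemma triple_Cond:
  assumes p: "triple (\<lambda>s. P s \<and> tval c s) p Q b" and q: "triple (\<lambda>s. P s \<and> \<not> tval c s) q Q b"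
  shows "triple P (Cond c p q) Q (Suc b)"
proof (rule tripleI)
  fix s assume "P s"
  show "\<exists>t s'. exec (Cond c p q) s t s' \<and> t \<le> Suc b \<and> Q s'"
  proof (cases "tval c s")
    case True
    with p \<open>P s\<close> obtain t s' where "exec p s t s'" "t \<le> b" "Q s'" by (blast elim: tripleE)
    then show ?thesis using exec.CondTrue[OF True] by (metis Suc_le_mono)
  next
    case False
    with q \<open>P s\<close> obtain t s' where "exec q s t s'" "t \<le> b" "Q s'" by (blast elim: tripleE)
    then show ?thesis using exec.CondFalse[OF False] by (metis Suc_le_mono)
  qed
qed

text \<open>The invariant is indexed by the number of completed rounds, so that \<open>bound\<close>
  acts as the variant: a round can only start while \<open>m < N\<close>. Each round pays for its
  test, and the last test costs 1.\<close>

lemma triple_Loop: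
  assumes bound: "\<And>m s. I m s \<Longrightarrow> tval c s \<Longrightarrow> m < N"
    and body: "\<And>m. triple (\<lambda>s. I m s \<and> tval c s) p (I (Suc m)) b"
    and post: "\<And>m s. I m s \<Longrightarrow> \<not> tval c s \<Longrightarrow> Q s"
  shows "triple (I 0) (Loop c p) Q (N * (b + 1) + 1)"
proof -
  have "\<exists>t s'. exec (Loop c p) s t s' \<and> t \<le> (N - m) * (b + 1) + 1 \<and> Q s'" if "I m s" for m s
    using that
  proof (induction "N - m" arbitrary: m s rule: less_induct)
    case less
    show ?case
    proof (cases "tval c s")
      case False
      then show ?thesis using exec.LoopFalse[OF False, of p] post[OF less.prems False]
        by (intro exI[of _ 1] exI[of _ s]) simp
    next
      case True
      have m: "m < N" by (rule bound[OF less.prems True])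
      obtain t s' where 1: "exec p s t s'" "t \<le> b" "I (Suc m) s'"
        using body[of m] less.prems True by (blast elim: tripleE)
      obtain t' s'' where 2: "exec (Loop c p) s' t' s''" "t' \<le> (N - Suc m) * (b + 1) + 1" "Q s''"
      proof -
        have "N - Suc m < N - m" using m by simp
        from less.hyps[OF this 1(3)] show ?thesis using that by blast
      qed
      have "Suc (t + t') \<le> (N - m) * (b + 1) + 1"
        using 1(2) 2(2) m by (simp add: Suc_diff_Suc[symmetric] del: Suc_diff_Suc)
      then show ?thesis using exec.LoopTrue[OF True 1(1) 2(1)] 2(3) by blast
    qed
  qed
  then show ?thesis unfolding triple_def by (metis diff_zero)
qed

definition for_loop :: "string \<Rightarrow> program \<Rightarrow> program" where
  "for_loop x p = Seq (NAssign x [] (NConst 1))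
     (Loop (TNot (NLess (NCell ''n'' []) (NCell x []))) (Seq p (NAssign x [] (NAdd (NCell x []) (NConst 1)))))"

text \<open>\<open>I j\<close> describes the state before round \<open>j\<close>. It must tolerate
  writes to the counter, and the body has to return the counter unchanged. A round costs
  \<open>b + 2\<close>, for the test and the increment.\<close>

lemma triple_for_loop:
  assumes n: "\<And>j s. I j s \<Longrightarrow> fst s ''n'' [] = n" and x: "x \<noteq> ''n''"
    and upd: "\<And>j s y. I j s \<Longrightarrow> I j (write_cell (fst s) x [] y, snd s)"
    and body: "\<And>j. j \<in> {1..n} \<Longrightarrow> triple (\<lambda>s. I j s \<and> fst s x [] = j) p (\<lambda>s. I (Suc j) s \<and> fst s x [] = j) b"
  shows "triple (I 1) (for_loop x p) (I (Suc n)) (n * (b + 2) + 2)"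
proof -
  let ?J = "\<lambda>m s. I (Suc m) s \<and> fst s x [] = Suc m \<and> m \<le> n"
  let ?c = "TNot (NLess (NCell ''n'' []) (NCell x []))"
  have init: "triple (I 1) (NAssign x [] (NConst 1)) (?J 0) 1"
    by (rule triple_NAssign) (use upd in simp)
  have "triple (\<lambda>s. ?J m s \<and> tval ?c s) (Seq p (NAssign x [] (NAdd (NCell x []) (NConst 1)))) (?J (Suc m)) (b + 1)" for m
  proof (cases "Suc m \<le> n")
    case True
    show ?thesis
    proof (rule triple_Seq)
      show "triple (\<lambda>s. ?J m s \<and> tval ?c s) p (\<lambda>s. I (Suc (Suc m)) s \<and> fst s x [] = Suc m) b"
        by (rule triple_pre[OF body[of "Suc m"]]) (use True in auto)
      show "triple (\<lambda>s. I (Suc (Suc m)) s \<and> fst s x [] = Suc m) (NAssign x [] (NAdd (NCell x []) (NConst 1))) (?J (Suc m)) 1"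
        by (rule triple_NAssign) (use upd True in auto)
    qed
  next
    case False
    then have "\<not> (?J m s \<and> tval ?c s)" for s using n[of "Suc m" s] by auto
    then show ?thesis unfolding triple_def by blast
  qed
  then have "triple (?J 0) (Loop ?c (Seq p (NAssign x [] (NAdd (NCell x []) (NConst 1))))) (I (Suc n)) (n * ((b + 1) + 1) + 1)"
  proof (rule triple_Loop[rotated])
    show "m < n" if "?J m s" "tval ?c s" for m s
      using that n[of "Suc m" s] by auto
    show "I (Suc n) s" if "?J m s" "\<not> tval ?c s" for m s
    proof -
      have "m = n" using that n[of "Suc m" s] by auto
      with that show ?thesis by simp
    qed
  qed
  from triple_Seq[OF init this] show ?thesis by (simp add: for_loop_def)
qed

section \<open>The text of the program\<close>

abbreviation var :: "string \<Rightarrow> nexp" where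
  "var x \<equiv> NCell x []"

text \<open>Only addition is available: \<open>W\<close> becomes \<open>n * n\<close> by adding
  \<open>n\<close> repeatedly, and \<open>B\<close> becomes \<open>big n\<close> by adding
  \<open>W\<close> to \<open>n + 1\<close> repeatedly.\<close>

definition init_prog :: program where
  "init_prog =
     Seq (NAssign ''W'' [] (NConst 0)) (Seq (for_loop ''i'' (NAssign ''W'' [] (NAdd (var ''W'') (var ''n''))))
     (Seq (NAssign ''B'' [] (NAdd (var ''n'') (NConst 1)))
          (for_loop ''i'' (NAssign ''B'' [] (NAdd (var ''B'') (var ''W''))))))"

text \<open>\<open>n\<close> times the cost is again a repeated addition. The value is clipped at 0
  and at \<open>W\<close>; the test for used cells comes last, so that it overrides both.\<close>

definition weight_prog :: program where
  "weight_prog =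
     Seq (RAssign ''w'' [var ''i'', var ''j''] (ROfNat (NConst 0)))
    (Seq (for_loop ''l'' (RAssign ''w'' [var ''i'', var ''j'']
           (RAdd (RCell ''w'' [var ''i'', var ''j'']) (RCell ''C'' [var ''i'', var ''j'', var ''k'']))))
    (Seq (Cond (RLess (RCell ''w'' [var ''i'', var ''j'']) (ROfNat (NConst 0)))
           (RAssign ''w'' [var ''i'', var ''j''] (ROfNat (NConst 0))) Skip)
    (Seq (Cond (RLess (ROfNat (var ''W'')) (RCell ''w'' [var ''i'', var ''j'']))
           (RAssign ''w'' [var ''i'', var ''j''] (ROfNat (var ''W''))) Skip)
         (Cond (NLess (NConst 0) (NCell ''used'' [var ''i'', var ''j'']))
           (RAssign ''w'' [var ''i'', var ''j''] (ROfNat (var ''B''))) Skip))))"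

definition reset_prog :: program where
  "reset_prog = Seq (for_loop ''j'' (Seq (NAssign ''p'' [var ''j''] (NConst 0)) (NAssign ''own'' [var ''j''] (NConst 0))))
     (Seq (NAssign ''cur'' [] (NConst 1)) (NAssign ''nxt'' [] (NConst 1)))"

definition best_prog :: program where
  "best_prog = Seq (NAssign ''bst'' [] (NConst 1)) (for_loop ''j''
     (Cond (RLess (RAdd (RCell ''w'' [var ''cur'', var ''j'']) (ROfNat (NCell ''p'' [var ''j''])))
                  (RAdd (RCell ''w'' [var ''cur'', var ''bst'']) (ROfNat (NCell ''p'' [var ''bst'']))))
       (NAssign ''bst'' [] (var ''j'')) Skip))"

text \<open>\<open>prv\<close> saves the displaced owner before the cell is overwritten. The
  \<open>Skip\<close> pads one branch, since the rule for conditionals expects the same time bound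
  for both. In the other branch \<open>cur\<close> receives the value of \<open>nxt\<close> after
  its increment.\<close>

definition bid_prog :: program where
  "bid_prog =
     Seq (NAssign ''prv'' [] (NCell ''own'' [var ''bst'']))
    (Seq (NAssign ''own'' [var ''bst''] (var ''cur''))
    (Seq (NAssign ''p'' [var ''bst''] (NAdd (NCell ''p'' [var ''bst'']) (NConst 1)))
         (Cond (NLess (NConst 0) (var ''prv''))
            (Seq Skip (NAssign ''cur'' [] (var ''prv'')))
            (Seq (NAssign ''nxt'' [] (NAdd (var ''nxt'') (NConst 1))) (NAssign ''cur'' [] (var ''nxt''))))))"

definition auction_prog :: program where
  "auction_prog = Loop (TNot (NLess (var ''n'') (var ''cur''))) (Seq best_prog bid_prog)"

definition mark_prog :: program where
  "mark_prog = for_loop ''j''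
     (Seq (NAssign ''T'' [NCell ''own'' [var ''j''], var ''j'', var ''k''] (NConst 1))
          (NAssign ''used'' [NCell ''own'' [var ''j''], var ''j''] (NConst 1)))"

definition layer_prog :: program where
  "layer_prog = Seq (for_loop ''i'' (for_loop ''j'' weight_prog)) (Seq reset_prog (Seq auction_prog mark_prog))"

definition latin_prog :: program where
  "latin_prog = Seq init_prog (for_loop ''k'' layer_prog)"

section \<open>Correctness and running time of the program\<close>

definition global_inv :: "nat \<Rightarrow> (nat list \<Rightarrow> real) \<Rightarrow> state \<Rightarrow> bool" where
  "global_inv n C s \<longleftrightarrow> fst s ''n'' [] = n \<and> fst s ''W'' [] = n * n \<and> fst s ''B'' [] = big n \<and>
     (\<forall>x\<in>cube 3 n. snd s ''C'' x = C x)"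

definition used_inv :: "nat \<Rightarrow> (nat \<times> nat) set \<Rightarrow> nat list set \<Rightarrow> state \<Rightarrow> bool" where
  "used_inv n U T s \<longleftrightarrow> (\<forall>i\<in>{1..n}. \<forall>j\<in>{1..n}. fst s ''used'' [i, j] \<noteq> 0 \<longleftrightarrow> (i, j) \<in> U) \<and>
     (\<forall>x. fst s ''T'' x \<noteq> 0 \<longleftrightarrow> x \<in> T)"

definition weights_inv :: "(nat \<times> nat) set \<Rightarrow> (nat \<Rightarrow> nat \<Rightarrow> real) \<Rightarrow> state \<Rightarrow> bool" where
  "weights_inv A w s \<longleftrightarrow> (\<forall>i j. (i, j) \<in> A \<longrightarrow> snd s ''w'' [i, j] = w i j)"

lemma weights_inv_mono: "weights_inv A w s \<Longrightarrow> B \<subseteq> A \<Longrightarrow> weights_inv B w s"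
  unfolding weights_inv_def by blast

lemma init_prog_triple:
  "triple (\<lambda>s. fst s ''n'' [] = n \<and> (\<forall>x\<in>cube 3 n. snd s ''C'' x = C x) \<and> used_inv n {} {} s) init_prog
     (\<lambda>s. global_inv n C s \<and> used_inv n {} {} s) (1 + ((n * (1 + 2) + 2) + (1 + (n * (1 + 2) + 2))))"
proof -
  let ?P = "\<lambda>s. fst s ''n'' [] = n \<and> (\<forall>x\<in>cube 3 n. snd s ''C'' x = C x) \<and> used_inv n {} {} s"
  let ?I = "\<lambda>j s. ?P s \<and> fst s ''W'' [] = (j - 1) * n"
  let ?J = "\<lambda>j s. ?P s \<and> fst s ''W'' [] = n * n \<and> fst s ''B'' [] = n + 1 + (j - 1) * (n * n)"
  have 1: "triple ?P (NAssign ''W'' [] (NConst 0)) (?I 1) 1"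
    by (rule triple_NAssign) (simp add: used_inv_def)
  have 2: "triple (?I 1) (for_loop ''i'' (NAssign ''W'' [] (NAdd (var ''W'') (var ''n'')))) (?I (Suc n)) (n * (1 + 2) + 2)"
  proof (rule triple_for_loop)
    fix j assume "j \<in> {1..n}"
    then show "triple (\<lambda>s. ?I j s \<and> fst s ''i'' [] = j) (NAssign ''W'' [] (NAdd (var ''W'') (var ''n'')))
        (\<lambda>s. ?I (Suc j) s \<and> fst s ''i'' [] = j) 1"
      by (intro triple_NAssign) (cases j; auto simp: used_inv_def)
  qed (simp_all add: used_inv_def)
  have 3: "triple (?I (Suc n)) (NAssign ''B'' [] (NAdd (var ''n'') (NConst 1))) (?J 1) 1"
    by (rule triple_NAssign) (simp add: used_inv_def)
  have "triple (?J 1) (for_loop ''i'' (NAssign ''B'' [] (NAdd (var ''B'') (var ''W'')))) (?J (Suc n)) (n * (1 + 2) + 2)"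
  proof (rule triple_for_loop)
    fix j assume "j \<in> {1..n}"
    then show "triple (\<lambda>s. ?J j s \<and> fst s ''i'' [] = j) (NAssign ''B'' [] (NAdd (var ''B'') (var ''W'')))
        (\<lambda>s. ?J (Suc j) s \<and> fst s ''i'' [] = j) 1"
      by (intro triple_NAssign) (cases j; auto simp: used_inv_def)
  qed (simp_all add: used_inv_def)
  then have "triple (?J 1) (for_loop ''i'' (NAssign ''B'' [] (NAdd (var ''B'') (var ''W''))))
      (\<lambda>s. global_inv n C s \<and> used_inv n {} {} s) (n * (1 + 2) + 2)"
    by (rule triple_post) (auto simp: global_inv_def big_def)
  from triple_Seq[OF 1 triple_Seq[OF 2 triple_Seq[OF 3 this]]] show ?thesis by (simp add: init_prog_def)
qed

context
  fixes n k :: nat and C :: "nat list \<Rightarrow> real" and U :: "(nat \<times> nat) set" and T :: "nat list set"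
    and w :: "nat \<Rightarrow> nat \<Rightarrow> real"
  assumes n: "1 \<le> n" and k: "k \<in> {1..n}" and w_def: "w = weights n U (layer C k)"
begin

definition base_inv :: "state \<Rightarrow> bool" where
  "base_inv s \<longleftrightarrow> global_inv n C s \<and> used_inv n U T s \<and> fst s ''k'' [] = k"

lemma base_inv_write:
  "a \<notin> {''n'', ''W'', ''B'', ''k'', ''used'', ''T''} \<Longrightarrow> base_inv (write_cell f a l y, g) = base_inv (f, g)"
proof -
  assume "a \<notin> {''n'', ''W'', ''B'', ''k'', ''used'', ''T''}"
  then have "write_cell f a l y b = f b" if "b \<in> {''n'', ''W'', ''B'', ''k'', ''used'', ''T''}" for b
    using that by (auto simp: write_cell_def)
  then show ?thesis unfolding base_inv_def global_inv_def used_inv_def fst_conv snd_conv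
    by (simp del: write_cell_apply)
qed

lemma base_inv_write':
  assumes "a \<noteq> ''C''"
  shows "base_inv (f, write_cell g a l z) = base_inv (f, g)"
proof -
  have "write_cell g a l z ''C'' = g ''C''" using not_sym[OF assms] by (simp add: write_cell_def)
  then show ?thesis unfolding base_inv_def global_inv_def used_inv_def fst_conv snd_conv
    by (simp del: write_cell_apply)
qed

text \<open>While cell \<open>(i, j)\<close> passes through intermediate values, the table is
  asserted on \<open>A - {(i, j)}\<close> only, and the value of the cell itself is tracked
  separately in \<open>?Q\<close>. Each instruction moves \<open>?Q\<close> from one explicit number
  to the next, ending with \<open>w i j\<close>.\<close>

lemma weight_prog_triple:
  assumes ij: "i \<in> {1..n}" "j \<in> {1..n}"
  shows "triple (\<lambda>s. base_inv s \<and> weights_inv A w s \<and> fst s ''i'' [] = i \<and> fst s ''j'' [] = j) weight_prog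
     (\<lambda>s. base_inv s \<and> weights_inv (insert (i, j) A) w s \<and> fst s ''i'' [] = i \<and> fst s ''j'' [] = j)
     (1 + ((n * (1 + 2) + 2) + (Suc 1 + (Suc 1 + Suc 1))))"
proof -
  let ?P = "\<lambda>s. base_inv s \<and> weights_inv (A - {(i, j)}) w s \<and> fst s ''i'' [] = i \<and> fst s ''j'' [] = j"
  let ?c = "C [i, j, k]"
  let ?Q = "\<lambda>x s. ?P s \<and> snd s ''w'' [i, j] = x"
  have c: "snd s ''C'' [i, j, k] = ?c" if "base_inv s" for s
  proof -
    have "[i, j, k] \<in> cube 3 n" using ij k by (simp add: cube_def)
    then show ?thesis using that unfolding base_inv_def global_inv_def by blast
  qed
  have P_write: "?P (fst s, write_cell (snd s) ''w'' [i, j] x)" if "?P s" for s x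
  proof -
    have "weights_inv (A - {(i, j)}) w (fst s, write_cell (snd s) ''w'' [i, j] x)"
      using that unfolding weights_inv_def by simp
    moreover have "base_inv (fst s, write_cell (snd s) ''w'' [i, j] x)"
      using that by (simp add: base_inv_write base_inv_write')
    ultimately show ?thesis using that by simp
  qed
  \<comment> \<open>\<open>R\<close> may mention the old value of the cell and is used up by the
    assignment; \<open>S\<close> sees only the natural number memory and therefore survives. It
    carries the loop counter.\<close>
  have assign': "triple (\<lambda>s. ?P s \<and> R s \<and> S (fst s)) (RAssign ''w'' [var ''i'', var ''j''] e)
      (\<lambda>s. ?Q x s \<and> S (fst s)) 1"
    if e: "\<And>s. ?P s \<Longrightarrow> R s \<Longrightarrow> rval e s = x" for e x R and S :: "(string \<Rightarrow> nat list \<Rightarrow> nat) \<Rightarrow> bool"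
  proof (rule triple_RAssign)
    fix s assume "?P s \<and> R s \<and> S (fst s)"
    then have P: "?P s" and R: "R s" and S: "S (fst s)" by simp_all
    have x: "rval e s = x" by (rule e[OF P R])
    have ij: "map (\<lambda>i. nval i s) [var ''i'', var ''j''] = [i, j]" using P by simp
    show "?Q x (fst s, write_cell (snd s) ''w'' (map (\<lambda>i. nval i s) [var ''i'', var ''j'']) (rval e s)) \<and>
        S (fst (fst s, write_cell (snd s) ''w'' (map (\<lambda>i. nval i s) [var ''i'', var ''j'']) (rval e s)))"
      unfolding ij x using P_write[OF P, of x] S by simp
  qed
  have assign: "triple (\<lambda>s. ?P s \<and> R s) (RAssign ''w'' [var ''i'', var ''j''] e) (?Q x) 1"
    if e: "\<And>s. ?P s \<Longrightarrow> R s \<Longrightarrow> rval e s = x" for e x R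
  proof (rule triple_post[OF triple_pre[OF assign'[of R e x "\<lambda>_. True", OF e]]])
    show "?P s \<and> R s \<and> True" if "?P s \<and> R s" for s using that by simp
    show "?Q x s" if "?Q x s \<and> True" for s using that by simp
  qed simp_all
  have 1: "triple (\<lambda>s. base_inv s \<and> weights_inv A w s \<and> fst s ''i'' [] = i \<and> fst s ''j'' [] = j)
      (RAssign ''w'' [var ''i'', var ''j''] (ROfNat (NConst 0))) (?Q (real (1 - 1) * ?c)) 1"
  proof (rule triple_pre[OF assign[of "\<lambda>_. True"]])
    show "?P s \<and> True" if s: "base_inv s \<and> weights_inv A w s \<and> fst s ''i'' [] = i \<and> fst s ''j'' [] = j" for s
    proof -
      have "weights_inv (A - {(i, j)}) w s" using s weights_inv_mono[of A w s "A - {(i, j)}"] by simp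
      with s show ?thesis by simp
    qed
    show "rval (ROfNat (NConst 0)) s = real (1 - 1) * ?c" for s by simp
  qed
  have 2: "triple (?Q (real (1 - 1) * ?c)) (for_loop ''l'' (RAssign ''w'' [var ''i'', var ''j'']
           (RAdd (RCell ''w'' [var ''i'', var ''j'']) (RCell ''C'' [var ''i'', var ''j'', var ''k'']))))
      (?Q (real (Suc n - 1) * ?c)) (n * (1 + 2) + 2)"
  proof (rule triple_for_loop[where I = "\<lambda>l. ?Q (real (l - 1) * ?c)"])
    fix l assume l: "l \<in> {1..n}"
    show "triple (\<lambda>s. ?Q (real (l - 1) * ?c) s \<and> fst s ''l'' [] = l) (RAssign ''w'' [var ''i'', var ''j'']
           (RAdd (RCell ''w'' [var ''i'', var ''j'']) (RCell ''C'' [var ''i'', var ''j'', var ''k''])))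
        (\<lambda>s. ?Q (real (Suc l - 1) * ?c) s \<and> fst s ''l'' [] = l) 1"
    proof (rule triple_pre[OF assign'[of "\<lambda>s. snd s ''w'' [i, j] = real (l - 1) * ?c" _ _ "\<lambda>m. m ''l'' [] = l"]])
      show "rval (RAdd (RCell ''w'' [var ''i'', var ''j'']) (RCell ''C'' [var ''i'', var ''j'', var ''k''])) s
         = real (Suc l - 1) * ?c"
        if s: "?P s" "snd s ''w'' [i, j] = real (l - 1) * ?c" for s
      proof -
        have "fst s ''k'' [] = k" "fst s ''i'' [] = i" "fst s ''j'' [] = j" using s(1) by (simp_all add: base_inv_def)
        moreover have "real (l - 1) * ?c + ?c = real l * ?c" using l by (simp add: of_nat_diff algebra_simps)
        ultimately show ?thesis using s(2) c[of s] s(1) by simp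
      qed
    qed blast
  next
    fix l s y assume "?Q (real (l - 1) * ?c) s"
    then show "?Q (real (l - 1) * ?c) (write_cell (fst s) ''l'' [] y, snd s)"
      by (simp add: base_inv_write base_inv_write' weights_inv_def)
  qed (simp_all add: base_inv_def global_inv_def)
  have clip: "triple (?Q x) (Cond b (RAssign ''w'' [var ''i'', var ''j''] e) Skip) (?Q y) (Suc 1)"
    if t: "\<And>s. base_inv s \<Longrightarrow> fst s ''i'' [] = i \<Longrightarrow> fst s ''j'' [] = j \<Longrightarrow> snd s ''w'' [i, j] = x \<Longrightarrow>
          tval b s \<Longrightarrow> rval e s = y"
      and f: "\<And>s. base_inv s \<Longrightarrow> fst s ''i'' [] = i \<Longrightarrow> fst s ''j'' [] = j \<Longrightarrow> snd s ''w'' [i, j] = x \<Longrightarrow>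
          \<not> tval b s \<Longrightarrow> x = y"
    for b e x y
  proof (rule triple_Cond)
    show "triple (\<lambda>s. ?Q x s \<and> tval b s) (RAssign ''w'' [var ''i'', var ''j''] e) (?Q y) 1"
      by (rule triple_pre[OF assign[of "\<lambda>s. snd s ''w'' [i, j] = x \<and> tval b s"]]) (use t in blast)+
    show "triple (\<lambda>s. ?Q x s \<and> \<not> tval b s) Skip (?Q y) 1"
      by (rule triple_Skip) (use f in blast)
  qed
  let ?x1 = "max 0 (real n * ?c)"
  have 3: "triple (?Q (real (Suc n - 1) * ?c)) (Cond (RLess (RCell ''w'' [var ''i'', var ''j'']) (ROfNat (NConst 0)))
           (RAssign ''w'' [var ''i'', var ''j''] (ROfNat (NConst 0))) Skip) (?Q ?x1) (Suc 1)"
    by (rule clip) auto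
  let ?x2 = "min (real (n * n)) ?x1"
  have 4: "triple (?Q ?x1) (Cond (RLess (ROfNat (var ''W'')) (RCell ''w'' [var ''i'', var ''j'']))
           (RAssign ''w'' [var ''i'', var ''j''] (ROfNat (var ''W''))) Skip) (?Q ?x2) (Suc 1)"
  proof (rule clip)
    fix s assume s: "base_inv s" "fst s ''i'' [] = i" "fst s ''j'' [] = j" "snd s ''w'' [i, j] = ?x1"
    have W: "fst s ''W'' [] = n * n" using s(1) by (simp add: base_inv_def global_inv_def)
    show "rval (ROfNat (var ''W'')) s = ?x2" if "tval (RLess (ROfNat (var ''W'')) (RCell ''w'' [var ''i'', var ''j''])) s"
      using that W s(2-4) by (simp del: of_nat_mult)
    show "?x1 = ?x2" if "\<not> tval (RLess (ROfNat (var ''W'')) (RCell ''w'' [var ''i'', var ''j''])) s"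
      using that W s(2-4) by (simp del: of_nat_mult)
  qed
  have 5: "triple (?Q ?x2) (Cond (NLess (NConst 0) (NCell ''used'' [var ''i'', var ''j'']))
           (RAssign ''w'' [var ''i'', var ''j''] (ROfNat (var ''B''))) Skip) (?Q (w i j)) (Suc 1)"
  proof (rule clip)
    fix s assume s: "base_inv s" "fst s ''i'' [] = i" "fst s ''j'' [] = j"
    have u: "fst s ''used'' [i, j] \<noteq> 0 \<longleftrightarrow> (i, j) \<in> U"
      using s(1) ij by (simp add: base_inv_def used_inv_def)
    show "rval (ROfNat (var ''B'')) s = w i j" if "tval (NLess (NConst 0) (NCell ''used'' [var ''i'', var ''j''])) s"
      using that u s by (simp add: base_inv_def global_inv_def w_def weights_def)
    show "?x2 = w i j" if "\<not> tval (NLess (NConst 0) (NCell ''used'' [var ''i'', var ''j''])) s"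
      using that u s by (simp add: w_def weights_def layer_def)
  qed
  have 5: "triple (?Q ?x2) (Cond (NLess (NConst 0) (NCell ''used'' [var ''i'', var ''j'']))
           (RAssign ''w'' [var ''i'', var ''j''] (ROfNat (var ''B''))) Skip)
      (\<lambda>s. base_inv s \<and> weights_inv (insert (i, j) A) w s \<and> fst s ''i'' [] = i \<and> fst s ''j'' [] = j) (Suc 1)"
  proof (rule triple_post[OF 5])
    fix s assume s: "?Q (w i j) s"
    then have "snd s ''w'' [i, j] = w i j" "weights_inv (A - {(i, j)}) w s" by blast+
    then have "weights_inv (insert (i, j) A) w s" unfolding weights_inv_def by (metis Diff_iff Pair_inject insert_iff singletonD)
    with s show "base_inv s \<and> weights_inv (insert (i, j) A) w s \<and> fst s ''i'' [] = i \<and> fst s ''j'' [] = j" by blast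
  qed
  from triple_Seq[OF 1 triple_Seq[OF 2 triple_Seq[OF 3 triple_Seq[OF 4 5]]]]
  show ?thesis by (simp only: weight_prog_def)
qed

lemma base_inv_n: "base_inv s \<Longrightarrow> fst s ''n'' [] = n"
  by (simp add: base_inv_def global_inv_def)

lemma weights_inv_nat: "weights_inv A w (f, snd s) = weights_inv A w s"
  by (simp add: weights_inv_def)

lemma weights_prog_triple:
  "triple base_inv (for_loop ''i'' (for_loop ''j'' weight_prog))
     (\<lambda>s. base_inv s \<and> weights_inv ({1..n} \<times> {1..n}) w s)
     (n * ((n * ((1 + ((n * (1 + 2) + 2) + (Suc 1 + (Suc 1 + Suc 1)))) + 2) + 2) + 2) + 2)"
proof -
  let ?I = "\<lambda>i s. base_inv s \<and> weights_inv ({1..<i} \<times> {1..n}) w s"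
  let ?J = "\<lambda>i j s. (base_inv s \<and> weights_inv ({1..<i} \<times> {1..n} \<union> {i} \<times> {1..<j}) w s) \<and> fst s ''i'' [] = i"
  let ?t = "1 + ((n * (1 + 2) + 2) + (Suc 1 + (Suc 1 + Suc 1)))"
  have inner: "triple (?J i 1) (for_loop ''j'' weight_prog) (?J i (Suc n)) (n * (?t + 2) + 2)" if i: "i \<in> {1..n}" for i
  proof (rule triple_for_loop)
    fix j assume j: "j \<in> {1..n}"
    have eq: "insert (i, j) ({1..<i} \<times> {1..n} \<union> {i} \<times> {1..<j}) = {1..<i} \<times> {1..n} \<union> {i} \<times> {1..<Suc j}"
      using j by auto
    show "triple (\<lambda>s. ?J i j s \<and> fst s ''j'' [] = j) weight_prog (\<lambda>s. ?J i (Suc j) s \<and> fst s ''j'' [] = j) ?t"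
      by (rule triple_post[OF triple_pre[OF weight_prog_triple[OF i j, where A = "{1..<i} \<times> {1..n} \<union> {i} \<times> {1..<j}"]]])
         (auto simp only: eq)
  qed (simp_all add: base_inv_n base_inv_write weights_inv_nat)
  have "triple (?I 1) (for_loop ''i'' (for_loop ''j'' weight_prog)) (?I (Suc n)) (n * ((n * (?t + 2) + 2) + 2) + 2)"
  proof (rule triple_for_loop)
    fix i assume i: "i \<in> {1..n}"
    have eq: "{1..<i} \<times> {1..n} \<union> {i} \<times> {1..<Suc n} = {1..<Suc i} \<times> {1..n}" using i by auto
    show "triple (\<lambda>s. ?I i s \<and> fst s ''i'' [] = i) (for_loop ''j'' weight_prog)
       (\<lambda>s. ?I (Suc i) s \<and> fst s ''i'' [] = i) (n * (?t + 2) + 2)"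
    proof (rule triple_post[OF triple_pre[OF inner[OF i]]])
      show "?J i 1 s" if "?I i s \<and> fst s ''i'' [] = i" for s using that by simp
      show "?I (Suc i) s \<and> fst s ''i'' [] = i" if "?J i (Suc n) s" for s using that unfolding eq by simp
    qed
  qed (simp_all add: base_inv_n base_inv_write weights_inv_nat)
  then show ?thesis
    by (rule triple_post[OF triple_pre]) (auto simp: weights_inv_def atLeastLessThanSuc_atLeastAtMost)
qed

definition ready :: "state \<Rightarrow> bool" where
  "ready s \<longleftrightarrow> base_inv s \<and> weights_inv ({1..n} \<times> {1..n}) w s"

lemma ready_write:
  "a \<notin> {''n'', ''W'', ''B'', ''k'', ''used'', ''T''} \<Longrightarrow> ready s \<Longrightarrow> ready (write_cell (fst s) a l y, snd s)"
  unfolding ready_def by (simp add: base_inv_write weights_inv_nat)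

lemma ready_n: "ready s \<Longrightarrow> fst s ''n'' [] = n"
  by (simp add: ready_def base_inv_n)

lemma ready_w: "ready s \<Longrightarrow> i \<in> {1..n} \<Longrightarrow> j \<in> {1..n} \<Longrightarrow> snd s ''w'' [i, j] = w i j"
  by (simp add: ready_def weights_inv_def)

text \<open>Memory and abstract state are compared on the objects \<open>1..n\<close>, the range
  which the reset loop clears and to which bids are confined.\<close>

definition repr :: "auction_state \<Rightarrow> state \<Rightarrow> bool" where
  "repr st s \<longleftrightarrow> (\<forall>j\<in>{1..n}. fst s ''p'' [j] = fst st j) \<and> (\<forall>j\<in>{1..n}. fst s ''own'' [j] = fst (snd st) j) \<and>
     fst s ''cur'' [] = fst (snd (snd st)) \<and> fst s ''nxt'' [] = snd (snd (snd st))"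

lemma repr_write:
  assumes "a \<notin> {''p'', ''own'', ''cur'', ''nxt''}" and "repr st s"
  shows "repr st (write_cell (fst s) a l y, snd s)"
proof -
  have "write_cell (fst s) a l y b = fst s b" if "b \<in> {''p'', ''own'', ''cur'', ''nxt''}" for b
    using that assms(1) by (auto simp: write_cell_def)
  then show ?thesis using assms(2) unfolding repr_def by (simp del: write_cell_apply)
qed

lemma reset_prog_triple:
  "triple ready reset_prog (\<lambda>s. ready s \<and> repr (auction n w 0) s) ((n * ((1 + 1) + 2) + 2) + (1 + 1))"
proof -
  let ?I = "\<lambda>j s. ready s \<and> (\<forall>j'\<in>{1..<j}. fst s ''p'' [j'] = 0) \<and> (\<forall>j'\<in>{1..<j}. fst s ''own'' [j'] = 0)"
  have "triple (?I 1) (for_loop ''j'' (Seq (NAssign ''p'' [var ''j''] (NConst 0)) (NAssign ''own'' [var ''j''] (NConst 0))))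
      (?I (Suc n)) (n * ((1 + 1) + 2) + 2)"
  proof (rule triple_for_loop)
    fix j assume "j \<in> {1..n}"
    let ?M = "\<lambda>s. ready s \<and> (\<forall>j'\<in>{1..<Suc j}. fst s ''p'' [j'] = 0) \<and> (\<forall>j'\<in>{1..<j}. fst s ''own'' [j'] = 0) \<and> fst s ''j'' [] = j"
    show "triple (\<lambda>s. ?I j s \<and> fst s ''j'' [] = j)
       (Seq (NAssign ''p'' [var ''j''] (NConst 0)) (NAssign ''own'' [var ''j''] (NConst 0)))
       (\<lambda>s. ?I (Suc j) s \<and> fst s ''j'' [] = j) (1 + 1)"
    proof (rule triple_Seq)
      show "triple (\<lambda>s. ?I j s \<and> fst s ''j'' [] = j) (NAssign ''p'' [var ''j''] (NConst 0)) ?M 1"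
        by (rule triple_NAssign) (simp add: ready_write)
      show "triple ?M (NAssign ''own'' [var ''j''] (NConst 0)) (\<lambda>s. ?I (Suc j) s \<and> fst s ''j'' [] = j) 1"
        by (rule triple_NAssign) (simp add: ready_write)
    qed
  qed (simp_all add: ready_n ready_write)
  then have 1: "triple ready (for_loop ''j'' (Seq (NAssign ''p'' [var ''j''] (NConst 0)) (NAssign ''own'' [var ''j''] (NConst 0))))
      (?I (Suc n)) (n * ((1 + 1) + 2) + 2)"
    by (rule triple_pre) simp
  have 2: "triple (?I (Suc n)) (NAssign ''cur'' [] (NConst 1)) (\<lambda>s. ?I (Suc n) s \<and> fst s ''cur'' [] = 1) 1"
    by (rule triple_NAssign) (simp add: ready_write)
  have 3: "triple (\<lambda>s. ?I (Suc n) s \<and> fst s ''cur'' [] = 1) (NAssign ''nxt'' [] (NConst 1))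
      (\<lambda>s. ready s \<and> repr (auction n w 0) s) 1"
    by (rule triple_NAssign) (simp add: ready_write repr_def auction_0 atLeastLessThanSuc_atLeastAtMost)
  from triple_Seq[OF 1 triple_Seq[OF 2 3]] show ?thesis by (simp only: reset_prog_def)
qed

lemma best_in: "best f n \<in> {1..n}"
  using best_bounds[of f n] n by auto

lemma best_prog_triple:
  fixes nxt :: nat
  assumes st: "st = (p, own, cur, nxt)" and cur: "cur \<in> {1..n}"
  shows "triple (\<lambda>s. ready s \<and> repr st s) best_prog
     (\<lambda>s. (ready s \<and> repr st s) \<and> fst s ''bst'' [] = best (\<lambda>j. w cur j + real (p j)) n) (1 + (n * (Suc 1 + 2) + 2))"
proof -
  let ?f = "\<lambda>j. w cur j + real (p j)"
  let ?I = "\<lambda>j s. (ready s \<and> repr st s) \<and> fst s ''bst'' [] = best ?f (j - 1)"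
  let ?t = "RLess (RAdd (RCell ''w'' [var ''cur'', var ''j'']) (ROfNat (NCell ''p'' [var ''j''])))
                  (RAdd (RCell ''w'' [var ''cur'', var ''bst'']) (ROfNat (NCell ''p'' [var ''bst''])))"
  have 1: "triple (\<lambda>s. ready s \<and> repr st s) (NAssign ''bst'' [] (NConst 1)) (?I 1) 1"
    by (rule triple_NAssign) (simp add: ready_write repr_write)
  have 2: "triple (?I 1) (for_loop ''j'' (Cond ?t (NAssign ''bst'' [] (var ''j'')) Skip)) (?I (Suc n)) (n * (Suc 1 + 2) + 2)"
  proof (rule triple_for_loop)
    fix j assume j: "j \<in> {1..n}"
    then obtain j0 where j0: "j = Suc j0" by (cases j) auto
    then have j0': "j - 1 = j0" by simp
    have t: "tval ?t s \<longleftrightarrow> ?f j < ?f (best ?f j0)" if s: "ready s" "repr st s" "fst s ''bst'' [] = best ?f j0" "fst s ''j'' [] = j" for s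
    proof -
      have b: "best ?f j0 \<in> {1..n}" using best_bounds[of ?f j0] j j0 by auto
      have "fst s ''p'' [j] = p j" "fst s ''p'' [best ?f j0] = p (best ?f j0)" "fst s ''cur'' [] = cur"
        using s(2) j b by (simp_all add: repr_def st)
      then show ?thesis using ready_w[OF s(1) cur j] ready_w[OF s(1) cur b] s(3,4) by simp
    qed
    show "triple (\<lambda>s. ?I j s \<and> fst s ''j'' [] = j) (Cond ?t (NAssign ''bst'' [] (var ''j'')) Skip)
       (\<lambda>s. ?I (Suc j) s \<and> fst s ''j'' [] = j) (Suc 1)"
    proof (rule triple_Cond)
      show "triple (\<lambda>s. (?I j s \<and> fst s ''j'' [] = j) \<and> tval ?t s) (NAssign ''bst'' [] (var ''j'')) (\<lambda>s. ?I (Suc j) s \<and> fst s ''j'' [] = j) 1"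
      proof (rule triple_NAssign)
        fix s assume "(?I j s \<and> fst s ''j'' [] = j) \<and> tval ?t s"
        then have s: "ready s" "repr st s" "fst s ''bst'' [] = best ?f j0" "fst s ''j'' [] = j" and "tval ?t s"
          unfolding j0' by blast+
        with t[OF s] have "best ?f j = j" by (simp add: j0)
        then show "?I (Suc j) (write_cell (fst s) ''bst'' (map (\<lambda>i. nval i s) []) (nval (var ''j'') s), snd s) \<and>
            fst (write_cell (fst s) ''bst'' (map (\<lambda>i. nval i s) []) (nval (var ''j'') s), snd s) ''j'' [] = j"
          using s by (simp add: ready_write repr_write)
      qed
      show "triple (\<lambda>s. (?I j s \<and> fst s ''j'' [] = j) \<and> \<not> tval ?t s) Skip (\<lambda>s. ?I (Suc j) s \<and> fst s ''j'' [] = j) 1"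
      proof (rule triple_Skip)
        fix s assume "(?I j s \<and> fst s ''j'' [] = j) \<and> \<not> tval ?t s"
        then have s: "ready s" "repr st s" "fst s ''bst'' [] = best ?f j0" "fst s ''j'' [] = j" and "\<not> tval ?t s"
          unfolding j0' by blast+
        with t[OF s] have "best ?f j = best ?f j0" by (simp add: j0)
        then show "?I (Suc j) s \<and> fst s ''j'' [] = j" using s by simp
      qed
    qed
  qed (simp_all add: ready_n ready_write repr_write)
  from triple_Seq[OF 1 2] show ?thesis by (simp only: best_prog_def diff_Suc_1)
qed

lemma bid_prog_triple:
  fixes nxt :: nat
  assumes st: "st = (p, own, cur, nxt)" and b: "b \<in> {1..n}" "b = best (\<lambda>j. w cur j + real (p j)) n"
  shows "triple (\<lambda>s. (ready s \<and> repr st s) \<and> fst s ''bst'' [] = b) bid_prog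
     (\<lambda>s. ready s \<and> repr (bid n w st) s) (1 + (1 + (1 + Suc (1 + 1))))"
proof -
  let ?own = "own(b := cur)" and ?p = "p(b := p b + 1)"
  let ?M1 = "\<lambda>s. ready s \<and> repr st s \<and> fst s ''bst'' [] = b \<and> fst s ''prv'' [] = own b"
  let ?M2 = "\<lambda>s. ready s \<and> repr (p, ?own, cur, nxt) s \<and> fst s ''bst'' [] = b \<and> fst s ''prv'' [] = own b"
  let ?M3 = "\<lambda>s. ready s \<and> repr (?p, ?own, cur, nxt) s \<and> fst s ''prv'' [] = own b"
  have 1: "triple (\<lambda>s. (ready s \<and> repr st s) \<and> fst s ''bst'' [] = b) (NAssign ''prv'' [] (NCell ''own'' [var ''bst''])) ?M1 1"
  proof (rule triple_NAssign)
    fix s assume s: "(ready s \<and> repr st s) \<and> fst s ''bst'' [] = b"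
    then have "fst s ''own'' [b] = own b" using b by (simp add: repr_def st)
    then show "?M1 (write_cell (fst s) ''prv'' (map (\<lambda>i. nval i s) []) (nval (NCell ''own'' [var ''bst'']) s), snd s)"
      using s by (simp add: ready_write repr_write)
  qed
  have 2: "triple ?M1 (NAssign ''own'' [var ''bst''] (var ''cur'')) ?M2 1"
    by (rule triple_NAssign) (simp add: ready_write repr_def st)
  have 3: "triple ?M2 (NAssign ''p'' [var ''bst''] (NAdd (NCell ''p'' [var ''bst'']) (NConst 1))) ?M3 1"
  proof (rule triple_NAssign)
    fix s assume s: "?M2 s"
    then have "fst s ''p'' [b] = p b" using b by (simp add: repr_def)
    then show "?M3 (write_cell (fst s) ''p'' (map (\<lambda>i. nval i s) [var ''bst'']) (nval (NAdd (NCell ''p'' [var ''bst'']) (NConst 1)) s), snd s)"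
      using s by (simp add: ready_write repr_def)
  qed
  have bid: "bid n w st = (?p, ?own, if own b = 0 then nxt + 1 else own b, if own b = 0 then nxt + 1 else nxt)"
    by (simp add: bid_def st Let_def b(2)[symmetric])
  let ?Q = "\<lambda>s. ready s \<and> repr (bid n w st) s"
  have 4: "triple ?M3 (Cond (NLess (NConst 0) (var ''prv''))
            (Seq Skip (NAssign ''cur'' [] (var ''prv'')))
            (Seq (NAssign ''nxt'' [] (NAdd (var ''nxt'') (NConst 1))) (NAssign ''cur'' [] (var ''nxt'')))) ?Q (Suc (1 + 1))"
  proof (rule triple_Cond)
    have "triple (\<lambda>s. ?M3 s \<and> tval (NLess (NConst 0) (var ''prv'')) s) (NAssign ''cur'' [] (var ''prv'')) ?Q 1"
      by (rule triple_NAssign) (simp add: ready_write repr_def bid)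
    with triple_Skip show "triple (\<lambda>s. ?M3 s \<and> tval (NLess (NConst 0) (var ''prv'')) s) (Seq Skip (NAssign ''cur'' [] (var ''prv''))) ?Q (1 + 1)"
      by (rule triple_Seq)
    let ?M4 = "\<lambda>s. ready s \<and> repr (?p, ?own, cur, nxt + 1) s \<and> own b = 0"
    have 5: "triple (\<lambda>s. ?M3 s \<and> \<not> tval (NLess (NConst 0) (var ''prv'')) s) (NAssign ''nxt'' [] (NAdd (var ''nxt'') (NConst 1))) ?M4 1"
      by (rule triple_NAssign) (simp add: ready_write repr_def)
    have 6: "triple ?M4 (NAssign ''cur'' [] (var ''nxt'')) ?Q 1"
      by (rule triple_NAssign) (simp add: ready_write repr_def bid)
    from triple_Seq[OF 5 6] show "triple (\<lambda>s. ?M3 s \<and> \<not> tval (NLess (NConst 0) (var ''prv'')) s)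
       (Seq (NAssign ''nxt'' [] (NAdd (var ''nxt'') (NConst 1))) (NAssign ''cur'' [] (var ''nxt''))) ?Q (1 + 1)" .
  qed
  from triple_Seq[OF 1 triple_Seq[OF 2 triple_Seq[OF 3 4]]] show ?thesis by (simp only: bid_prog_def)
qed

text \<open>After \<open>m\<close> rounds the memory represents \<open>auction n w m\<close>, and
  \<open>auction_running\<close> limits the rounds. At exit the auction is frozen, so the state
  agrees with the one at the fixed round number in the definition of \<open>owner\<close>.\<close>

lemma auction_prog_triple:
  "triple (\<lambda>s. ready s \<and> repr (auction n w 0) s) auction_prog
     (\<lambda>s. ready s \<and> (\<forall>j\<in>{1..n}. fst s ''own'' [j] = owner n w (big n) j))
     ((n * (big n + 1) + 1) * (((1 + (n * (Suc 1 + 2) + 2)) + (1 + (1 + (1 + Suc (1 + 1))))) + 1) + 1)"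
proof -
  interpret auction_data n w "big n" unfolding w_def by (rule auction_data_weights[OF n])
  let ?t = "TNot (NLess (var ''n'') (var ''cur''))"
  have test: "tval ?t s \<longleftrightarrow> bidder (auction n w m) \<le> n" if "ready s \<and> repr (auction n w m) s" for s m
    using that ready_n[of s] by (auto simp: repr_def bidder_def split: prod.splits)
  show ?thesis
    unfolding auction_prog_def
  proof (rule triple_Loop[where I = "\<lambda>m s. ready s \<and> repr (auction n w m) s"])
    show "m < n * (big n + 1) + 1" if "ready s \<and> repr (auction n w m) s" "tval ?t s" for m s
      using auction_running[of m] test[OF that(1)] that(2) by simp
    show "triple (\<lambda>s. (ready s \<and> repr (auction n w m) s) \<and> tval ?t s) (Seq best_prog bid_prog)
       (\<lambda>s. ready s \<and> repr (auction n w (Suc m)) s) ((1 + (n * (Suc 1 + 2) + 2)) + (1 + (1 + (1 + Suc (1 + 1)))))" for m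
    proof (cases "bidder (auction n w m) \<le> n")
      case True
      obtain p own cur nxt where st: "auction n w m = (p, own, cur, nxt)" by (cases "auction n w m")
      have cur: "cur \<in> {1..n}" using True auction_inv_auction[of m] by (simp add: st bidder_def auction_inv_def)
      have suc: "auction n w (Suc m) = bid n w (auction n w m)" using True by (simp add: auction_Suc)
      show ?thesis
        unfolding suc
        by (rule triple_pre[OF triple_Seq[OF best_prog_triple[OF st cur] bid_prog_triple[OF st best_in refl]]]) simp
    next
      case False
      then have "\<not> ((ready s \<and> repr (auction n w m) s) \<and> tval ?t s)" for s using test[of s m] by blast
      then show ?thesis unfolding triple_def by blast
    qed
    show "ready s \<and> (\<forall>j\<in>{1..n}. fst s ''own'' [j] = owner n w (big n) j)"
      if s: "ready s \<and> repr (auction n w m) s" "\<not> tval ?t s" for m s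
    proof -
      have "auction n w m = auction n w (n * (big n + 1) + 1)"
      proof (rule auction_stopped)
        show "n < bidder (auction n w m)" using test[OF s(1)] s(2) by simp
        show "n < bidder (auction n w (n * (big n + 1) + 1))"
        proof (rule ccontr)
          assume "\<not> ?thesis"
          then have "bidder (auction n w (n * (big n + 1) + 1)) \<le> n" by simp
          from auction_running[OF this] show False by simp
        qed
      qed
      then show ?thesis using s(1) by (simp add: repr_def owner_def)
    qed
  qed
qed

lemma used_inv_write:
  assumes "used_inv n U' T' s"
  shows "used_inv n U' (insert x T') (write_cell (fst s) ''T'' x 1, snd s)"
    and "used_inv n (insert (i, j) U') T' (write_cell (fst s) ''used'' [i, j] 1, snd s)"
  using assms unfolding used_inv_def by (simp_all, blast)

lemma used_inv_write':
  assumes "used_inv n U' T' s" and "a \<notin> {''used'', ''T''}"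
  shows "used_inv n U' T' (write_cell (fst s) a x y, snd s)"
proof -
  have "write_cell (fst s) a x y b = fst s b" if "b \<in> {''used'', ''T''}" for b
    using that assms(2) by (auto simp: write_cell_def)
  then show ?thesis using assms(1) unfolding used_inv_def by (simp del: write_cell_apply)
qed

lemma global_inv_write:
  assumes "global_inv n C s" and "a \<notin> {''n'', ''W'', ''B''}"
  shows "global_inv n C (write_cell (fst s) a x y, snd s)"
proof -
  have "write_cell (fst s) a x y b = fst s b" if "b \<in> {''n'', ''W'', ''B''}" for b
    using that assms(2) by (auto simp: write_cell_def)
  then show ?thesis using assms(1) unfolding global_inv_def by (simp del: write_cell_apply)
qed

lemma mark_prog_triple:
  assumes \<sigma>: "\<sigma> = owner n w (big n)"
  shows "triple (\<lambda>s. ready s \<and> (\<forall>j\<in>{1..n}. fst s ''own'' [j] = \<sigma> j)) mark_prog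
    (\<lambda>s. (global_inv n C s \<and> used_inv n (U \<union> (\<lambda>j. (\<sigma> j, j)) ` {1..n}) (T \<union> (\<lambda>j. [\<sigma> j, j, k]) ` {1..n}) s)
       \<and> fst s ''k'' [] = k) (n * ((1 + 1) + 2) + 2)"
proof -
  let ?U = "\<lambda>j. U \<union> (\<lambda>j. (\<sigma> j, j)) ` {1..<j}" and ?T = "\<lambda>j. T \<union> (\<lambda>j. [\<sigma> j, j, k]) ` {1..<j}"
  let ?B = "\<lambda>s. (global_inv n C s \<and> fst s ''k'' [] = k) \<and> (\<forall>j\<in>{1..n}. fst s ''own'' [j] = \<sigma> j)"
  let ?I = "\<lambda>j s. ?B s \<and> used_inv n (?U j) (?T j) s"
  have B: "?B (write_cell (fst s) a x y, snd s)" if "?B s" "a \<notin> {''n'', ''W'', ''B'', ''k'', ''own''}" for s a x y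
  proof -
    have "write_cell (fst s) a x y b = fst s b" if "b \<in> {''k'', ''own''}" for b
      using that \<open>a \<notin> _\<close> by (auto simp: write_cell_def)
    then show ?thesis using that by (simp add: global_inv_write del: write_cell_apply)
  qed
  have main: "triple (?I 1) mark_prog (?I (Suc n)) (n * ((1 + 1) + 2) + 2)"
    unfolding mark_prog_def
  proof (rule triple_for_loop[where I = ?I])
    fix j assume j: "j \<in> {1..n}"
    have TS: "?T (Suc j) = insert [\<sigma> j, j, k] (?T j)" and US: "?U (Suc j) = insert (\<sigma> j, j) (?U j)"
    proof -
      have "{1..<Suc j} = insert j {1..<j}" using j by auto
      then show "?T (Suc j) = insert [\<sigma> j, j, k] (?T j)" "?U (Suc j) = insert (\<sigma> j, j) (?U j)" by simp_all
    qed
    let ?M = "\<lambda>s. (?B s \<and> used_inv n (?U j) (?T (Suc j)) s) \<and> fst s ''j'' [] = j"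
    show "triple (\<lambda>s. ?I j s \<and> fst s ''j'' [] = j)
       (Seq (NAssign ''T'' [NCell ''own'' [var ''j''], var ''j'', var ''k''] (NConst 1))
          (NAssign ''used'' [NCell ''own'' [var ''j''], var ''j''] (NConst 1)))
       (\<lambda>s. ?I (Suc j) s \<and> fst s ''j'' [] = j) (1 + 1)"
    proof (rule triple_Seq)
      show "triple (\<lambda>s. ?I j s \<and> fst s ''j'' [] = j)
        (NAssign ''T'' [NCell ''own'' [var ''j''], var ''j'', var ''k''] (NConst 1)) ?M 1"
      proof (rule triple_NAssign)
        fix s assume "?I j s \<and> fst s ''j'' [] = j"
        note s = conjunct1[OF conjunct1[OF this]] conjunct2[OF conjunct1[OF this]] conjunct2[OF this]
        have idx: "map (\<lambda>i. nval i s) [NCell ''own'' [var ''j''], var ''j'', var ''k''] = [\<sigma> j, j, k]"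
          using bspec[OF conjunct2[OF s(1)] j] conjunct2[OF conjunct1[OF s(1)]] s(3) by simp
        have "?B (write_cell (fst s) ''T'' [\<sigma> j, j, k] 1, snd s)" by (rule B[OF s(1)]) simp
        moreover note used_inv_write(1)[OF s(2), of "[\<sigma> j, j, k]"]
        moreover have "fst (write_cell (fst s) ''T'' [\<sigma> j, j, k] 1, snd s) ''j'' [] = j" using s(3) by simp
        ultimately show "?M (write_cell (fst s) ''T'' (map (\<lambda>i. nval i s) [NCell ''own'' [var ''j''], var ''j'', var ''k'']) (nval (NConst 1) s), snd s)"
          unfolding idx TS nval.simps by (rule conjI[OF conjI])
      qed
      show "triple ?M (NAssign ''used'' [NCell ''own'' [var ''j''], var ''j''] (NConst 1))
         (\<lambda>s. ?I (Suc j) s \<and> fst s ''j'' [] = j) 1"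
      proof (rule triple_NAssign)
        fix s assume "?M s"
        note s = conjunct1[OF conjunct1[OF this]] conjunct2[OF conjunct1[OF this]] conjunct2[OF this]
        have idx: "map (\<lambda>i. nval i s) [NCell ''own'' [var ''j''], var ''j''] = [\<sigma> j, j]"
          using bspec[OF conjunct2[OF s(1)] j] s(3) by simp
        have "?B (write_cell (fst s) ''used'' [\<sigma> j, j] 1, snd s)" by (rule B[OF s(1)]) simp
        moreover note used_inv_write(2)[OF s(2), of "\<sigma> j" j]
        moreover have "fst (write_cell (fst s) ''used'' [\<sigma> j, j] 1, snd s) ''j'' [] = j" using s(3) by simp
        ultimately show "?I (Suc j) (write_cell (fst s) ''used'' (map (\<lambda>i. nval i s) [NCell ''own'' [var ''j''], var ''j'']) (nval (NConst 1) s), snd s) \<and>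
            fst (write_cell (fst s) ''used'' (map (\<lambda>i. nval i s) [NCell ''own'' [var ''j''], var ''j'']) (nval (NConst 1) s), snd s) ''j'' [] = j"
          unfolding idx US nval.simps by (rule conjI[OF conjI])
      qed
    qed
  next
    fix j s y assume s: "?I j s"
    have "?B (write_cell (fst s) ''j'' [] y, snd s)" by (rule B[OF conjunct1[OF s]]) simp
    moreover have "used_inv n (?U j) (?T j) (write_cell (fst s) ''j'' [] y, snd s)"
      by (rule used_inv_write'[OF conjunct2[OF s]]) simp
    ultimately show "?I j (write_cell (fst s) ''j'' [] y, snd s)" by (rule conjI)
  qed (simp_all add: global_inv_def)
  have pre: "?I 1 s" if "ready s \<and> (\<forall>j\<in>{1..n}. fst s ''own'' [j] = \<sigma> j)" for s
  proof -
    have eqs: "?U 1 = U" "?T 1 = T" by simp_all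
    have "base_inv s" using that by (simp add: ready_def)
    then have "global_inv n C s" "fst s ''k'' [] = k" "used_inv n U T s" by (simp_all add: base_inv_def)
    then show ?thesis unfolding eqs using conjunct2[OF that] by (intro conjI)
  qed
  have last: "{1..<Suc n} = {1..n}" by auto
  show ?thesis
  proof (rule triple_post[OF triple_pre[OF main pre]])
    fix s assume "?I (Suc n) s"
    note c = this[unfolded last]
    show "(global_inv n C s \<and> used_inv n (U \<union> (\<lambda>j. (\<sigma> j, j)) ` {1..n}) (T \<union> (\<lambda>j. [\<sigma> j, j, k]) ` {1..n}) s)
       \<and> fst s ''k'' [] = k"
      using conjunct1[OF conjunct1[OF conjunct1[OF c]]] conjunct2[OF c] conjunct2[OF conjunct1[OF conjunct1[OF c]]]
      by (rule conjI[OF conjI])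
  qed
qed

lemma layer_prog_triple:
  assumes \<sigma>: "\<sigma> = owner n w (big n)"
  shows "triple base_inv layer_prog
    (\<lambda>s. (global_inv n C s \<and> used_inv n (U \<union> (\<lambda>j. (\<sigma> j, j)) ` {1..n}) (T \<union> (\<lambda>j. [\<sigma> j, j, k]) ` {1..n}) s)
       \<and> fst s ''k'' [] = k)
    ((n * ((n * ((1 + ((n * (1 + 2) + 2) + (Suc 1 + (Suc 1 + Suc 1)))) + 2) + 2) + 2) + 2) +
     (((n * ((1 + 1) + 2) + 2) + (1 + 1)) +
      (((n * (big n + 1) + 1) * (((1 + (n * (Suc 1 + 2) + 2)) + (1 + (1 + (1 + Suc (1 + 1))))) + 1) + 1) +
       (n * ((1 + 1) + 2) + 2))))"
  unfolding layer_prog_def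
  by (rule triple_Seq[OF weights_prog_triple[folded ready_def] triple_Seq[OF reset_prog_triple
      triple_Seq[OF auction_prog_triple[folded \<sigma>] mark_prog_triple[OF \<sigma>]]]])

end

text \<open>The bound is kept literally as the triples assemble it, so that it matches by unfolding,
  and polynomial growth follows from closure under sums and products.\<close>

definition layer_time :: "nat \<Rightarrow> nat" where
  "layer_time n = (n * ((n * ((1 + ((n * (1 + 2) + 2) + (Suc 1 + (Suc 1 + Suc 1)))) + 2) + 2) + 2) + 2) +
     (((n * ((1 + 1) + 2) + 2) + (1 + 1)) +
      (((n * (big n + 1) + 1) * (((1 + (n * (Suc 1 + 2) + 2)) + (1 + (1 + (1 + Suc (1 + 1))))) + 1) + 1) +
       (n * ((1 + 1) + 2) + 2)))"

definition latin_time :: "nat \<Rightarrow> nat" where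
  "latin_time n = (1 + ((n * (1 + 2) + 2) + (1 + (n * (1 + 2) + 2)))) + (n * (layer_time n + 2) + 2)"

lemma latin_prog_triple:
  assumes n: "1 \<le> n"
  shows "triple (\<lambda>s. fst s ''n'' [] = n \<and> (\<forall>x\<in>cube 3 n. snd s ''C'' x = C x) \<and> used_inv n {} {} s) latin_prog
     (\<lambda>s. used_inv n (used n C n) (marked n C n) s) (latin_time n)"
proof -
  let ?I = "\<lambda>k s. global_inv n C s \<and> used_inv n (used n C (k - 1)) (marked n C (k - 1)) s"
  have 1: "triple (\<lambda>s. fst s ''n'' [] = n \<and> (\<forall>x\<in>cube 3 n. snd s ''C'' x = C x) \<and> used_inv n {} {} s) init_prog
     (?I 1) (1 + ((n * (1 + 2) + 2) + (1 + (n * (1 + 2) + 2))))"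
    using init_prog_triple[of n C] by simp
  have 2: "triple (?I 1) (for_loop ''k'' layer_prog) (?I (Suc n)) (n * (layer_time n + 2) + 2)"
  proof (rule triple_for_loop[where I = ?I])
    fix k assume k: "k \<in> {1..n}"
    let ?w = "weights n (used n C (k - 1)) (layer C k)" and ?\<sigma> = "layer_matching n C (k - 1)"
    have \<sigma>: "?\<sigma> = owner n ?w (big n)"
      using k by (simp add: layer_matching_def matching_def)
    have S: "used n C (Suc k - 1) = used n C (k - 1) \<union> (\<lambda>j. (?\<sigma> j, j)) ` {1..n}"
        "marked n C (Suc k - 1) = marked n C (k - 1) \<union> (\<lambda>j. [?\<sigma> j, j, k]) ` {1..n}"
      using k used_Suc[of n C "k - 1"] marked.simps(2)[of n C "k - 1"] by simp_all
    show "triple (\<lambda>s. ?I k s \<and> fst s ''k'' [] = k) layer_prog (\<lambda>s. ?I (Suc k) s \<and> fst s ''k'' [] = k) (layer_time n)"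
      unfolding S layer_time_def
      by (rule triple_pre[OF layer_prog_triple[OF n k refl \<sigma>]]) (simp add: base_inv_def[OF n k refl])
  next
    fix k s y assume "?I k s"
    then show "?I k (write_cell (fst s) ''k'' [] y, snd s)"
      by (simp add: global_inv_def used_inv_def)
  qed (simp_all add: global_inv_def)
  from triple_Seq[OF 1 2] show ?thesis
    unfolding latin_prog_def latin_time_def by (rule triple_post) simp
qed

section \<open>Polynomial time and the output of the program\<close>

definition poly_bounded :: "(nat \<Rightarrow> nat) \<Rightarrow> bool" where
  "poly_bounded f \<longleftrightarrow> (\<exists>a k. \<forall>n\<ge>1. f n \<le> a * n ^ k)"

lemma poly_bounded_const: "poly_bounded (\<lambda>_. c)"
  unfolding poly_bounded_def by (intro exI[of _ c] exI[of _ 0]) simp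

lemma poly_bounded_ident: "poly_bounded (\<lambda>n. n)"
  unfolding poly_bounded_def by (intro exI[of _ 1] exI[of _ 1]) simp

lemma poly_bounded_add: "poly_bounded f \<Longrightarrow> poly_bounded g \<Longrightarrow> poly_bounded (\<lambda>n. f n + g n)"
  unfolding poly_bounded_def
proof (elim exE)
  fix a k b l assume f: "\<forall>n\<ge>1. f n \<le> a * n ^ k" and g: "\<forall>n\<ge>1. g n \<le> b * n ^ l"
  have "f n + g n \<le> (a + b) * n ^ (k + l)" if n: "1 \<le> n" for n
  proof -
    have "n ^ k \<le> n ^ (k + l)" "n ^ l \<le> n ^ (k + l)" using n by (simp_all add: power_increasing)
    then have "a * n ^ k + b * n ^ l \<le> a * n ^ (k + l) + b * n ^ (k + l)"
      by (intro add_mono mult_le_mono2)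
    moreover have "f n + g n \<le> a * n ^ k + b * n ^ l" using f g n by (intro add_mono) auto
    ultimately show ?thesis unfolding distrib_right by (rule order_trans[rotated])
  qed
  then show "\<exists>a k. \<forall>n\<ge>1. f n + g n \<le> a * n ^ k" by blast
qed

lemma poly_bounded_mult: "poly_bounded f \<Longrightarrow> poly_bounded g \<Longrightarrow> poly_bounded (\<lambda>n. f n * g n)"
  unfolding poly_bounded_def
proof (elim exE)
  fix a k b l assume f: "\<forall>n\<ge>1. f n \<le> a * n ^ k" and g: "\<forall>n\<ge>1. g n \<le> b * n ^ l"
  have "f n * g n \<le> (a * b) * n ^ (k + l)" if n: "1 \<le> n" for n
  proof -
    have "f n * g n \<le> (a * n ^ k) * (b * n ^ l)" using f g n by (intro mult_le_mono) auto
    also have "\<dots> = (a * b) * n ^ (k + l)" by (simp only: power_add mult_ac)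
    finally show ?thesis .
  qed
  then show "\<exists>a k. \<forall>n\<ge>1. f n * g n \<le> a * n ^ k" by blast
qed

lemma latin_time_poly: "poly_bounded latin_time"
  unfolding latin_time_def[abs_def] layer_time_def big_def
  by (intro poly_bounded_add poly_bounded_mult poly_bounded_const poly_bounded_ident)

lemma latin_prog_exec:
  assumes n: "1 \<le> n"
  obtains t s where "exec latin_prog (init_state 3 n C) t s" "t \<le> latin_time n" "output_set 3 n s = marked n C n"
proof -
  have "fst (init_state 3 n C) ''n'' [] = n \<and> (\<forall>x\<in>cube 3 n. snd (init_state 3 n C) ''C'' x = C x) \<and> used_inv n {} {} (init_state 3 n C)"
    by (simp add: init_state_def used_inv_def)
  with latin_prog_triple[OF n] obtain t s where s: "exec latin_prog (init_state 3 n C) t s" "t \<le> latin_time n"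
      and inv: "used_inv n (used n C n) (marked n C n) s"
    by (rule tripleE)
  have "output_set 3 n s = marked n C n"
    using inv marked_subset_cube[OF n, of C] unfolding output_set_def used_inv_def by blast
  with s that show ?thesis by blast
qed

lemma latin_prog_output:
  assumes n: "1 \<le> n"
  shows "program_output 3 latin_prog n C = marked n C n"
proof -
  obtain t s where s: "exec latin_prog (init_state 3 n C) t s" "output_set 3 n s = marked n C n"
    using latin_prog_exec[OF n] by blast
  \<comment> \<open>Determinism makes the run found by the triples the only one, so the definite
    description denotes its final state.\<close>
  have "(THE s. \<exists>t. exec latin_prog (init_state 3 n C) t s) = s"
    using s(1) exec_deterministic by (intro the_equality) blast+
  with s(2) show ?thesis by (simp add: program_output_def)
qed

lemma latin_prog_polynomial_time: "polynomial_time 3 latin_prog"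
proof -
  obtain a k where ak: "\<forall>n\<ge>1. latin_time n \<le> a * n ^ k" using latin_time_poly unfolding poly_bounded_def by blast
  show ?thesis
    unfolding polynomial_time_def
  proof (rule exI[of _ a], rule exI[of _ k], intro allI impI)
    fix n :: nat and C assume n: "1 \<le> n"
    obtain t s where "exec latin_prog (init_state 3 n C) t s" "t \<le> latin_time n"
      using latin_prog_exec[OF n] by blast
    then show "\<exists>t s. exec latin_prog (init_state 3 n C) t s \<and> t \<le> a * n ^ k"
      using ak n by (meson order_trans)
  qed
qed

lemma latin_prog_finds: "finds_axial_assignment 3 latin_prog"
  unfolding finds_axial_assignment_def using latin_prog_output marked_axial by simp

section \<open>Probabilistic analysis\<close>

text \<open>The scan compares values at a random index; such a value is measurable because the index
  ranges over a countable set.\<close>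

lemma best_measurable:
  assumes "\<And>j. (\<lambda>\<omega>. f \<omega> j) \<in> borel_measurable N"
  shows "(\<lambda>\<omega>. best (f \<omega>) n) \<in> measurable N (count_space UNIV)"
proof (induction n)
  case (Suc n)
  note [measurable] = assms Suc
  have [measurable]: "(\<lambda>\<omega>. f \<omega> (best (f \<omega>) n)) \<in> borel_measurable N"
    by (rule measurable_compose_countable[OF _ Suc]) (rule assms)
  show ?case unfolding best.simps by measurable
qed simp

text \<open>Prices and owners are functions, so measurability is demanded for each of their values,
  and no sigma-algebra on states is needed.\<close>

definition measurable_state :: "'b measure \<Rightarrow> ('b \<Rightarrow> auction_state) \<Rightarrow> bool" where
  "measurable_state N st \<longleftrightarrow>
     (\<forall>j. (\<lambda>\<omega>. fst (st \<omega>) j) \<in> measurable N (count_space UNIV)) \<and>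
     (\<forall>j. (\<lambda>\<omega>. fst (snd (st \<omega>)) j) \<in> measurable N (count_space UNIV)) \<and>
     (\<lambda>\<omega>. fst (snd (snd (st \<omega>)))) \<in> measurable N (count_space UNIV) \<and>
     (\<lambda>\<omega>. snd (snd (snd (st \<omega>)))) \<in> measurable N (count_space UNIV)"

lemma bid_measurable:
  assumes st: "measurable_state N st" and w: "\<And>i j. (\<lambda>\<omega>. w \<omega> i j) \<in> borel_measurable N"
  shows "measurable_state N (\<lambda>\<omega>. bid n (w \<omega>) (st \<omega>))"
proof -
  define p own cur nxt where "p = (\<lambda>\<omega>. fst (st \<omega>))" and "own = (\<lambda>\<omega>. fst (snd (st \<omega>)))"
    and "cur = (\<lambda>\<omega>. fst (snd (snd (st \<omega>))))" and "nxt = (\<lambda>\<omega>. snd (snd (snd (st \<omega>))))"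
  have st_eq: "st \<omega> = (p \<omega>, own \<omega>, cur \<omega>, nxt \<omega>)" for \<omega> by (simp add: p_def own_def cur_def nxt_def)
  have p [measurable]: "\<And>j. (\<lambda>\<omega>. p \<omega> j) \<in> measurable N (count_space UNIV)"
    and own [measurable]: "\<And>j. (\<lambda>\<omega>. own \<omega> j) \<in> measurable N (count_space UNIV)"
    and cur [measurable]: "cur \<in> measurable N (count_space UNIV)"
    and nxt [measurable]: "nxt \<in> measurable N (count_space UNIV)"
    using st unfolding measurable_state_def st_eq by simp_all
  define b where "b = (\<lambda>\<omega>. best (\<lambda>j. w \<omega> (cur \<omega>) j + real (p \<omega> j)) n)"
  have [measurable]: "(\<lambda>\<omega>. w \<omega> (cur \<omega>) j) \<in> borel_measurable N" for j
    by (rule measurable_compose_countable[OF _ cur]) (rule w)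
  have b [measurable]: "b \<in> measurable N (count_space UNIV)"
    unfolding b_def by (rule best_measurable) measurable
  have [measurable]: "(\<lambda>\<omega>. p \<omega> (b \<omega>)) \<in> measurable N (count_space UNIV)"
    "(\<lambda>\<omega>. own \<omega> (b \<omega>)) \<in> measurable N (count_space UNIV)"
    by (rule measurable_compose_countable[OF _ b], rule p) (rule measurable_compose_countable[OF _ b], rule own)
  have eq: "bid n (w \<omega>) (st \<omega>) = (\<lambda>j. if j = b \<omega> then p \<omega> (b \<omega>) + 1 else p \<omega> j,
      \<lambda>j. if j = b \<omega> then cur \<omega> else own \<omega> j,
      if own \<omega> (b \<omega>) = 0 then nxt \<omega> + 1 else own \<omega> (b \<omega>),
      if own \<omega> (b \<omega>) = 0 then nxt \<omega> + 1 else nxt \<omega>)" for \<omega>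
  proof -
    have "best (\<lambda>j. w \<omega> (cur \<omega>) j + real (p \<omega> j)) n = b \<omega>" by (simp add: b_def)
    then show ?thesis by (simp only: bid_def st_eq Let_def fun_upd_def prod.case)
  qed
  show ?thesis
    unfolding measurable_state_def eq fst_conv snd_conv by (intro conjI allI; measurable)
qed

lemma auction_measurable:
  assumes w: "\<And>i j. (\<lambda>\<omega>. w \<omega> i j) \<in> borel_measurable N"
  shows "measurable_state N (\<lambda>\<omega>. auction n (w \<omega>) m)"
proof (induction m)
  case 0
  then show ?case by (simp add: measurable_state_def auction_0)
next
  case (Suc m)
  have b: "measurable_state N (\<lambda>\<omega>. bid n (w \<omega>) (auction n (w \<omega>) m))"
    by (rule bid_measurable[OF Suc w])
  have "(\<lambda>\<omega>. bidder (auction n (w \<omega>) m)) \<in> measurable N (count_space UNIV)"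
    using Suc by (simp add: measurable_state_def bidder_def case_prod_beta')
  then have P [measurable]: "Measurable.pred N (\<lambda>\<omega>. n < bidder (auction n (w \<omega>) m))" by measurable
  show ?case
    using Suc b unfolding measurable_state_def auction_Suc if_distrib[of fst] if_distrib[of snd] if_distribR
    by (intro conjI allI measurable_If; (elim conjE)?; (rule P | simp))
qed

lemma matching_measurable:
  assumes c: "\<And>i j. (\<lambda>\<omega>. c \<omega> i j) \<in> borel_measurable N"
  shows "(\<lambda>\<omega>. matching n U (c \<omega>) j) \<in> measurable N (count_space UNIV)"
proof -
  have "(\<lambda>\<omega>. weights n U (c \<omega>) i j) \<in> borel_measurable N" for i j
    unfolding weights_def using c by (cases "(i, j) \<in> U") simp_all
  from auction_measurable[of "\<lambda>\<omega>. weights n U (c \<omega>)", OF this]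
  show ?thesis unfolding matching_def owner_def measurable_state_def by blast
qed

context
  fixes N :: "'b measure" and F :: "'b \<Rightarrow> nat list \<Rightarrow> real" and n :: nat
  assumes n: "1 \<le> n" and F: "\<And>x. (\<lambda>\<omega>. F \<omega> x) \<in> borel_measurable N"
begin

lemma matching_layer_measurable: "(\<lambda>\<omega>. matching n U (layer (F \<omega>) k) j) \<in> measurable N (count_space UNIV)"
  by (rule matching_measurable) (simp add: layer_def F)

text \<open>The set of used cells has finitely many possible values. Splitting by its value
  \<open>U\<close> before a layer makes the argument \<open>U\<close> of \<open>matching\<close>
  deterministic, and for fixed \<open>U\<close> measurability is already known.\<close>

lemma used_measurable: "Measurable.pred N (\<lambda>\<omega>. e \<in> used n (F \<omega>) k)"
  and used_eq_measurable: "U \<subseteq> {1..n} \<times> {1..n} \<Longrightarrow> Measurable.pred N (\<lambda>\<omega>. used n (F \<omega>) k = U)"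
proof -
  have *: "Measurable.pred N (\<lambda>\<omega>. used n (F \<omega>) k = U)"
    if U: "U \<subseteq> {1..n} \<times> {1..n}" and IH: "\<And>e. Measurable.pred N (\<lambda>\<omega>. e \<in> used n (F \<omega>) k)" for U k
  proof -
    have "used n (F \<omega>) k = U \<longleftrightarrow> (\<forall>e\<in>{1..n} \<times> {1..n}. e \<in> used n (F \<omega>) k \<longleftrightarrow> e \<in> U)" for \<omega>
      using U used_subset[OF n, of "F \<omega>" k] by blast
    moreover have "Measurable.pred N (\<lambda>\<omega>. \<forall>e\<in>{1..n} \<times> {1..n}. e \<in> used n (F \<omega>) k \<longleftrightarrow> e \<in> U)"
      using IH by (intro pred_intros_finite pred_intros_logic) auto
    ultimately show ?thesis by simp
  qed
  have 1: "Measurable.pred N (\<lambda>\<omega>. e \<in> used n (F \<omega>) k)" for e k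
  proof (induction k arbitrary: e)
    case (Suc k)
    obtain i j where e: "e = (i, j)" by (cases e)
    have "e \<in> used n (F \<omega>) (Suc k) \<longleftrightarrow> (\<exists>U\<in>Pow ({1..n} \<times> {1..n}). used n (F \<omega>) k = U \<and>
        ((i, j) \<in> U \<or> j \<in> {1..n} \<and> matching n U (layer (F \<omega>) (Suc k)) j = i))" for \<omega>
      using used_subset[OF n, of "F \<omega>" k] unfolding e by (auto simp: used_Suc layer_matching_def)
    moreover have "Measurable.pred N (\<lambda>\<omega>. \<exists>U\<in>Pow ({1..n} \<times> {1..n}). used n (F \<omega>) k = U \<and>
        ((i, j) \<in> U \<or> j \<in> {1..n} \<and> matching n U (layer (F \<omega>) (Suc k)) j = i))"
      using *[OF _ Suc] matching_layer_measurable
      by (intro pred_intros_finite pred_intros_logic) auto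
    ultimately show ?case by simp
  qed simp
  show "Measurable.pred N (\<lambda>\<omega>. e \<in> used n (F \<omega>) k)" by (rule 1)
  show "Measurable.pred N (\<lambda>\<omega>. used n (F \<omega>) k = U)" if "U \<subseteq> {1..n} \<times> {1..n}" by (rule *[OF that 1])
qed

lemma layer_matching_measurable: "(\<lambda>\<omega>. layer_matching n (F \<omega>) k j) \<in> measurable N (count_space UNIV)"
proof -
  have "layer_matching n (F \<omega>) k j = i \<longleftrightarrow> (\<exists>U\<in>Pow ({1..n} \<times> {1..n}). used n (F \<omega>) k = U \<and>
      matching n U (layer (F \<omega>) (Suc k)) j = i)" for \<omega> i
    using used_subset[OF n, of "F \<omega>" k] by (auto simp: layer_matching_def)
  moreover have "Measurable.pred N (\<lambda>\<omega>. \<exists>U\<in>Pow ({1..n} \<times> {1..n}). used n (F \<omega>) k = U \<and>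
      matching n U (layer (F \<omega>) (Suc k)) j = i)" for i
    using used_eq_measurable matching_layer_measurable
    by (intro pred_intros_finite pred_intros_logic) auto
  ultimately have "Measurable.pred N (\<lambda>\<omega>. layer_matching n (F \<omega>) k j = i)" for i by simp
  then show ?thesis
    by (subst measurable_count_space_eq2_countable) (auto simp: pred_def vimage_def Int_def conj_commute)
qed

lemma marked_cost_measurable: "(\<lambda>\<omega>. assignment_cost (F \<omega>) (marked n (F \<omega>) n)) \<in> borel_measurable N"
proof -
  have "(\<lambda>\<omega>. F \<omega> [layer_matching n (F \<omega>) l j, j, Suc l]) \<in> borel_measurable N" for l j
    by (rule measurable_compose_countable[OF _ layer_matching_measurable]) (rule F)
  then show ?thesis unfolding assignment_cost_def sum_marked by simp
qed

end

text \<open>Filling the first \<open>k\<close> layers reads only those layers. This is what makes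
  the free graph of the next layer independent of its costs.\<close>

lemma used_cong:
  assumes "\<And>i j l. l \<le> k \<Longrightarrow> c [i, j, l] = c' [i, j, l]"
  shows "used n c k = used n c' k"
  using assms
proof (induction k)
  case (Suc k)
  have "layer c (Suc k) = layer c' (Suc k)" using Suc.prems by (simp add: layer_def fun_eq_iff)
  with Suc show ?case by (simp add: used_Suc layer_matching_def)
qed simp

lemma init_state_cong:
  "init_state 3 n C = init_state 3 n (\<lambda>x. if x \<in> cube 3 n then C x else 0)"
  by (simp add: init_state_def fun_eq_iff)

text \<open>The machine sees the costs inside the cube only, so they may be replaced by their
  extension by 0. The random costs are assumed measurable just on the cube, while the measurability
  results above ask for all lists.\<close>

lemma latin_prog_cost:
  assumes n: "1 \<le> n"
  defines "C' \<equiv> (\<lambda>C x. if x \<in> cube 3 n then C x else (0::real))"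
  shows "assignment_cost C (program_output 3 latin_prog n C) = assignment_cost (C' C) (marked n (C' C) n)"
proof -
  have "program_output 3 latin_prog n C = program_output 3 latin_prog n (C' C)"
    using init_state_cong[of n C] by (simp add: program_output_def C'_def)
  also have "\<dots> = marked n (C' C) n" by (rule latin_prog_output[OF n])
  finally have "assignment_cost C (program_output 3 latin_prog n C) = assignment_cost C (marked n (C' C) n)" by simp
  also have "\<dots> = assignment_cost (C' C) (marked n (C' C) n)"
    unfolding assignment_cost_def using marked_subset_cube[OF n, of "C' C"]
    by (intro sum.cong) (auto simp: C'_def)
  finally show ?thesis .
qed

section \<open>The cost of one layer over a fixed free graph\<close>

text \<open>The abstract tail bound with \<open>2 * n\<close> dual variables and
  \<open>s = 3 * n\<close>: the probability is \<open>exp (- 3 * n) * (8/3) ^ (2 * n)\<close>, and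
  the value of any feasible dual is below \<open>4 * s / r\<close>, that is
  \<open>12 * n / r\<close>. The certificate of the auction is such a dual and adds the 2.\<close>

lemma layer_cost_tail:
  assumes n: "1 \<le> n" and k: "k < n" and reg: "regular n (n - k) U"
  defines "E \<equiv> (\<lambda>(i, j). [i, j, Suc k]) ` free_edges n U"
  shows "\<exists>A. A \<in> sets (PiM E (\<lambda>_. exp_measure)) \<and>
    measure (PiM E (\<lambda>_. exp_measure)) A \<le> (64 / 9 * exp (- 3)) ^ n \<and>
    (\<forall>c :: nat list \<Rightarrow> real. (\<forall>x\<in>cube 3 n. 0 < c x \<and> c x \<le> n) \<longrightarrow> restrict c E \<notin> A \<longrightarrow>
       (\<Sum>j\<in>{1..n}. layer c (Suc k) (matching n U (layer c (Suc k)) j) j) \<le> 12 * real n / real (n - k) + 2)"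
proof -
  define I where "I = Inl ` {1..n} \<union> (Inr ` {1..n} :: (nat + nat) set)"
  define a where "a = (\<lambda>e. case_sum (\<lambda>i. of_bool (e ! 0 = i)) (\<lambda>j. - of_bool (e ! 1 = j)) :: nat + nat \<Rightarrow> real)"
  define \<eta> where "\<eta> = 1 / (real (big n) + 1)"
  have \<eta>: "0 < \<eta>" by (simp add: \<eta>_def)
  define b where "b = (case_sum (\<lambda>_. 1) (\<lambda>_. - (1 + \<eta>)) :: nat + nat \<Rightarrow> real)"
  define r where "r = real (n - k)"
  have r: "0 < r" using k by (simp add: r_def)
  \<comment> \<open>Averaging the constraints over the free edges bounds the unperturbed value by
    the sum of the costs divided by \<open>r\<close>.\<close>
  define M where "M c = (1 + \<eta>/2) * ((\<Sum>e\<in>E. c e) / r)" for c :: "nat list \<Rightarrow> real"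
  have finE: "finite E" by (simp add: E_def)
  have sumI: "(\<Sum>i\<in>I. f i) = (\<Sum>i\<in>{1..n}. f (Inl i)) + (\<Sum>j\<in>{1..n}. f (Inr j))" for f :: "nat + nat \<Rightarrow> real"
    unfolding I_def by (subst sum.union_disjoint) (auto simp: sum.reindex)
  have load: "(\<Sum>x\<in>I. a [i, j, Suc k] x * D x) = D (Inl i) - D (Inr j)" if "i \<in> {1..n}" "j \<in> {1..n}" for i j D
  proof -
    have "(\<Sum>i'\<in>{1..n}. of_bool (i = i') * D (Inl i')) = D (Inl i)"
      using that by (subst sum.remove[of _ i]) (auto intro!: sum.neutral)
    moreover have "(\<Sum>j'\<in>{1..n}. - of_bool (j = j') * D (Inr j')) = - D (Inr j)"
      using that by (subst sum.remove[of _ j]) (auto intro!: sum.neutral)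
    ultimately show ?thesis unfolding sumI a_def by simp
  qed
  have inj: "inj_on (\<lambda>(i, j). [i, j, Suc k]) (free_edges n U)" by (auto simp: inj_on_def)
  have loads: "(\<Sum>e\<in>E. \<Sum>x\<in>I. a e x * D x) = r * ((\<Sum>i\<in>{1..n}. D (Inl i)) - (\<Sum>j\<in>{1..n}. D (Inr j)))" for D
  proof -
    have "(\<Sum>e\<in>E. \<Sum>x\<in>I. a e x * D x) = (\<Sum>e\<in>free_edges n U. \<Sum>x\<in>I. a (case e of (i, j) \<Rightarrow> [i, j, Suc k]) x * D x)"
      unfolding E_def by (subst sum.reindex[OF inj]) (simp only: o_def)
    also have "\<dots> = (\<Sum>e\<in>free_edges n U. D (Inl (fst e)) + - D (Inr (snd e)))"
      using load by (intro sum.cong) auto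
    also have "\<dots> = r * ((\<Sum>i\<in>{1..n}. D (Inl i)) + (\<Sum>j\<in>{1..n}. - D (Inr j)))"
      unfolding r_def by (rule sum_free_edges_regular[OF reg, of "\<lambda>i. D (Inl i)" "\<lambda>j. - D (Inr j)"])
    finally show ?thesis by (simp add: sum_negf)
  qed
  have vals: "(\<Sum>x\<in>I. b x * D x) = (\<Sum>i\<in>{1..n}. D (Inl i)) - (1 + \<eta>) * (\<Sum>j\<in>{1..n}. D (Inr j))" for D
    unfolding sumI b_def by (simp only: sum.case mult_1_left sum_distrib_left[symmetric])
  interpret dual_program I E a b r M "\<eta>/2"
  proof
    fix D :: "nat + nat \<Rightarrow> real" assume D: "\<And>i. i \<in> I \<Longrightarrow> 0 \<le> D i"
    have p: "0 \<le> (\<Sum>j\<in>{1..n}. D (Inr j))" by (intro sum_nonneg D) (auto simp: I_def)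
    then have \<eta>p: "0 \<le> \<eta> * (\<Sum>j\<in>{1..n}. D (Inr j))" using \<eta> by simp
    then show "r * (\<Sum>i\<in>I. b i * D i) \<le> (\<Sum>e\<in>E. \<Sum>i\<in>I. a e i * D i)"
      unfolding loads vals using r by (intro mult_left_mono) (simp_all add: distrib_right)
    fix c assume c: "\<And>e. e \<in> E \<Longrightarrow> (\<Sum>i\<in>I. a e i * D i) \<le> c e"
    have "r * ((\<Sum>i\<in>{1..n}. D (Inl i)) - (\<Sum>j\<in>{1..n}. D (Inr j))) \<le> (\<Sum>e\<in>E. c e)"
      unfolding loads[symmetric] using c by (rule sum_mono)
    then have S: "(\<Sum>i\<in>{1..n}. D (Inl i)) - (\<Sum>j\<in>{1..n}. D (Inr j)) \<le> (\<Sum>e\<in>E. c e) / r"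
      using r by (simp add: pos_le_divide_eq mult.commute)
    \<comment> \<open>The identity behind this is \<open>x - (1 + \<eta>) * y = (1 + \<eta>/2) * (x
      - y) - \<eta>/2 * (x + y)\<close>: the surcharge on the prices is traded for a decay in all
      variables at half the rate.\<close>
    have gen: "x - (1 + \<eta>) * y \<le> (1 + \<eta>/2) * z - \<eta>/2 * (x + y)" if "x - y \<le> z" for x y z :: real
    proof -
      have "(1 + \<eta>/2) * (x - y) \<le> (1 + \<eta>/2) * z" using \<eta> that by (intro mult_left_mono) auto
      then show ?thesis by (simp add: algebra_simps add_divide_distrib diff_divide_distrib)
    qed
    show "(\<Sum>i\<in>I. b i * D i) \<le> M c - \<eta>/2 * (\<Sum>i\<in>I. D i)"
      unfolding vals M_def sumI[of D] by (rule gen[OF S])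
  qed (use r \<eta> in \<open>auto simp: I_def finE\<close>)
  have cardI: "card I = 2 * n"
    unfolding I_def by (subst card_Un_disjoint) (auto simp: card_image)
  obtain A where A: "A \<in> sets costs" "measure costs A \<le> exp (- (3 * real n)) * (8/3) ^ card I"
    "\<forall>c\<in>space costs. c \<notin> A \<longrightarrow> (\<forall>e\<in>E. 0 < c e) \<longrightarrow> (\<forall>D. feasible c D \<longrightarrow> r * val D < 4 * (3 * real n))"
    using value_tail[of "3 * real n"] by (elim exE conjE)
  have "exp (- (3 * real n)) = exp (- 3) ^ n" by (simp add: exp_of_nat_mult[symmetric] mult.commute)
  moreover have "(8/3 :: real) ^ (2 * n) = (64 / 9) ^ n" by (simp add: power_mult power2_eq_square)
  ultimately have "exp (- (3 * real n)) * (8/3) ^ card I = (64 / 9 * exp (- 3)) ^ n"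
    unfolding cardI by (simp only: power_mult_distrib mult.commute)
  with A have A2: "measure costs A \<le> (64 / 9 * exp (- 3)) ^ n" by simp
  show ?thesis
  proof (intro exI[of _ A] conjI A(1) A2 allI impI)
    fix c :: "nat list \<Rightarrow> real"
    assume c: "\<forall>x\<in>cube 3 n. 0 < c x \<and> c x \<le> n" and cA: "restrict c E \<notin> A"
    have c': "0 < layer c (Suc k) i j \<and> layer c (Suc k) i j \<le> n" if "i \<in> {1..n}" "j \<in> {1..n}" for i j
    proof -
      have "[i, j, Suc k] \<in> cube 3 n" using that k by (simp add: cube_def)
      with c show ?thesis by (simp add: layer_def)
    qed
    have k1: "1 \<le> n - k" using k by simp
    let ?m = "matching n U (layer c (Suc k))"
    have "\<exists>u p. (\<forall>i\<in>{1..n}. 0 \<le> u i) \<and> (\<forall>j\<in>{1..n}. 0 \<le> p j) \<and>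
      (\<forall>i\<in>{1..n}. \<forall>j\<in>{1..n}. (i, j) \<notin> U \<longrightarrow> u i - p j \<le> layer c (Suc k) i j) \<and>
      (\<Sum>j\<in>{1..n}. layer c (Suc k) (?m j) j)
        \<le> (\<Sum>i\<in>{1..n}. u i) - (1 + 1 / (real (big n) + 1)) * (\<Sum>j\<in>{1..n}. p j) + 2"
      by (rule matching_certificate[OF n reg k1 c'])
    then obtain u p :: "nat \<Rightarrow> real" where u: "\<forall>i\<in>{1..n}. 0 \<le> u i" and p: "\<forall>j\<in>{1..n}. 0 \<le> p j"
      and up: "\<forall>i\<in>{1..n}. \<forall>j\<in>{1..n}. (i, j) \<notin> U \<longrightarrow> u i - p j \<le> layer c (Suc k) i j"
      and cost: "(\<Sum>j\<in>{1..n}. layer c (Suc k) (?m j) j)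
        \<le> (\<Sum>i\<in>{1..n}. u i) - (1 + 1 / (real (big n) + 1)) * (\<Sum>j\<in>{1..n}. p j) + 2"
      by (elim exE conjE)
    define D where "D = case_sum u p"
    have "feasible (restrict c E) D"
      unfolding feasible_def
    proof (intro conjI ballI)
      show "0 \<le> D x" if "x \<in> I" for x using that u p by (auto simp: I_def D_def)
      fix e assume e: "e \<in> E"
      then obtain i j where ij: "i \<in> {1..n}" "j \<in> {1..n}" "(i, j) \<notin> U" "e = [i, j, Suc k]"
        by (auto simp: E_def)
      have "local.load D e = u i - p j" unfolding load_def ij(4) load[OF ij(1,2)] by (simp add: D_def)
      then show "max 0 (local.load D e) \<le> restrict c E e"
        using bspec[OF bspec[OF up ij(1)] ij(2)] c'[OF ij(1,2)] ij(3) e by (simp add: ij(4) layer_def)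
    qed
    moreover have "0 < restrict c E e" if "e \<in> E" for e
      using that c' by (auto simp: E_def layer_def)
    ultimately have "r * val D < 4 * (3 * real n)"
      using bspec[OF A(3), of "restrict c E"] cA by (simp add: space_PiM)
    then have "val D \<le> 12 * n / r" using r by (simp add: pos_le_divide_eq mult.commute)
    moreover have "val D = (\<Sum>i\<in>{1..n}. u i) - (1 + 1 / (real (big n) + 1)) * (\<Sum>j\<in>{1..n}. p j)"
      unfolding val_def vals by (simp add: D_def \<eta>_def)
    ultimately show "(\<Sum>j\<in>{1..n}. layer c (Suc k) (?m j) j) \<le> 12 * real n / real (n - k) + 2"
      using cost by (simp add: r_def)
  qed
qed

lemma distributed_exp_measure:
  assumes "distributed M lborel X (\<lambda>t. ennreal (exponential_density 1 t))"
  shows "distr M borel X = exp_measure"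
proof -
  have "distr M borel X = distr M lborel X" by (rule distr_cong) auto
  also have "\<dots> = exp_measure"
    using assms by (simp add: distributed_def exp_measure_def)
  finally show ?thesis .
qed

lemma iid_restrict:
  assumes iid: "iid_exp_costs d n M C" and E: "E \<subseteq> cube d n" "E \<noteq> {}"
  shows "(\<lambda>\<omega>. \<lambda>x\<in>E. C x \<omega>) \<in> measurable M (PiM E (\<lambda>_. borel))"
    and "distr M (PiM E (\<lambda>_. borel)) (\<lambda>\<omega>. \<lambda>x\<in>E. C x \<omega>) = PiM E (\<lambda>_. exp_measure)"
proof -
  interpret prob_space M using iid by (simp add: iid_exp_costs_def)
  have rv: "random_variable borel (C x)" if "x \<in> E" for x
    using iid E that by (auto simp: iid_exp_costs_def distributed_def)
  then show "(\<lambda>\<omega>. \<lambda>x\<in>E. C x \<omega>) \<in> measurable M (PiM E (\<lambda>_. borel))"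
    by (intro measurable_restrict)
  have "indep_vars (\<lambda>_. borel) C (cube d n)" using iid by (simp add: iid_exp_costs_def)
  then have "indep_vars (\<lambda>_. borel) C E" by (rule indep_vars_subset[OF _ E(1)])
  then have "distr M (PiM E (\<lambda>_. borel)) (\<lambda>\<omega>. \<lambda>x\<in>E. C x \<omega>) = PiM E (\<lambda>x. distr M borel (C x))"
    using indep_vars_iff_distr_eq_PiM'[OF E(2) rv] by simp
  also have "\<dots> = PiM E (\<lambda>_. exp_measure)"
    using iid E by (intro PiM_cong) (auto simp: iid_exp_costs_def intro!: distributed_exp_measure)
  finally show "distr M (PiM E (\<lambda>_. borel)) (\<lambda>\<omega>. \<lambda>x\<in>E. C x \<omega>) = PiM E (\<lambda>_. exp_measure)" .
qed

section \<open>Conditioning on the earlier layers and summation over all layers\<close>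

context
  fixes n :: nat and M :: "'a measure" and C :: "nat list \<Rightarrow> 'a \<Rightarrow> real"
  assumes n: "1 \<le> n" and iid: "iid_exp_costs 3 n M C"
begin

interpretation prob_space M using iid by (simp add: iid_exp_costs_def)

definition cost :: "'a \<Rightarrow> nat list \<Rightarrow> real" where
  "cost \<omega> x = (if x \<in> cube 3 n then C x \<omega> else 0)"

lemma C_measurable: "x \<in> cube 3 n \<Longrightarrow> random_variable borel (C x)"
  using iid by (auto simp: iid_exp_costs_def distributed_def)

lemma cost_measurable: "(\<lambda>\<omega>. cost \<omega> x) \<in> borel_measurable M"
  unfolding cost_def by (cases "x \<in> cube 3 n") (simp_all add: C_measurable)

text \<open>The used cells are a function of the costs with third coordinate at most
  \<open>k\<close>, and \<open>E\<close> lies in the next layer; restrictions of an independent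
  family to disjoint index sets are independent.\<close>

lemma prob_used_and_fresh:
  assumes U: "U \<subseteq> {1..n} \<times> {1..n}" and E: "E \<subseteq> {x \<in> cube 3 n. x ! 2 = Suc k}" "E \<noteq> {}"
    and A: "A \<in> sets (PiM E (\<lambda>_. exp_measure))"
  shows "prob {\<omega> \<in> space M. used n (cost \<omega>) k = U \<and> restrict (cost \<omega>) E \<in> A}
     = prob {\<omega> \<in> space M. used n (cost \<omega>) k = U} * measure (PiM E (\<lambda>_. exp_measure)) A"
proof -
  define L where "L = {x \<in> cube 3 n. x ! 2 \<le> k}"
  have A': "A \<in> sets (PiM E (\<lambda>_. borel))" using A by (simp cong: sets_PiM_cong)
  have ind: "indep_var (PiM L (\<lambda>_. borel)) (\<lambda>\<omega>. restrict (\<lambda>x. C x \<omega>) L) (PiM E (\<lambda>_. borel)) (\<lambda>\<omega>. restrict (\<lambda>x. C x \<omega>) E)"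
    using iid E by (intro indep_var_restrict[where I = "cube 3 n"]) (auto simp: iid_exp_costs_def L_def)
  \<comment> \<open>Extension by 0 turns a cost vector on \<open>L\<close> into a full input, so
    that the used cells become a function of that vector alone.\<close>
  define ext where "ext = (\<lambda>y x. if x \<in> L then y x else (0::real))"
  define B where "B = {y \<in> space (PiM L (\<lambda>_. borel)). used n (ext y) k = U}"
  have ext_m: "(\<lambda>y. ext y x) \<in> borel_measurable (PiM L (\<lambda>_. borel))" for x
    unfolding ext_def by (cases "x \<in> L") simp_all
  have B: "B \<in> sets (PiM L (\<lambda>_. borel))"
    unfolding B_def using used_eq_measurable[of n ext, OF n ext_m U, of k] by simp
  have used: "used n (cost \<omega>) k = used n (ext (restrict (\<lambda>x. C x \<omega>) L)) k" for \<omega>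
    by (rule used_cong) (auto simp: cost_def ext_def L_def)
  have fresh: "restrict (cost \<omega>) E = restrict (\<lambda>x. C x \<omega>) E" for \<omega>
    using E by (auto simp: restrict_def cost_def fun_eq_iff)
  have "{\<omega> \<in> space M. used n (cost \<omega>) k = U \<and> restrict (cost \<omega>) E \<in> A}
     = (\<lambda>\<omega>. (restrict (\<lambda>x. C x \<omega>) L, restrict (\<lambda>x. C x \<omega>) E)) -` (B \<times> A) \<inter> space M"
    unfolding used fresh B_def by (auto simp: space_PiM)
  then have "prob {\<omega> \<in> space M. used n (cost \<omega>) k = U \<and> restrict (cost \<omega>) E \<in> A}
     = prob ((\<lambda>\<omega>. restrict (\<lambda>x. C x \<omega>) L) -` B \<inter> space M) * prob ((\<lambda>\<omega>. restrict (\<lambda>x. C x \<omega>) E) -` A \<inter> space M)"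
    using indep_varD[OF ind B A'] by simp
  also have "(\<lambda>\<omega>. restrict (\<lambda>x. C x \<omega>) L) -` B \<inter> space M = {\<omega> \<in> space M. used n (cost \<omega>) k = U}"
    unfolding used B_def by (auto simp: space_PiM)
  also have "prob ((\<lambda>\<omega>. restrict (\<lambda>x. C x \<omega>) E) -` A \<inter> space M) = measure (PiM E (\<lambda>_. exp_measure)) A"
  proof -
    have E': "E \<subseteq> cube 3 n" using E by blast
    show ?thesis
      using iid_restrict[OF iid E' E(2)] A' by (simp add: measure_distr[symmetric])
  qed
  finally show ?thesis .
qed

text \<open>The exceptional set \<open>A U\<close> depends on the random graph. The events that the
  used cells equal \<open>U\<close> are disjoint, so summing over \<open>U\<close> gives the uniform
  bound itself, not its multiple by the number of graphs.\<close>

lemma prob_layer_cost: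
  assumes k: "k < n"
  shows "\<exists>B. B \<in> events \<and> prob B \<le> (64 / 9 * exp (- 3)) ^ n \<and>
    (\<forall>\<omega>\<in>space M. \<omega> \<notin> B \<longrightarrow> (\<forall>x\<in>cube 3 n. 0 < C x \<omega> \<and> C x \<omega> \<le> n) \<longrightarrow>
       (\<Sum>j\<in>{1..n}. cost \<omega> [layer_matching n (cost \<omega>) k j, j, Suc k]) \<le> 12 * real n / real (n - k) + 2)"
proof -
  define \<rho> where "\<rho> = (64 / 9 * exp (- 3) :: real) ^ n"
  have \<rho>: "0 \<le> \<rho>" by (simp add: \<rho>_def)
  define E where "E U = (\<lambda>(i, j). [i, j, Suc k]) ` free_edges n U" for U
  let ?good = "\<lambda>U A. A \<in> sets (PiM (E U) (\<lambda>_. exp_measure)) \<and> measure (PiM (E U) (\<lambda>_. exp_measure)) A \<le> \<rho> \<and>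
    (\<forall>c :: nat list \<Rightarrow> real. (\<forall>x\<in>cube 3 n. 0 < c x \<and> c x \<le> n) \<longrightarrow> restrict c (E U) \<notin> A \<longrightarrow>
       (\<Sum>j\<in>{1..n}. layer c (Suc k) (matching n U (layer c (Suc k)) j) j) \<le> 12 * real n / real (n - k) + 2)"
  have ex: "\<exists>A. ?good U A" if U: "regular n (n - k) U" for U
    unfolding E_def \<rho>_def by (rule layer_cost_tail[OF n k U])
  define A where "A U = (SOME A. ?good U A)" for U
  have A: "?good U (A U)" if "regular n (n - k) U" for U
    unfolding A_def by (rule someI_ex) (rule ex[OF that])
  define V where "V = {U. U \<subseteq> {1..n} \<times> {1..n} \<and> regular n (n - k) U}"
  have finV: "finite V" unfolding V_def by (rule finite_subset[of _ "Pow ({1..n} \<times> {1..n})"]) auto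
  have used_V: "used n c k \<in> V" for c
    using used_subset[OF n, of c k] used_regular[OF n, of k c] k by (simp add: V_def)
  define B where "B U = {\<omega> \<in> space M. used n (cost \<omega>) k = U \<and> restrict (cost \<omega>) (E U) \<in> A U}" for U
  have used_ev: "{\<omega> \<in> space M. used n (cost \<omega>) k = U} \<in> events" if "U \<in> V" for U
    using used_eq_measurable[of n cost M U k, OF n cost_measurable] that by (simp add: V_def)
  have restrict_m: "(\<lambda>\<omega>. restrict (cost \<omega>) F) \<in> measurable M (PiM F (\<lambda>_. exp_measure))" for F
    using cost_measurable by (intro measurable_restrict) (simp cong: measurable_cong_sets)
  have B_ev: "B U \<in> events" if U: "U \<in> V" for U
  proof -
    have "B U = {\<omega> \<in> space M. used n (cost \<omega>) k = U} \<inter> ((\<lambda>\<omega>. restrict (cost \<omega>) (E U)) -` A U \<inter> space M)"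
      by (auto simp: B_def)
    moreover have "A U \<in> sets (PiM (E U) (\<lambda>_. exp_measure))" using A U by (simp add: V_def)
    ultimately show ?thesis using used_ev[OF U] measurable_sets[OF restrict_m] by simp
  qed
  have B_prob: "prob (B U) \<le> prob {\<omega> \<in> space M. used n (cost \<omega>) k = U} * \<rho>" if U: "U \<in> V" for U
  proof -
    have reg: "regular n (n - k) U" and sub: "U \<subseteq> {1..n} \<times> {1..n}" using U by (auto simp: V_def)
    have "E U \<subseteq> {x \<in> cube 3 n. x ! 2 = Suc k}" using k by (auto simp: E_def cube_def)
    moreover have "E U \<noteq> {}"
    proof -
      have "card (free_edges n U) \<noteq> 0" unfolding card_free_edges[OF reg] using n k by simp
      then have "free_edges n U \<noteq> {}" by (metis card.empty)
      then show ?thesis unfolding E_def by (simp only: image_is_empty not_False_eq_True)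
    qed
    ultimately have "prob (B U) = prob {\<omega> \<in> space M. used n (cost \<omega>) k = U} * measure (PiM (E U) (\<lambda>_. exp_measure)) (A U)"
      unfolding B_def using sub A[OF reg] by (intro prob_used_and_fresh) auto
    then show ?thesis using A[OF reg] by (simp add: mult_left_mono)
  qed
  show ?thesis
  proof (intro exI[of _ "\<Union>U\<in>V. B U"] conjI ballI impI)
    show "(\<Union>U\<in>V. B U) \<in> events" using finV B_ev by auto
    have "prob (\<Union>U\<in>V. B U) \<le> (\<Sum>U\<in>V. prob (B U))"
      using finV B_ev by (intro finite_measure_subadditive_finite) auto
    also have "\<dots> \<le> (\<Sum>U\<in>V. prob {\<omega> \<in> space M. used n (cost \<omega>) k = U}) * \<rho>"
      unfolding sum_distrib_right by (rule sum_mono) (rule B_prob)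
    also have "(\<Sum>U\<in>V. prob {\<omega> \<in> space M. used n (cost \<omega>) k = U})
        = prob (\<Union>U\<in>V. {\<omega> \<in> space M. used n (cost \<omega>) k = U})"
      using finV used_ev by (intro finite_measure_finite_Union[symmetric]) (auto simp: disjoint_family_on_def)
    also have "\<dots> * \<rho> \<le> 1 * \<rho>" using \<rho> by (intro mult_right_mono prob_le_1)
    finally show "prob (\<Union>U\<in>V. B U) \<le> (64 / 9 * exp (- 3)) ^ n" by (simp add: \<rho>_def)
    fix \<omega> assume \<omega>: "\<omega> \<in> space M" "\<omega> \<notin> (\<Union>U\<in>V. B U)" and c: "\<forall>x\<in>cube 3 n. 0 < C x \<omega> \<and> C x \<omega> \<le> n"
    let ?U = "used n (cost \<omega>) k"
    have "restrict (cost \<omega>) (E ?U) \<notin> A ?U" using \<omega> used_V[of "cost \<omega>"] by (auto simp: B_def)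
    moreover have "\<forall>x\<in>cube 3 n. 0 < cost \<omega> x \<and> cost \<omega> x \<le> n" using c by (simp add: cost_def)
    moreover have "?good ?U (A ?U)" using A used_V[of "cost \<omega>"] by (simp add: V_def)
    ultimately show "(\<Sum>j\<in>{1..n}. cost \<omega> [layer_matching n (cost \<omega>) k j, j, Suc k]) \<le> 12 * real n / real (n - k) + 2"
      by (simp add: layer_def layer_matching_def)
  qed
qed

text \<open>Outside this event clipping leaves all free weights intact and the tail bound applies. A
  cost is at most 0 with probability 0 and above \<open>n\<close> with probability
  \<open>exp (- n)\<close>; there are \<open>n ^ 3\<close> cells.\<close>

lemma prob_extreme_cost:
  "prob {\<omega> \<in> space M. \<exists>x\<in>cube 3 n. \<not> (0 < C x \<omega> \<and> C x \<omega> \<le> n)} \<le> real n ^ 3 * exp (- real n)"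
proof -
  have m: "{\<omega> \<in> space M. \<not> (0 < C x \<omega> \<and> C x \<omega> \<le> n)} \<in> events" if "x \<in> cube 3 n" for x
    using C_measurable[OF that] by measurable
  have p: "prob {\<omega> \<in> space M. \<not> (0 < C x \<omega> \<and> C x \<omega> \<le> n)} \<le> exp (- real n)" if x: "x \<in> cube 3 n" for x
  proof -
    note [measurable] = C_measurable[OF x]
    have D: "distributed M lborel (C x) (exponential_density 1)" using iid x by (simp add: iid_exp_costs_def)
    have "prob {\<omega> \<in> space M. \<not> (0 < C x \<omega> \<and> C x \<omega> \<le> n)}
        \<le> prob ({\<omega> \<in> space M. C x \<omega> \<le> 0} \<union> {\<omega> \<in> space M. real n < C x \<omega>})"
      by (intro finite_measure_mono) auto
    also have "\<dots> \<le> prob {\<omega> \<in> space M. C x \<omega> \<le> 0} + prob {\<omega> \<in> space M. real n < C x \<omega>}"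
      by (intro measure_Un_le) auto
    also have "\<dots> = exp (- real n)"
      using exponential_distributedD_le[OF D, of 0] exponential_distributedD_gt[OF D, of "real n"] by simp
    finally show ?thesis .
  qed
  have "{\<omega> \<in> space M. \<exists>x\<in>cube 3 n. \<not> (0 < C x \<omega> \<and> C x \<omega> \<le> n)}
      = (\<Union>x\<in>cube 3 n. {\<omega> \<in> space M. \<not> (0 < C x \<omega> \<and> C x \<omega> \<le> n)})" by auto
  then have "prob {\<omega> \<in> space M. \<exists>x\<in>cube 3 n. \<not> (0 < C x \<omega> \<and> C x \<omega> \<le> n)}
      \<le> (\<Sum>x\<in>cube 3 n. prob {\<omega> \<in> space M. \<not> (0 < C x \<omega> \<and> C x \<omega> \<le> n)})"
    using m finite_cube by (auto intro!: finite_measure_subadditive_finite)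
  also have "\<dots> \<le> (\<Sum>x\<in>cube 3 n. exp (- real n))" by (intro sum_mono p)
  also have "\<dots> = real n ^ 3 * exp (- real n)"
    using card_lists_length_eq[of "{1..n}" 3] by (simp add: cube_def conj_commute)
  finally show ?thesis .
qed

text \<open>The bounds \<open>12 * n / (n - k) + 2\<close> add up to a harmonic sum after the
  substitution of \<open>n - k\<close> for \<open>k\<close>; the failure probability is a union over
  \<open>n\<close> layers and the extreme costs.\<close>

lemma prob_latin_cost:
  "1 - (real n ^ 3 * exp (- real n) + n * (64 / 9 * exp (- 3)) ^ n)
    \<le> prob {\<omega> \<in> space M. assignment_cost (\<lambda>x. C x \<omega>) (program_output 3 latin_prog n (\<lambda>x. C x \<omega>)) \<le> 12 * real n * harm n + 2 * real n}"
proof -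
  define \<rho> where "\<rho> = (64 / 9 * exp (- 3) :: real) ^ n"
  let ?good = "\<lambda>k B. B \<in> events \<and> prob B \<le> \<rho> \<and> (\<forall>\<omega>\<in>space M. \<omega> \<notin> B \<longrightarrow> (\<forall>x\<in>cube 3 n. 0 < C x \<omega> \<and> C x \<omega> \<le> n) \<longrightarrow>
       (\<Sum>j\<in>{1..n}. cost \<omega> [layer_matching n (cost \<omega>) k j, j, Suc k]) \<le> 12 * real n / real (n - k) + 2)"
  have ex: "\<exists>B. ?good k B" if "k < n" for k
    unfolding \<rho>_def by (rule prob_layer_cost[OF that])
  define B where "B k = (SOME B. ?good k B)" for k
  have B: "?good k (B k)" if "k < n" for k
    unfolding B_def by (rule someI_ex) (rule ex[OF that])
  define X where "X = {\<omega> \<in> space M. \<exists>x\<in>cube 3 n. \<not> (0 < C x \<omega> \<and> C x \<omega> \<le> n)}"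
  have X: "X \<in> events"
  proof -
    have "X = (\<Union>x\<in>cube 3 n. {\<omega> \<in> space M. \<not> (0 < C x \<omega> \<and> C x \<omega> \<le> n)})" by (auto simp: X_def)
    moreover have "{\<omega> \<in> space M. \<not> (0 < C x \<omega> \<and> C x \<omega> \<le> n)} \<in> events" if "x \<in> cube 3 n" for x
      using C_measurable[OF that] by measurable
    ultimately show ?thesis using finite_cube by auto
  qed
  let ?cost = "\<lambda>\<omega>. assignment_cost (\<lambda>x. C x \<omega>) (program_output 3 latin_prog n (\<lambda>x. C x \<omega>))"
  have cost_eq: "?cost \<omega> = assignment_cost (cost \<omega>) (marked n (cost \<omega>) n)" for \<omega>
    using latin_prog_cost[OF n, of "\<lambda>x. C x \<omega>"] by (simp add: cost_def[abs_def])
  have meas: "{\<omega> \<in> space M. ?cost \<omega> \<le> 12 * real n * harm n + 2 * real n} \<in> events"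
    unfolding cost_eq using marked_cost_measurable[of n cost M, OF n cost_measurable] by measurable
  have "space M - (X \<union> (\<Union>k<n. B k)) \<subseteq> {\<omega> \<in> space M. ?cost \<omega> \<le> 12 * real n * harm n + 2 * real n}"
  proof
    fix \<omega> assume \<omega>: "\<omega> \<in> space M - (X \<union> (\<Union>k<n. B k))"
    have c: "\<forall>x\<in>cube 3 n. 0 < C x \<omega> \<and> C x \<omega> \<le> n" using \<omega> unfolding X_def by blast
    have "?cost \<omega> = (\<Sum>k<n. \<Sum>j\<in>{1..n}. cost \<omega> [layer_matching n (cost \<omega>) k j, j, Suc k])"
      unfolding cost_eq unfolding assignment_cost_def sum_marked ..
    also have "\<dots> \<le> (\<Sum>k<n. 12 * real n / real (n - k) + 2)"
      using B \<omega> c by (intro sum_mono) blast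
    also have "\<dots> = 12 * real n * (\<Sum>k<n. 1 / real (n - k)) + 2 * real n"
      by (simp add: sum.distrib sum_distrib_left)
    also have "(\<Sum>k<n. 1 / real (n - k)) = harm n"
      unfolding harm_def
      by (rule sum.reindex_bij_witness[of _ "\<lambda>k. n - k" "\<lambda>k. n - k"]) (auto simp: inverse_eq_divide)
    finally show "\<omega> \<in> {\<omega> \<in> space M. ?cost \<omega> \<le> 12 * real n * harm n + 2 * real n}" using \<omega> by simp
  qed
  then have "prob (space M - (X \<union> (\<Union>k<n. B k))) \<le> prob {\<omega> \<in> space M. ?cost \<omega> \<le> 12 * real n * harm n + 2 * real n}"
    using meas by (rule finite_measure_mono)
  moreover have "prob (space M - (X \<union> (\<Union>k<n. B k))) = 1 - prob (X \<union> (\<Union>k<n. B k))"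
    using X B by (intro prob_compl) auto
  moreover have "prob (X \<union> (\<Union>k<n. B k)) \<le> real n ^ 3 * exp (- real n) + n * \<rho>"
  proof -
    have "prob (X \<union> (\<Union>k<n. B k)) \<le> prob X + prob (\<Union>k<n. B k)"
      using X B by (intro measure_Un_le) auto
    also have "prob (\<Union>k<n. B k) \<le> (\<Sum>k<n. prob (B k))"
      using B by (intro finite_measure_subadditive_finite) auto
    also have "\<dots> \<le> (\<Sum>k<n. \<rho>)" using B by (intro sum_mono) simp
    finally show ?thesis using prob_extreme_cost by (simp add: X_def)
  qed
  ultimately show ?thesis by (simp add: \<rho>_def)
qed

end

lemma harm_le_ln: "1 \<le> n \<Longrightarrow> harm n \<le> ln (real n) + 1"
proof -
  assume "1 \<le> n"
  then obtain m where m: "n = Suc m" by (cases n) auto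
  have "harm (Suc m) - ln (real (Suc m)) \<le> harm (Suc 0) - ln (real (Suc 0))"
    using decseqD[OF decseq_harm_diff_ln, of 0 m] by simp
  then show ?thesis by (simp add: m harm_def)
qed

lemma latin_cost_whp:
  fixes M :: "nat \<Rightarrow> 'a measure"
  assumes iid: "\<And>n. iid_exp_costs 3 n (M n) (C n)"
  shows "whp M (\<lambda>n \<omega>. assignment_cost (\<lambda>x. C n x \<omega>) (program_output 3 latin_prog n (\<lambda>x. C n x \<omega>))
           \<le> 26 * (real n * ln (real n)))"
  unfolding whp_def
proof (rule tendsto_sandwich)
  let ?cost = "\<lambda>n \<omega>. assignment_cost (\<lambda>x. C n x \<omega>) (program_output 3 latin_prog n (\<lambda>x. C n x \<omega>))"
  let ?p = "\<lambda>n. measure (M n) {\<omega> \<in> space (M n). ?cost n \<omega> \<le> 26 * (real n * ln (real n))}"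
  let ?l = "\<lambda>n. 1 - (real n ^ 3 * exp (- real n) + real n * (1/2) ^ n)"
  have prob: "prob_space (M n)" for n using iid[of n] by (simp add: iid_exp_costs_def)
  show "\<forall>\<^sub>F n in sequentially. ?p n \<le> 1"
    by (intro always_eventually allI prob_space.prob_le_1 prob)
  have "(\<lambda>n. real n ^ 3 / exp (real n)) \<longlonglongrightarrow> 0"
    by (rule filterlim_compose[OF tendsto_power_div_exp_0 filterlim_real_sequentially])
  then have "(\<lambda>n. real n ^ 3 * exp (- real n)) \<longlonglongrightarrow> 0"
    by (simp only: exp_minus divide_inverse)
  moreover have "(\<lambda>n. real n * (1/2) ^ n) \<longlonglongrightarrow> (0::real)"
    by (rule powser_times_n_limit_0) simp
  ultimately have "(\<lambda>n. 1 - (real n ^ 3 * exp (- real n) + real n * (1/2) ^ n)) \<longlonglongrightarrow> 1 - (0 + 0)"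
    by (intro tendsto_intros)
  then show "?l \<longlonglongrightarrow> 1" by simp
  show "(\<lambda>_. 1) \<longlonglongrightarrow> (1::real)" by simp
  \<comment> \<open>From \<open>exp 1 \<ge> 5/2\<close> one gets \<open>exp 3 \<ge> 125/8\<close>,
    which exceeds \<open>128/9\<close>.\<close>
  have half: "64 / 9 * exp (- 3) \<le> (1/2 :: real)"
  proof -
    have "(5/2 :: real) \<le> exp 1" using exp_lower_Taylor_quadratic[of 1] by simp
    then have "(5/2 :: real) ^ 3 \<le> exp 1 ^ 3" by (rule power_mono) simp
    also have "exp 1 ^ 3 = (exp 3 :: real)" using exp_of_nat_mult[of 3 "1::real"] by simp
    finally have "128 / 9 \<le> (exp 3 :: real)" by (simp add: power3_eq_cube)
    then have "128 / 9 * exp (- 3) \<le> (exp 3 :: real) * exp (- 3)" by (rule mult_right_mono) simp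
    also have "exp 3 * exp (- 3) = (1 :: real)" by (simp add: exp_minus)
    finally show ?thesis by simp
  qed
  show "\<forall>\<^sub>F n in sequentially. ?l n \<le> ?p n"
    \<comment> \<open>From \<open>n = 3\<close> on, \<open>ln n\<close> is at least 1, so the linear
      term \<open>14 * n\<close> is absorbed and the constant becomes 12 + 14 = 26.\<close>
    using eventually_ge_at_top[of 3]
  proof eventually_elim
    case (elim n)
    interpret prob_space "M n" by (rule prob)
    have n: "1 \<le> n" using elim by simp
    have "exp 1 \<le> real n" using exp_le elim by linarith
    then have "ln (exp 1) \<le> ln (real n)" using n by (subst ln_le_cancel_iff) auto
    then have ln: "1 \<le> ln (real n)" by simp
    have "12 * real n * harm n + 2 * real n \<le> 12 * real n * (ln (real n) + 1) + 2 * real n"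
      using harm_le_ln[OF n] by (intro add_right_mono mult_left_mono) auto
    also have "\<dots> = 12 * (real n * ln (real n)) + 14 * (real n * 1)" by (simp add: algebra_simps)
    also have "\<dots> \<le> 12 * (real n * ln (real n)) + 14 * (real n * ln (real n))"
      using ln by (intro add_left_mono mult_left_mono) auto
    finally have le: "12 * real n * harm n + 2 * real n \<le> 26 * (real n * ln (real n))" by simp
    have meas: "{\<omega> \<in> space (M n). ?cost n \<omega> \<le> 26 * (real n * ln (real n))} \<in> events"
      unfolding latin_prog_cost[OF n]
      using marked_cost_measurable[of n "cost n (C n)" "M n", OF n cost_measurable[OF n iid]]
      unfolding cost_def[OF n iid, abs_def] by measurable
    have "(64 / 9 * exp (- 3)) ^ n \<le> (1/2 :: real) ^ n" by (intro power_mono half) auto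
    then have "?l n \<le> 1 - (real n ^ 3 * exp (- real n) + n * (64 / 9 * exp (- 3)) ^ n)"
      by (simp add: mult_left_mono)
    also have "\<dots> \<le> prob {\<omega> \<in> space (M n). ?cost n \<omega> \<le> 12 * real n * harm n + 2 * real n}"
      by (rule prob_latin_cost[OF n iid])
    also have "\<dots> \<le> ?p n" using le meas by (intro finite_measure_mono) auto
    finally show ?case .
  qed
qed

section \<open>The lower bound\<close>

lemma Cons_in_cube: "i # x \<in> cube (Suc d) n \<longleftrightarrow> i \<in> {1..n} \<and> x \<in> cube d n"
  by (auto simp: cube_def)

lemma card_cube: "card (cube d n) = n ^ d"
  using card_lists_length_eq[of "{1..n}" d] by (simp add: cube_def conj_commute)

text \<open>An axial assignment is the graph of a function of the last \<open>d - 1\<close> coordinates.\<close>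

lemma card_axial_assignments:
  assumes n: "1 \<le> n"
  shows "card (axial_assignments (Suc d) n) \<le> n ^ (n ^ d)"
proof -
  define F where "F T = (\<lambda>y\<in>cube d n. THE i. i # y \<in> T)" for T
  have uniq: "\<exists>!i. i # y \<in> T" if T: "T \<in> axial_assignments (Suc d) n" and y: "y \<in> cube d n" for T y
  proof -
    let ?L = "(\<lambda>i. (1 # y)[0 := i]) ` {1..n}"
    have "1 # y \<in> cube (Suc d) n" using y n by (simp add: Cons_in_cube)
    then have L: "?L \<in> axis_lines (Suc d) n"
      unfolding axis_lines_def by (intro CollectI exI[of _ "1 # y"] exI[of _ 0] conjI refl) simp_all
    have "\<forall>L\<in>axis_lines (Suc d) n. \<exists>!x. x \<in> T \<inter> L" using T unfolding axial_assignments_def mem_Collect_eq by (elim conjE)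
    then have "\<exists>!x. x \<in> T \<inter> ?L" using L by (rule bspec)
    then obtain x where x: "x \<in> T \<inter> ?L" and u: "\<forall>x'. x' \<in> T \<inter> ?L \<longrightarrow> x' = x" by (elim ex1E)
    have "\<exists>i. x = i # y" using x by auto
    then obtain i where i: "x = i # y" by blast
    show ?thesis
    proof (rule ex1I[of _ i])
      show "i # y \<in> T" using x i by simp
      fix i' assume i': "i' # y \<in> T"
      then have "i' # y \<in> cube (Suc d) n" using T by (auto simp: axial_assignments_def)
      then have "i' \<in> {1..n}" by (simp add: Cons_in_cube)
      then have "i' # y \<in> ?L" by (intro image_eqI[of _ _ i']) simp_all
      with i' have "i' # y = x" using u by blast
      then show "i' = i" using i by simp
    qed
  qed
  have F: "F T y = i \<longleftrightarrow> i # y \<in> T" if "T \<in> axial_assignments (Suc d) n" "y \<in> cube d n" for T y i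
  proof -
    have the: "F T y = (THE i. i # y \<in> T)" using that(2) by (simp add: F_def)
    show ?thesis
    proof
      assume "F T y = i"
      then show "i # y \<in> T" using theI'[OF uniq[OF that]] the by simp
    next
      assume "i # y \<in> T"
      then show "F T y = i" using the1_equality[OF uniq[OF that]] the by simp
    qed
  qed
  have "inj_on F (axial_assignments (Suc d) n)"
  proof (rule inj_onI)
    fix T T' assume T: "T \<in> axial_assignments (Suc d) n" and T': "T' \<in> axial_assignments (Suc d) n" and eq: "F T = F T'"
    have "T \<subseteq> cube (Suc d) n" "T' \<subseteq> cube (Suc d) n" using T T' by (auto simp: axial_assignments_def)
    moreover have "x \<in> T \<longleftrightarrow> x \<in> T'" if "x \<in> cube (Suc d) n" for x
    proof -
      obtain i y where x: "x = i # y" using \<open>x \<in> cube (Suc d) n\<close> by (cases x) (auto simp: cube_def)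
      then have "y \<in> cube d n" using \<open>x \<in> cube (Suc d) n\<close> by (simp add: Cons_in_cube)
      then show ?thesis using F[OF T, of y i] F[OF T', of y i] eq x by simp
    qed
    ultimately show "T = T'" by blast
  qed
  moreover have "F ` axial_assignments (Suc d) n \<subseteq> PiE (cube d n) (\<lambda>_. {1..n})"
  proof (intro image_subsetI PiE_I)
    fix T y assume T: "T \<in> axial_assignments (Suc d) n" and y: "y \<in> cube d n"
    have "F T y # y \<in> T" using F[OF T y] by blast
    then show "F T y \<in> {1..n}" using T by (auto simp: axial_assignments_def Cons_in_cube)
  qed (simp add: F_def)
  ultimately have "card (axial_assignments (Suc d) n) \<le> card (PiE (cube d n) (\<lambda>_. {1..n}))"
    using finite_cube by (intro card_inj_on_le) (auto intro!: finite_PiE)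
  also have "\<dots> = n ^ (n ^ d)" by (simp add: card_PiE finite_cube card_cube)
  finally show ?thesis .
qed

section \<open>Small cost of a fixed set of cells\<close>

text \<open>Tilting the standard exponential density by \<open>exp (- l * x)\<close> gives the
  density of rate \<open>1 + l\<close>, up to the factor \<open>1 / (1 + l)\<close>.\<close>

lemma exp_moment:
  assumes D: "distributed M lborel X (\<lambda>t. ennreal (exponential_density 1 t))" and l: "0 < l"
  shows "(\<integral>\<^sup>+\<omega>. ennreal (exp (- l * X \<omega>)) \<partial>M) = ennreal (1 / (1 + l))"
proof -
  have "(\<integral>\<^sup>+\<omega>. ennreal (exp (- l * X \<omega>)) \<partial>M) = (\<integral>\<^sup>+x. ennreal (exponential_density 1 x) * ennreal (exp (- l * x)) \<partial>lborel)"
    by (rule distributed_nn_integral[OF D, symmetric]) simp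
  also have "\<dots> = (\<integral>\<^sup>+x. ennreal (1 / (1 + l)) * ennreal (exponential_density (1 + l) x) \<partial>lborel)"
  proof (rule nn_integral_cong)
    fix x :: real
    have "exponential_density 1 x * exp (- l * x) = 1 / (1 + l) * exponential_density (1 + l) x"
    proof -
      have "exp (- x) * exp (- l * x) = exp (- x * (1 + l))"
        by (simp add: exp_add[symmetric] algebra_simps)
      then show ?thesis using l by (cases "x < 0") (simp_all add: exponential_density_def)
    qed
    then show "ennreal (exponential_density 1 x) * ennreal (exp (- l * x)) = ennreal (1 / (1 + l)) * ennreal (exponential_density (1 + l) x)"
      using l by (simp add: ennreal_mult'[symmetric])
  qed
  also have "\<dots> = ennreal (1 / (1 + l)) * emeasure (density lborel (\<lambda>x. ennreal (exponential_density (1 + l) x))) UNIV"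
    using l by (subst nn_integral_cmult) (auto simp: emeasure_density)
  also have "\<dots> = ennreal (1 / (1 + l))"
    using prob_space.emeasure_space_1[OF prob_space_exponential_density[of "1 + l"]] l by simp
  finally show ?thesis .
qed

text \<open>Chernoff's bound with \<open>l = 4 * n\<close>, the reciprocal of the threshold per
  cell: each cell contributes \<open>exp 1 / (1 + l)\<close>, which is at most
  \<open>exp 1 / l\<close>.\<close>

lemma prob_assignment_cost_small:
  assumes iid: "iid_exp_costs d n M C" and T: "T \<subseteq> cube d n" and n: "1 \<le> n"
  shows "measure M {\<omega> \<in> space M. assignment_cost (\<lambda>x. C x \<omega>) T < card T / (4 * real n)} \<le> (exp 1 / (4 * real n)) ^ card T"
proof -
  interpret prob_space M using iid by (simp add: iid_exp_costs_def)
  define l where "l = 4 * real n"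
  have l: "0 < l" using n by (simp add: l_def)
  have finT: "finite T" using T finite_cube finite_subset by blast
  have ind: "indep_vars (\<lambda>_. borel) C T"
    using iid by (intro indep_vars_subset[OF _ T]) (simp add: iid_exp_costs_def)
  have D: "distributed M lborel (C x) (\<lambda>t. ennreal (exponential_density 1 t))" if "x \<in> T" for x
    using iid T that by (auto simp: iid_exp_costs_def)
  have Cm: "random_variable borel (C x)" if "x \<in> T" for x
    using D[OF that] by (auto simp: distributed_def)
  have Sm [measurable]: "random_variable borel (\<lambda>\<omega>. \<Sum>x\<in>T. C x \<omega>)"
    using Cm by (rule borel_measurable_sum)
  have "emeasure M {\<omega> \<in> space M. (\<Sum>x\<in>T. C x \<omega>) < card T / l}
      \<le> emeasure M {\<omega> \<in> space M. 1 \<le> ennreal (exp (card T)) * ennreal (exp (- l * (\<Sum>x\<in>T. C x \<omega>)))}"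
  proof (intro emeasure_mono subsetI)
    fix \<omega> assume "\<omega> \<in> {\<omega> \<in> space M. (\<Sum>x\<in>T. C x \<omega>) < card T / l}"
    then have \<omega>: "\<omega> \<in> space M" and "l * (\<Sum>x\<in>T. C x \<omega>) < card T" using l by (auto simp: field_simps)
    then have "1 \<le> exp (card T + - l * (\<Sum>x\<in>T. C x \<omega>))" by simp
    then have "1 \<le> exp (card T) * exp (- l * (\<Sum>x\<in>T. C x \<omega>))" by (simp only: exp_add)
    then show "\<omega> \<in> {\<omega> \<in> space M. 1 \<le> ennreal (exp (card T)) * ennreal (exp (- l * (\<Sum>x\<in>T. C x \<omega>)))}"
      using \<omega> by (simp add: ennreal_mult'[symmetric] ennreal_le_iff del: ennreal_1 add: ennreal_1[symmetric])
  qed measurable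
  also have "\<dots> \<le> ennreal (exp (card T)) * (\<integral>\<^sup>+\<omega>. ennreal (exp (- l * (\<Sum>x\<in>T. C x \<omega>))) \<partial>M)"
    using nn_integral_Markov_inequality[of "\<lambda>\<omega>. ennreal (exp (- l * (\<Sum>x\<in>T. C x \<omega>)))" "space M" M "ennreal (exp (card T))"]
    by simp
  also have "(\<integral>\<^sup>+\<omega>. ennreal (exp (- l * (\<Sum>x\<in>T. C x \<omega>))) \<partial>M) = (\<integral>\<^sup>+\<omega>. (\<Prod>x\<in>T. ennreal (exp (- l * C x \<omega>))) \<partial>M)"
    by (intro nn_integral_cong) (simp add: prod_ennreal exp_sum[OF finT] sum_distrib_left)
  also have "\<dots> = (\<Prod>x\<in>T. \<integral>\<^sup>+\<omega>. ennreal (exp (- l * C x \<omega>)) \<partial>M)"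
    using finT indep_vars_compose2[OF ind, where N = "\<lambda>_. borel" and Y = "\<lambda>_ t. ennreal (exp (- l * t))"]
    by (intro indep_vars_nn_integral) auto
  also have "\<dots> = (\<Prod>x\<in>T. ennreal (1 / (1 + l)))" using exp_moment[OF D l] by (intro prod.cong) auto
  also have "ennreal (exp (card T)) * (\<Prod>x\<in>T. ennreal (1 / (1 + l))) \<le> ennreal ((exp 1 / l) ^ card T)"
  proof -
    have "exp (real (card T)) * (1 / (1 + l)) ^ card T = (exp 1 * (1 / (1 + l))) ^ card T"
      using exp_of_nat_mult[of "card T" "1::real"] by (simp only: power_mult_distrib mult_1_right)
    also have "\<dots> \<le> (exp 1 / l) ^ card T"
      using l by (intro power_mono) (auto simp: field_simps)
    finally show ?thesis using l by (simp add: ennreal_power ennreal_mult'[symmetric])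
  qed
  finally show ?thesis by (simp add: emeasure_eq_measure assignment_cost_def l_def)
qed

section \<open>Existence of an assignment and the union bound\<close>

lemma unique_residue:
  fixes n s :: nat
  assumes "1 \<le> n"
  shows "\<exists>!j. j \<in> {1..n} \<and> n dvd s + j"
proof (rule ex1I)
  have "s mod n < n" using assms by simp
  moreover have "s + (n - s mod n) = n * (s div n) + n"
    using mult_div_mod_eq[of n s] \<open>s mod n < n\<close> by linarith
  ultimately show "n - s mod n \<in> {1..n} \<and> n dvd s + (n - s mod n)" by simp
next
  have eq: "i = j" if "i \<in> {1..n}" "j \<in> {1..n}" "n dvd s + i" "n dvd s + j" "i \<le> j" for i j
  proof -
    have "n dvd j - i" using dvd_diff_nat[OF that(4,3)] by simp
    moreover have "j - i < n" using that by auto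
    ultimately have "j - i = 0" using nat_dvd_not_less by blast
    then show ?thesis using that by simp
  qed
  have "s mod n < n" using assms by simp
  moreover have "s + (n - s mod n) = n * (s div n) + n"
    using mult_div_mod_eq[of n s] \<open>s mod n < n\<close> by linarith
  ultimately have k: "n - s mod n \<in> {1..n}" "n dvd s + (n - s mod n)" by simp_all
  fix j assume "j \<in> {1..n} \<and> n dvd s + j"
  then show "j = n - s mod n" using eq[of j "n - s mod n"] eq[of "n - s mod n" j] k by (cases "j \<le> n - s mod n") auto
qed

text \<open>All coordinates but one determine the residue of the remaining one modulo
  \<open>n\<close>, and \<open>1..n\<close> represents each residue once. Only the nonemptiness is
  of interest: it gives the \<open>Min\<close> in \<open>Z_A\<close> its meaning.\<close>

lemma zero_sum_axial:
  assumes n: "1 \<le> n"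
  shows "{x \<in> cube (Suc d) n. n dvd sum_list x} \<in> axial_assignments (Suc d) n"
proof -
  let ?T = "{x \<in> cube (Suc d) n. n dvd sum_list x}"
  have "bij_betw tl ?T (cube d n)"
    unfolding bij_betw_def
  proof
    show "inj_on tl ?T"
    proof (rule inj_onI)
      fix x y assume x: "x \<in> ?T" and y: "y \<in> ?T" and tl: "tl x = tl y"
      obtain i z where i: "x = i # z" using x by (cases x) (auto simp: cube_def)
      obtain j z' where j: "y = j # z'" using y by (cases y) (auto simp: cube_def)
      have "i \<in> {1..n} \<and> n dvd sum_list z + i" "j \<in> {1..n} \<and> n dvd sum_list z + j"
        using x y tl i j by (auto simp: Cons_in_cube add.commute)
      then show "x = y" using unique_residue[OF n, of "sum_list z"] i j tl by auto
    qed
    show "tl ` ?T = cube d n"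
    proof
      show "tl ` ?T \<subseteq> cube d n"
      proof (rule image_subsetI)
        fix x assume x: "x \<in> ?T"
        then obtain i z where "x = i # z" by (cases x) (auto simp: cube_def)
        then show "tl x \<in> cube d n" using x by (simp add: Cons_in_cube)
      qed
      show "cube d n \<subseteq> tl ` ?T"
      proof
        fix y assume y: "y \<in> cube d n"
        obtain j where j: "j \<in> {1..n} \<and> n dvd sum_list y + j"
          using unique_residue[OF n, of "sum_list y"] by (elim ex1E)
        have "j # y \<in> ?T" using j y by (simp add: Cons_in_cube add.commute)
        then show "y \<in> tl ` ?T" by (rule image_eqI[rotated]) simp
      qed
    qed
  qed
  then have card: "card ?T = n ^ d" using bij_betw_same_card card_cube by metis
  have lines: "\<exists>!x. x \<in> ?T \<inter> L" if L0: "L \<in> axis_lines (Suc d) n" for L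
  proof -
    obtain y k where L: "L = (\<lambda>j. y[k := j]) ` {1..n}" and y: "y \<in> cube (Suc d) n" and k: "k < Suc d"
      using L0 unfolding axis_lines_def by blast
    have len: "k < length y" using y k by (simp add: cube_def)
    have in_cube: "y[k := j] \<in> cube (Suc d) n" if "j \<in> {1..n}" for j
      using y that set_update_subset_insert[of y k j] by (auto simp: cube_def)
    have le: "y ! k \<le> sum_list y" using len by (rule elem_le_sum_list)
    have sum: "sum_list (y[k := j]) = (sum_list y - y ! k) + j" for j
      using le by (simp add: sum_list_update[OF len])
    obtain j where j: "j \<in> {1..n} \<and> n dvd (sum_list y - y ! k) + j"
      and uniq: "\<forall>i. i \<in> {1..n} \<and> n dvd (sum_list y - y ! k) + i \<longrightarrow> i = j"
      using unique_residue[OF n, of "sum_list y - y ! k"] by (elim ex1E)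
    show ?thesis
    proof (rule ex1I[of _ "y[k := j]"])
      show "y[k := j] \<in> ?T \<inter> L" using j in_cube[of j] unfolding L by (simp add: sum)
      fix x assume x: "x \<in> ?T \<inter> L"
      then obtain i where i: "i \<in> {1..n}" "x = y[k := i]" unfolding L by blast
      then have "n dvd (sum_list y - y ! k) + i" using x by (simp add: sum)
      then show "x = y[k := j]" using uniq i by blast
    qed
  qed
  show ?thesis
    unfolding axial_assignments_def using card lines by simp
qed

text \<open>With \<open>N = n ^ (d - 1)\<close> the union bound gives at most
  \<open>(n * exp 1 / (4 * n)) ^ N\<close>. The factor 4 in the threshold is there to make the base
  \<open>exp 1 / 4\<close> at most \<open>3/4\<close>, and \<open>N / (4 * n)\<close> is the claimed
  \<open>1/4 * n ^ (d - 2)\<close>.\<close>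

lemma Z_A_lower_whp:
  fixes M :: "nat \<Rightarrow> 'a measure"
  assumes iid: "\<And>n. iid_exp_costs d n (M n) (C n)" and d: "3 \<le> d"
  shows "whp M (\<lambda>n \<omega>. 1/4 * real n ^ (d - 2) \<le> Z_A d n (\<lambda>x. C n x \<omega>))"
  unfolding whp_def
proof (rule tendsto_sandwich)
  let ?A = "\<lambda>n. axial_assignments d n"
  let ?p = "\<lambda>n. measure (M n) {\<omega> \<in> space (M n). 1/4 * real n ^ (d - 2) \<le> Z_A d n (\<lambda>x. C n x \<omega>)}"
  have prob: "prob_space (M n)" for n using iid[of n] by (simp add: iid_exp_costs_def)
  show "\<forall>\<^sub>F n in sequentially. ?p n \<le> 1"
    by (intro always_eventually allI prob_space.prob_le_1 prob)
  have "(\<lambda>n. 1 - (3/4 :: real) ^ n) \<longlonglongrightarrow> 1 - 0"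
    by (intro tendsto_intros LIMSEQ_realpow_zero) auto
  then show "(\<lambda>n. 1 - (3/4 :: real) ^ n) \<longlonglongrightarrow> 1" by simp
  show "(\<lambda>_. 1) \<longlonglongrightarrow> (1::real)" by simp
  show "\<forall>\<^sub>F n in sequentially. 1 - (3/4) ^ n \<le> ?p n"
    using eventually_ge_at_top[of 1]
  proof eventually_elim
    case (elim n)
    interpret prob_space "M n" by (rule prob)
    define m where "m = d - 2"
    have m: "d = Suc (Suc m)" "1 \<le> m" using d by (simp_all add: m_def)
    let ?low = "\<lambda>T. {\<omega> \<in> space (M n). assignment_cost (\<lambda>x. C n x \<omega>) T < card T / (4 * real n)}"
    have card: "card T = n ^ Suc m" "T \<subseteq> cube d n" if "T \<in> ?A n" for T
      using that by (simp_all add: axial_assignments_def m)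
    have bound: "1/4 * real n ^ (d - 2) = card T / (4 * real n)" if "T \<in> ?A n" for T
      using card(1)[OF that] elim by (simp add: m)
    have ne: "?A n \<noteq> {}" using zero_sum_axial[OF elim, of "Suc m"] unfolding m(1) by blast
    have ev: "?low T \<in> events" if T: "T \<in> ?A n" for T
    proof -
      have "random_variable borel (C n x)" if "x \<in> T" for x
        using iid[of n] card(2)[OF T] that by (auto simp: iid_exp_costs_def distributed_def)
      then have "random_variable borel (\<lambda>\<omega>. assignment_cost (\<lambda>x. C n x \<omega>) T)"
        unfolding assignment_cost_def by (rule borel_measurable_sum)
      then show ?thesis by measurable
    qed
    have Z: "1/4 * real n ^ (d - 2) \<le> Z_A d n c \<longleftrightarrow> (\<forall>T\<in>?A n. \<not> assignment_cost c T < card T / (4 * real n))" for c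
    proof -
      have "1/4 * real n ^ (d - 2) \<le> Z_A d n c \<longleftrightarrow> (\<forall>y\<in>assignment_cost c ` ?A n. 1/4 * real n ^ (d - 2) \<le> y)"
        unfolding Z_A_def by (rule Min_ge_iff) (simp_all only: ne finite_axial_assignments finite_imageI image_is_empty not_False_eq_True)
      also have "\<dots> \<longleftrightarrow> (\<forall>T\<in>?A n. 1/4 * real n ^ (d - 2) \<le> assignment_cost c T)" by blast
      also have "\<dots> \<longleftrightarrow> (\<forall>T\<in>?A n. \<not> assignment_cost c T < card T / (4 * real n))"
        by (rule ball_cong[OF refl]) (simp only: bound not_less)
      finally show ?thesis .
    qed
    have "prob (\<Union>T\<in>?A n. ?low T) \<le> (\<Sum>T\<in>?A n. prob (?low T))"
      using finite_axial_assignments ev by (intro finite_measure_subadditive_finite) auto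
    also have "\<dots> \<le> (\<Sum>T\<in>?A n. (exp 1 / (4 * real n)) ^ (n ^ Suc m))"
    proof (rule sum_mono)
      fix T assume T: "T \<in> ?A n"
      show "prob (?low T) \<le> (exp 1 / (4 * real n)) ^ (n ^ Suc m)"
        using prob_assignment_cost_small[OF iid card(2)[OF T] elim] unfolding card(1)[OF T] .
    qed
    also have "\<dots> = card (?A n) * (exp 1 / (4 * real n)) ^ (n ^ Suc m)" by simp
    also have "\<dots> \<le> real (n ^ (n ^ Suc m)) * (exp 1 / (4 * real n)) ^ (n ^ Suc m)"
    proof (rule mult_right_mono)
      show "real (card (?A n)) \<le> real (n ^ (n ^ Suc m))"
        unfolding m(1) of_nat_le_iff by (rule card_axial_assignments[OF elim])
    qed simp
    also have "\<dots> = (real n * (exp 1 / (4 * real n))) ^ (n ^ Suc m)"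
      by (simp only: of_nat_power power_mult_distrib)
    also have "real n * (exp 1 / (4 * real n)) = exp 1 / 4" using elim by simp
    also have "(exp 1 / 4 :: real) ^ (n ^ Suc m) \<le> (3/4) ^ (n ^ Suc m)"
      using exp_le by (intro power_mono) simp_all
    \<comment> \<open>The exponent is weakened to \<open>n\<close>, which still tends to infinity
      and suffices for the limit.\<close>
    also have "(3/4 :: real) ^ (n ^ Suc m) \<le> (3/4) ^ n"
    proof (rule power_decreasing)
      show "n \<le> n ^ Suc m" using self_le_power[OF elim, of "Suc m"] by simp
    qed simp_all
    finally have "prob (\<Union>T\<in>?A n. ?low T) \<le> (3/4) ^ n" .
    moreover have "{\<omega> \<in> space (M n). 1/4 * real n ^ (d - 2) \<le> Z_A d n (\<lambda>x. C n x \<omega>)} = space (M n) - (\<Union>T\<in>?A n. ?low T)"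
      unfolding Z by blast
    moreover have "prob (space (M n) - (\<Union>T\<in>?A n. ?low T)) = 1 - prob (\<Union>T\<in>?A n. ?low T)"
      using ev finite_axial_assignments by (intro prob_compl) auto
    ultimately show ?case by simp
  qed
qed

theorem theorem3:
  shows "(\<forall>d\<ge>3. \<exists>c>0. \<forall>(M :: nat \<Rightarrow> 'a measure) C.
            (\<forall>n. iid_exp_costs d n (M n) (C n)) \<longrightarrow>
            whp M (\<lambda>n \<omega>. Z_A d n (\<lambda>x. C n x \<omega>) \<ge> c * real n ^ (d - 2)))
       \<and> (\<exists>p. polynomial_time 3 p \<and> finds_axial_assignment 3 p \<and>
            (\<exists>K>0. \<forall>(M :: nat \<Rightarrow> 'a measure) C.
               (\<forall>n. iid_exp_costs 3 n (M n) (C n)) \<longrightarrow>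
               whp M (\<lambda>n \<omega>. assignment_cost (\<lambda>x. C n x \<omega>) (program_output 3 p n (\<lambda>x. C n x \<omega>))
                              \<le> K * (real n * ln (real n)))))"
proof (intro conjI)
  show "\<forall>d\<ge>3. \<exists>c>0. \<forall>(M :: nat \<Rightarrow> 'a measure) C.
      (\<forall>n. iid_exp_costs d n (M n) (C n)) \<longrightarrow>
      whp M (\<lambda>n \<omega>. Z_A d n (\<lambda>x. C n x \<omega>) \<ge> c * real n ^ (d - 2))"
    by (intro allI impI exI[of _ "1/4"] conjI Z_A_lower_whp) simp_all
  have "\<exists>K>0. \<forall>(M :: nat \<Rightarrow> 'a measure) C. (\<forall>n. iid_exp_costs 3 n (M n) (C n)) \<longrightarrow>
      whp M (\<lambda>n \<omega>. assignment_cost (\<lambda>x. C n x \<omega>) (program_output 3 latin_prog n (\<lambda>x. C n x \<omega>))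
         \<le> K * (real n * ln (real n)))"
    by (intro exI[of _ 26] conjI allI impI latin_cost_whp) simp_all
  with latin_prog_polynomial_time latin_prog_finds
  show "\<exists>p. polynomial_time 3 p \<and> finds_axial_assignment 3 p \<and>
      (\<exists>K>0. \<forall>(M :: nat \<Rightarrow> 'a measure) C.
         (\<forall>n. iid_exp_costs 3 n (M n) (C n)) \<longrightarrow>
         whp M (\<lambda>n \<omega>. assignment_cost (\<lambda>x. C n x \<omega>) (program_output 3 p n (\<lambda>x. C n x \<omega>))
            \<le> K * (real n * ln (real n))))"
    by (intro exI[of _ latin_prog] conjI)
qed

end
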